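(* Let $f$ be a non-constant entire function with hyper-order $\rho_1(f)<1$, let $c\in\mathbb{C}\setminus\{0\}$, and let $a_1,a_2\in S(f)$ be distinct such that either $a_1$ and $a_2$ are both $c$-periodic, or $a_1'-a_2'$ is non-constant. If $f(z)$ and $f(z+c)$ share $a_1$ and $a_2$ IM, then $f(z)\equiv f(z+c)$.
   Context: Standard Nevanlinna theory notation is used: $T(r,f)$ is the Nevanlinna characteristic of a meromorphic function $f$ on $\mathbb{C}$. $S(r,f)$ denotes any quantity satisfying $S(r,f)=o(T(r,f))$ as $r\to\infty$, possibly outside an exceptional set of finite linear measure. A meromorphic function $a$ on $\mathbb{C}$ is a small function of $f$ if $T(r,a)=S(r,f)$; $S(f)$ denotes the set of small functions of $f$. The hyper-order of $f$ is $\rho_1(f)=\limsup_{r\to\infty}\frac{\log\log T(r,f)}{\log r}$. A function $a$ is $c$-periodic if $a(z+c)\equiv a(z)$. Two meromorphic functions $f,g$ share a small function $a$ IM (ignoring multiplicities) if $f-a$ and $g-a$ have the same zeros, multiplicities being ignored. *)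

theory Defs
  imports "HOL-Complex_Analysis.Complex_Analysis" "HOL-Library.Landau_Symbols"
begin

text \<open>
  Nevanlinna theory for meromorphic functions on the whole plane. A meromorphic function is
  represented by a total function \<open>complex \<Rightarrow> complex\<close> that is \<open>nicely_meromorphic_on UNIV\<close>
  (removable singularities removed, value 0 at the poles), so that two meromorphic functions are
  identical iff their representatives are equal.
\<close>

definition proximity_fun :: "(complex \<Rightarrow> complex) \<Rightarrow> real \<Rightarrow> real" where
  "proximity_fun f r =
     1 / (2 * pi) * integral {0..2 * pi} (\<lambda>\<theta>. ln (max 1 (norm (f (of_real r * cis \<theta>)))))"

text \<open>
  The order of a pole is \<open>- zorder f z\<close>. The index set is finite whenever \<open>f\<close> is meromorphic
  on the plane.
\<close>

definition pole_count :: "(complex \<Rightarrow> complex) \<Rightarrow> real \<Rightarrow> nat" where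
  "pole_count f t = (\<Sum>z\<in>{z. is_pole f z \<and> norm z \<le> t}. nat (- zorder f z))"

definition integrated_pole_count :: "(complex \<Rightarrow> complex) \<Rightarrow> real \<Rightarrow> real" where
  "integrated_pole_count f r =
     integral {0..r} (\<lambda>t. (real (pole_count f t) - real (pole_count f 0)) / t)
       + real (pole_count f 0) * ln r"

definition nevanlinna_char :: "(complex \<Rightarrow> complex) \<Rightarrow> real \<Rightarrow> real" where
  "nevanlinna_char f r = proximity_fun f r + integrated_pole_count f r"

text \<open>
  Only meaningful for non-constant \<open>f\<close>: then \<open>nevanlinna_char f r\<close> tends to infinity with \<open>r\<close>,
  so the iterated logarithm is eventually the genuine one.
\<close>

definition hyper_order :: "(complex \<Rightarrow> complex) \<Rightarrow> ereal" where
  "hyper_order f = Limsup at_top (\<lambda>r. ereal (ln (ln (nevanlinna_char f r)) / ln r))"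

text \<open>\<open>E\<close> is the exceptional set of finite linear measure.\<close>

definition small_functions :: "(complex \<Rightarrow> complex) \<Rightarrow> (complex \<Rightarrow> complex) set" where
  "small_functions f = {a. a nicely_meromorphic_on UNIV \<and>
     (\<exists>E\<in>lmeasurable. nevanlinna_char a \<in> o[inf at_top (principal (- E))](nevanlinna_char f))}"

text \<open>
  The zeros of \<open>h\<close> as a meromorphic function. Limits are used in place of values because \<open>h\<close> will
  be a pointwise difference, whose value at a pole of one of the two terms is meaningless.
\<close>

definition mero_zeros :: "(complex \<Rightarrow> complex) \<Rightarrow> complex set" where
  "mero_zeros h = {z. (h \<longlongrightarrow> 0) (at z)}"

definition share_IM ::
    "(complex \<Rightarrow> complex) \<Rightarrow> (complex \<Rightarrow> complex) \<Rightarrow> (complex \<Rightarrow> complex) \<Rightarrow> bool" where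
  "share_IM f g a \<longleftrightarrow> mero_zeros (\<lambda>z. f z - a z) = mero_zeros (\<lambda>z. g z - a z)"

text \<open>
  Constancy of a meromorphic function, disregarding a closed discrete set of points: \<open>deriv a\<close> has
  no meaningful value at the poles of \<open>a\<close>.
\<close>

definition mero_constant :: "(complex \<Rightarrow> complex) \<Rightarrow> bool" where
  "mero_constant h \<longleftrightarrow> (\<exists>k. \<forall>\<^sub>\<approx>z\<in>UNIV. h z = k)"

end

theory Submission
  imports Defs "HOL-Real_Asymp.Real_Asymp"
begin

text \<open>
  Suppose that \<open>g z = f (z + c)\<close> differs from \<open>f\<close>, and put \<open>U = (f - a2) / (f - a1)\<close> and
  \<open>V = (g - a2) / (g - a1)\<close>. At a shared point where \<open>f\<close> takes the value \<open>a1\<close> or \<open>a2\<close> with multiplicity \<open>m\<close>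
  and \<open>g\<close> with multiplicity \<open>n\<close>, the residues of \<open>U' / U\<close> and \<open>V' / V\<close> are \<open>m\<close> and \<open>n\<close> up to a common
  sign, so \<open>(n U' / U - m V' / V) (f - g)\<close> vanishes there. This function is small, by the lemma on
  the logarithmic derivative and by its difference analogue, which says that \<open>g / f\<close> and \<open>f / g\<close>
  have small proximity functions because the hyper-order is less than 1. If none of these functions
  with \<open>m, n \<le> 4\<close> vanishes identically, then most shared points have \<open>m + n \<ge> 6\<close>, and the second main
  theorem gives \<open>6 T \<le> 4 T + o(T)\<close>. Otherwise \<open>U ^ n = k V ^ m\<close>; comparing characteristics, \<open>n = m\<close>, and
  then \<open>U\<close> is a constant multiple of \<open>V\<close>, which expresses \<open>g\<close> through \<open>g / f\<close>, \<open>1 / f\<close> and small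
  functions and makes \<open>g\<close> small.

  All asymptotic statements are needed only along one sequence of radii that avoids the exceptional
  sets and along which \<open>T\<close> does not grow too fast.
\<close>

subsection \<open>Means over circles\<close>

text \<open>The product with \<open>f - g\<close> is small although \<open>f\<close> is large: where
  \<open>f\<close> is large, \<open>U' / U\<close> decays fast enough to absorb one factor
  \<open>f\<close>, and \<open>f - g = f (1 - g / f)\<close> needs only one. In the same way
  \<open>V' / V\<close> absorbs one factor \<open>g\<close>. At shared points the zero of
  \<open>f - g\<close> cancels the simple pole of \<open>n U' / U - m V' / V\<close>, so the product
  can have poles only where \<open>a1\<close> or \<open>a2\<close> has a pole or
  \<open>a2 - a1\<close> has a zero or pole.

  The bound 4 on the multiplicities comes from the last inequality. Zeros and poles of
  \<open>U\<close> and \<open>V\<close>, with multiplicity, number at most \<open>2 T\<close> for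
  each function, \<open>4 T\<close> in all. Excluding all pairs with \<open>m, n \<le> N\<close>
  leaves \<open>m + n \<ge> N + 2\<close>, which has to exceed 4; \<open>N = 4\<close> gives 6.

  The two quotient estimates differ in strength. For the logarithmic derivative the bound is
  logarithmic in the characteristic at a larger radius \<open>R\<close>; for the shift it is linear,
  multiplied by negative powers of \<open>r\<close> and \<open>R - r\<close>. The latter helps only
  if the characteristics at \<open>r\<close> and \<open>R\<close> are comparable while
  \<open>R - r\<close> is a positive power of \<open>r\<close>, and this is what hyper-order less
  than 1 provides.\<close>

lemma cos_mult_half_pi_pos: "0 < \<alpha> \<Longrightarrow> \<alpha> < 1 \<Longrightarrow> 0 < cos (\<alpha> * pi / 2)"
  by (intro cos_gt_zero) (auto simp: field_simps mult_strict_left_mono)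

definition circle_mean :: "(complex \<Rightarrow> real) \<Rightarrow> real \<Rightarrow> real" where
  "circle_mean u r = 1 / (2 * pi) * integral {0..2 * pi} (\<lambda>\<theta>. u (of_real r * cis \<theta>))"

lemma circle_integrable:
  fixes u :: "complex \<Rightarrow> 'a::banach"
  assumes "continuous_on (sphere 0 r) u" "0 \<le> r"
  shows "(\<lambda>\<theta>. u (of_real r * cis \<theta>)) integrable_on {0..2 * pi}"
  by (intro integrable_continuous_real continuous_on_compose2[OF assms(1)] continuous_intros)
     (use assms(2) in \<open>auto simp: norm_mult\<close>)

lemma circle_mean_cong:
  assumes "\<And>z. norm z = r \<Longrightarrow> u z = v z" "0 \<le> r"
  shows "circle_mean u r = circle_mean v r"
  unfolding circle_mean_def using assms by (auto simp: norm_mult intro!: integral_cong)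

lemma circle_mean_const [simp]: "circle_mean (\<lambda>_. k) r = k"
  by (simp add: circle_mean_def)

lemma circle_mean_add:
  assumes "continuous_on (sphere 0 r) u" "continuous_on (sphere 0 r) v" "0 \<le> r"
  shows "circle_mean (\<lambda>z. u z + v z) r = circle_mean u r + circle_mean v r"
  unfolding circle_mean_def
  by (subst Henstock_Kurzweil_Integration.integral_add)
     (intro circle_integrable assms, intro circle_integrable assms, simp add: algebra_simps add_divide_distrib)

lemma circle_mean_diff:
  assumes "continuous_on (sphere 0 r) u" "continuous_on (sphere 0 r) v" "0 \<le> r"
  shows "circle_mean (\<lambda>z. u z - v z) r = circle_mean u r - circle_mean v r"
  unfolding circle_mean_def
  by (subst Henstock_Kurzweil_Integration.integral_diff)
     (intro circle_integrable assms, intro circle_integrable assms, simp add: algebra_simps diff_divide_distrib)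

lemma circle_mean_cmult: "circle_mean (\<lambda>z. k * u z) r = k * circle_mean u r"
  by (simp add: circle_mean_def)

lemma circle_mean_mono:
  assumes "continuous_on (sphere 0 r) u" "continuous_on (sphere 0 r) v" "0 \<le> r"
    and "\<And>z. norm z = r \<Longrightarrow> u z \<le> v z"
  shows "circle_mean u r \<le> circle_mean v r"
  unfolding circle_mean_def using assms
  by (intro mult_left_mono integral_le circle_integrable) (auto simp: norm_mult)

lemma circle_mean_nonneg:
  assumes "continuous_on (sphere 0 r) u" "0 \<le> r" "\<And>z. norm z = r \<Longrightarrow> 0 \<le> u z"
  shows "0 \<le> circle_mean u r"
  using circle_mean_mono[of r "\<lambda>_. 0" u] assms by simp

lemma circle_mean_sum:
  assumes "finite A" "\<And>a. a \<in> A \<Longrightarrow> continuous_on (sphere 0 r) (u a)" "0 \<le> r"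
  shows "circle_mean (\<lambda>z. \<Sum>a\<in>A. u a z) r = (\<Sum>a\<in>A. circle_mean (u a) r)"
  using assms(1,2)
proof (induction rule: finite_induct)
  case (insert a A)
  then show ?case
    by (subst sum.insert, simp, simp, subst circle_mean_add) (auto intro!: continuous_on_sum \<open>0 \<le> r\<close>)
qed simp

section \<open>Cauchy and Poisson integrals in mean value form\<close>

lemma cauchy_circle_mean:
  fixes f :: "complex \<Rightarrow> complex"
  assumes "continuous_on (cball 0 r) f" "f holomorphic_on ball 0 r" "norm w < r"
  shows "((\<lambda>\<theta>. f (of_real r * cis \<theta>) * (of_real r * cis \<theta>) / (of_real r * cis \<theta> - w))
           has_integral (2 * pi * f w)) {0..2 * pi}"
proof -
  have "((\<lambda>u. f u / (u - w)) has_contour_integral (2 * of_real pi * \<i> * f w)) (circlepath 0 r)"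
    by (rule Cauchy_integral_circlepath) (use assms in auto)
  then have "((\<lambda>t. f (of_real r * cis t) / (of_real r * cis t - w) * r * \<i> * cis t)
      has_integral (2 * of_real pi * \<i> * f w)) {0..2 * pi}"
    unfolding circlepath_def by (subst (asm) has_contour_integral_part_circlepath_iff) simp_all
  \<comment> \<open>Parametrising the circle gives \<open>dz = \<i> z d\<theta>\<close>; removing
    \<open>\<i>\<close> leaves the extra factor \<open>z\<close> in the integrand.\<close>
  from has_integral_mult_right[OF this, of "-\<i>"] show ?thesis
    by (simp add: algebra_simps)
qed

lemma holomorphic_circle_mean:
  fixes f :: "complex \<Rightarrow> complex"
  assumes "continuous_on (cball 0 r) f" "f holomorphic_on ball 0 r" "0 < r"
  shows "((\<lambda>\<theta>. f (of_real r * cis \<theta>)) has_integral (2 * pi * f 0)) {0..2 * pi}"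
  using cauchy_circle_mean[OF assms(1,2), of 0] assms(3) by simp

lemma circle_mean_Re:
  fixes f :: "complex \<Rightarrow> complex"
  assumes "continuous_on (cball 0 r) f" "f holomorphic_on ball 0 r" "0 < r"
  shows "circle_mean (\<lambda>z. Re (f z)) r = Re (f 0)"
proof -
  have "((\<lambda>\<theta>. Re (f (of_real r * cis \<theta>))) has_integral Re (2 * pi * f 0)) {0..2 * pi}"
    using has_integral_Re[OF holomorphic_circle_mean[OF assms]] .
  then show ?thesis unfolding circle_mean_def by (simp add: integral_unique)
qed

text \<open>The conjugate of \<open>f\<close> contributes nothing to the Cauchy integral of the derivative, since
  \<open>cnj z = r\<^sup>2 / z\<close> on the circle; so the derivative is expressed through \<open>Re f\<close> alone.\<close>

lemma deriv_circle_mean_Re: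
  fixes f :: "complex \<Rightarrow> complex"
  assumes "continuous_on (cball 0 r) f" "f holomorphic_on ball 0 r" "norm w < r"
  shows "((\<lambda>\<theta>. 2 * Re (f (of_real r * cis \<theta>)) * (of_real r * cis \<theta>) / (of_real r * cis \<theta> - w)^2)
           has_integral (2 * pi * deriv f w)) {0..2 * pi}"
proof -
  have r: "0 < r" using assms(3) norm_ge_zero[of w] by linarith
  have "((\<lambda>u. f u / (u - w)^2) has_contour_integral (2 * of_real pi * \<i> * deriv f w)) (circlepath 0 r)"
    using Cauchy_has_contour_integral_higher_derivative_circlepath[of 0 r f w 1] assms
    by (simp add: power2_eq_square)
  then have "((\<lambda>t. f (of_real r * cis t) / (of_real r * cis t - w)^2 * r * \<i> * cis t)
      has_integral (2 * of_real pi * \<i> * deriv f w)) {0..2 * pi}"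
    unfolding circlepath_def by (subst (asm) has_contour_integral_part_circlepath_iff) simp_all
  from has_integral_mult_right[OF this, of "-\<i>"]
  have 1: "((\<lambda>\<theta>. f (of_real r * cis \<theta>) * (of_real r * cis \<theta>) / (of_real r * cis \<theta> - w)^2)
           has_integral (2 * pi * deriv f w)) {0..2 * pi}"
    by (simp add: algebra_simps)
  \<comment> \<open>On the circle, \<open>cnj g\<close> is the Cauchy kernel with
    \<open>cnj f\<close> in place of \<open>f\<close>. The pole of \<open>g\<close> lies outside the
    disc, and the factor \<open>z\<close> makes \<open>g 0 = 0\<close>, so the mean
    vanishes.\<close>
  define g where "g = (\<lambda>z. f z * (of_real (r^2) * z) / (of_real (r^2) - cnj w * z)^2)"
  have nz: "of_real (r^2) - cnj w * z \<noteq> 0" if "norm z \<le> r" for z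
  proof
    assume "of_real (r^2) - cnj w * z = 0"
    then have "r^2 = norm (cnj w * z)"
      by (metis eq_iff_diff_eq_0 norm_of_real abs_of_nonneg zero_le_power2)
    also have "\<dots> \<le> norm w * r" using that by (simp add: norm_mult mult_left_mono)
    also have "\<dots> < r * r" using assms(3) r by simp
    finally show False by (simp add: power2_eq_square)
  qed
  have "continuous_on (cball 0 r) g" unfolding g_def
    by (intro continuous_intros assms(1)) (use nz in auto)
  moreover have "g holomorphic_on ball 0 r" unfolding g_def
    by (intro holomorphic_intros assms(2)) (use nz in auto)
  ultimately have "((\<lambda>\<theta>. g (of_real r * cis \<theta>)) has_integral (2 * pi * g 0)) {0..2 * pi}"
    using r by (rule holomorphic_circle_mean)
  then have "((\<lambda>\<theta>. cnj (g (of_real r * cis \<theta>))) has_integral 0) {0..2 * pi}"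
    using has_integral_cnj[of "\<lambda>\<theta>. g (of_real r * cis \<theta>)" 0 "{0..2 * pi}"] by (simp add: g_def o_def)
  moreover have "cnj (g (of_real r * cis \<theta>)) =
      cnj (f (of_real r * cis \<theta>)) * (of_real r * cis \<theta>) / (of_real r * cis \<theta> - w)^2" for \<theta>
  proof -
    define z where "z = of_real r * cis \<theta>"
    have z: "z \<noteq> 0" "cnj z * z = of_real (r^2)" "norm z = r"
      using r by (auto simp: z_def norm_mult power2_eq_square cis_cnj cis_mult)
    have "z - w \<noteq> 0" using assms(3) z by auto
    have "of_real (r^2) * cnj z / (of_real (r^2) - w * cnj z)^2 = z / (z - w)^2"
    proof -
      have "of_real (r^2) - w * cnj z = cnj z * (z - w)"
        unfolding z(2)[symmetric] by (simp add: algebra_simps)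
      then have "of_real (r^2) * cnj z / (of_real (r^2) - w * cnj z)^2
          = (cnj z * z * cnj z) / (cnj z * (z - w))^2"
        by (simp only: z(2))
      also have "\<dots> = z / (z - w)^2"
        using z(1) by (simp add: power_mult_distrib power2_eq_square)
      finally show ?thesis .
    qed
    then have "cnj (f z) * (of_real (r^2) * cnj z / (of_real (r^2) - w * cnj z)^2) = cnj (f z) * (z / (z - w)^2)"
      by (simp only:)
    then show ?thesis unfolding g_def z_def[symmetric] by simp
  qed
  ultimately have "((\<lambda>\<theta>. cnj (f (of_real r * cis \<theta>)) * (of_real r * cis \<theta>) / (of_real r * cis \<theta> - w)^2)
      has_integral 0) {0..2 * pi}" by simp
  from has_integral_add[OF 1 this] show ?thesis
    by (simp add: complex_add_cnj flip: add_divide_distrib distrib_right)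
qed

text \<open>The real part of \<open>(w + z) / (w - z)\<close> is
  \<open>(R^2 - r^2) / norm (w - z)^2\<close>, and this function is holomorphic for
  \<open>norm z < R\<close> with value 1 at the centre. The average runs over the inner variable
  \<open>z\<close>, not over the boundary point \<open>w\<close>.\<close>

lemma circle_mean_Poisson:
  fixes w :: complex
  assumes "norm w = R" "0 < r" "r < R"
  shows "circle_mean (\<lambda>z. 1 / norm (w - z)^2) r = 1 / (R^2 - r^2)"
proof -
  have wz: "w - z \<noteq> 0" if "norm z \<le> r" for z :: complex using that assms by auto
  have "circle_mean (\<lambda>z::complex. Re ((w + z) / (w - z))) r = Re ((w + 0) / (w - 0))"
    by (intro circle_mean_Re continuous_intros holomorphic_intros assms) (use wz in auto)
  moreover have "circle_mean (\<lambda>z. Re ((w + z) / (w - z))) r = circle_mean (\<lambda>z. (R^2 - r^2) * (1 / norm (w - z)^2)) r"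
  proof (rule circle_mean_cong)
    fix z :: complex assume "norm z = r"
    then have R: "R^2 = Re w^2 + Im w^2" and r: "r^2 = Re z^2 + Im z^2"
      using assms(1) by (auto simp: cmod_def)
    show "Re ((w + z) / (w - z)) = (R^2 - r^2) * (1 / norm (w - z)^2)"
      unfolding R r by (simp add: Re_divide cmod_power2) (simp add: power2_eq_square algebra_simps)
  qed (use assms in auto)
  moreover have "w \<noteq> 0" using assms by auto
  moreover have "R^2 - r^2 \<noteq> 0" using assms
    by (metis eq_iff_diff_eq_0 less_eq_real_def linorder_neq_iff power2_eq_imp_eq norm_ge_zero)
  ultimately show ?thesis unfolding circle_mean_cmult by (simp add: field_simps)
qed

text \<open>\<open>1 - k * z\<close> stays in the right half-plane, so its power with exponent
  \<open>- \<alpha>\<close> stays in a sector of half-angle \<open>\<alpha> * pi / 2\<close>. There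
  the modulus is at most the real part divided by \<open>cos (\<alpha> * pi / 2)\<close>, and the
  real part has mean 1.\<close>

lemma sector_circle_mean_le:
  assumes \<alpha>: "0 < \<alpha>" "\<alpha> < 1" and r: "0 < r" and k: "norm k * r < 1"
  shows "circle_mean (\<lambda>z. norm (1 - k * z) powr (-\<alpha>)) r \<le> 1 / cos (\<alpha> * pi / 2)"
proof -
  define g where "g = (\<lambda>z. exp (- of_real \<alpha> * Ln (1 - k * z)))"
  have pos: "Re (1 - k * z) > 0" if "norm z \<le> r" for z :: complex
  proof -
    have "Re (k * z) \<le> norm (k * z)" by (rule complex_Re_le_cmod)
    also have "\<dots> \<le> norm k * r" using that by (simp add: norm_mult mult_left_mono)
    finally show ?thesis using k by simp
  qed
  then have nn: "1 - k * z \<notin> \<real>\<^sub>\<le>\<^sub>0" if "norm z \<le> r" for z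
    using that by (auto simp: complex_nonpos_Reals_iff dest: pos)
  have nz: "1 - k * z \<noteq> 0" if "norm z \<le> r" for z :: complex
    using pos[OF that] by force
  have cg: "continuous_on (cball 0 r) g" unfolding g_def
    by (intro continuous_intros) (use nn in auto)
  have "g holomorphic_on ball 0 r" unfolding g_def
    by (intro holomorphic_intros) (use nn in auto)
  then have mg: "circle_mean (\<lambda>z. Re (g z)) r = 1"
    by (subst circle_mean_Re[OF cg _ r]) (auto simp: g_def)
  have c: "0 < cos (\<alpha> * pi / 2)" by (rule cos_mult_half_pi_pos[OF \<alpha>])
  have "circle_mean (\<lambda>z. norm (1 - k * z) powr (-\<alpha>)) r \<le> circle_mean (\<lambda>z. 1 / cos (\<alpha> * pi / 2) * Re (g z)) r"
  proof (rule circle_mean_mono)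
    show "continuous_on (sphere 0 r) (\<lambda>z. norm (1 - k * z) powr (-\<alpha>))"
      by (intro continuous_intros) (use nz in auto)
    show "continuous_on (sphere 0 r) (\<lambda>z. 1 / cos (\<alpha> * pi / 2) * Re (g z))"
      by (intro continuous_intros continuous_on_subset[OF cg]) auto
    fix z :: complex assume z: "norm z = r"
    define y where "y = Im (Ln (1 - k * z))"
    have p: "Re (1 - k * z) > 0" using pos z by simp
    then have nz: "1 - k * z \<noteq> 0" by force
    have y: "\<bar>y\<bar> < pi / 2" unfolding y_def using Re_Ln_pos_lt_imp[OF p] by simp
    have "Re (g z) = norm (1 - k * z) powr (-\<alpha>) * cos (\<alpha> * y)"
      using nz unfolding g_def y_def powr_def by (simp add: Re_exp)
    moreover have "cos (\<alpha> * pi / 2) \<le> cos (\<alpha> * \<bar>y\<bar>)"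
    proof (rule cos_monotone_0_pi_le)
      show "\<alpha> * \<bar>y\<bar> \<le> \<alpha> * pi / 2" using y \<alpha> mult_left_mono[of "\<bar>y\<bar>" "pi / 2" \<alpha>] by simp
      show "\<alpha> * pi / 2 \<le> pi" using \<alpha> mult_right_mono[of \<alpha> 2 pi] by simp
    qed (use \<alpha> in auto)
    moreover have "cos (\<alpha> * \<bar>y\<bar>) = cos (\<alpha> * y)" by (cases "y \<ge> 0") (auto simp: abs_if)
    ultimately show "norm (1 - k * z) powr (-\<alpha>) \<le> 1 / cos (\<alpha> * pi / 2) * Re (g z)"
      using c mult_left_mono[of "cos (\<alpha> * pi / 2)" "cos (\<alpha> * y)" "norm (1 - k * z) powr (-\<alpha>)"]
      by (simp add: field_simps)
  qed (use r in auto)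
  then show ?thesis unfolding circle_mean_cmult mg by simp
qed

text \<open>A zero \<open>b\<close> inside the disc is traded for its reflection outside at the
  price of a factor \<open>r\<close>, so that mean value arguments for zero-free functions
  apply.\<close>

lemma reflect_circle:
  fixes b z :: complex
  assumes "norm z = r" "0 < r"
  shows "norm (z - b) = r * norm (1 - cnj b / of_real (r^2) * z)"
proof -
  have z: "z \<noteq> 0" "z * cnj z = of_real (r^2)" using assms by (auto simp flip: complex_norm_square)
  have "cnj (z - b) * z = of_real (r^2) * (1 - cnj b / of_real (r^2) * z)"
    using assms z by (simp add: algebra_simps)
  then have "norm (cnj (z - b) * z) = r^2 * norm (1 - cnj b / of_real (r^2) * z)"
    by (simp only: norm_mult norm_of_real) simp
  moreover have "norm (cnj (z - b) * z) = norm (z - b) * r" using assms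
    by (simp only: norm_mult complex_mod_cnj)
  ultimately show ?thesis using assms by (simp add: power2_eq_square)
qed

text \<open>The bound is uniform in the distance of \<open>b\<close> from the circle. This is what
  \<open>\<alpha> < 1\<close> buys: with exponent 1 the mean is unbounded as \<open>b\<close>
  approaches the circle.\<close>

lemma circle_mean_powr_le:
  assumes \<alpha>: "0 < \<alpha>" "\<alpha> < 1" and r: "0 < r" and b: "norm b \<noteq> r"
  shows "circle_mean (\<lambda>z. norm (z - b) powr (-\<alpha>)) r \<le> r powr (-\<alpha>) / cos (\<alpha> * pi / 2)"
proof (cases "norm b < r")
  case True
  have "circle_mean (\<lambda>z. norm (z - b) powr (-\<alpha>)) r
      = circle_mean (\<lambda>z. r powr (-\<alpha>) * norm (1 - cnj b / of_real (r^2) * z) powr (-\<alpha>)) r"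
    using r by (intro circle_mean_cong) (simp_all only: reflect_circle[OF _ r] powr_mult norm_ge_zero less_imp_le)
  also have "\<dots> = r powr (-\<alpha>) * circle_mean (\<lambda>z. norm (1 - cnj b / of_real (r^2) * z) powr (-\<alpha>)) r"
    by (rule circle_mean_cmult)
  also have "\<dots> \<le> r powr (-\<alpha>) * (1 / cos (\<alpha> * pi / 2))"
    using True r by (intro mult_left_mono sector_circle_mean_le \<alpha> r)
      (auto simp: norm_divide norm_mult power2_eq_square)
  finally show ?thesis by simp
next
  case False
  then have br: "norm b > r" and b0: "b \<noteq> 0" using b r by auto
  have c: "0 < cos (\<alpha> * pi / 2)" by (rule cos_mult_half_pi_pos[OF \<alpha>])
  have "norm (z - b) = norm b * norm (1 - 1 / b * z)" for z
    unfolding norm_mult[symmetric] using b0 by (simp add: algebra_simps norm_minus_commute)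
  then have "circle_mean (\<lambda>z. norm (z - b) powr (-\<alpha>)) r
      = norm b powr (-\<alpha>) * circle_mean (\<lambda>z. norm (1 - 1 / b * z) powr (-\<alpha>)) r"
    by (simp add: powr_mult circle_mean_cmult)
  also have "\<dots> \<le> norm b powr (-\<alpha>) * (1 / cos (\<alpha> * pi / 2))"
    using br r b0 by (intro mult_left_mono sector_circle_mean_le \<alpha> r) (auto simp: norm_divide field_simps)
  also have "\<dots> \<le> r powr (-\<alpha>) * (1 / cos (\<alpha> * pi / 2))"
    using br r c \<alpha> by (intro mult_right_mono powr_mono2') auto
  finally show ?thesis by simp
qed

lemma circle_mean_ln_one_minus:
  assumes r: "0 < r" and k: "norm k * r < 1"
  shows "circle_mean (\<lambda>z. ln (norm (1 - k * z))) r = 0"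
proof -
  have pos: "Re (1 - k * z) > 0" if "norm z \<le> r" for z :: complex
  proof -
    have "Re (k * z) \<le> norm (k * z)" by (rule complex_Re_le_cmod)
    also have "\<dots> \<le> norm k * r" using that by (simp add: norm_mult mult_left_mono)
    finally show ?thesis using k by simp
  qed
  then have nn: "1 - k * z \<notin> \<real>\<^sub>\<le>\<^sub>0" if "norm z \<le> r" for z
    using that by (auto simp: complex_nonpos_Reals_iff dest: pos)
  have nz: "1 - k * z \<noteq> 0" if "norm z \<le> r" for z :: complex
    using pos[OF that] by force
  have "circle_mean (\<lambda>z. ln (norm (1 - k * z))) r = circle_mean (\<lambda>z. Re (Ln (1 - k * z))) r"
    using r nz by (intro circle_mean_cong) auto
  also have "\<dots> = Re (Ln (1 - k * 0))"
    by (intro circle_mean_Re continuous_intros holomorphic_intros r) (use nn in auto)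
  finally show ?thesis by simp
qed

text \<open>Jensen's formula for one linear factor: after reflection, or after division by
  \<open>b\<close>, the remaining factor is zero-free in the disc and its logarithm has mean
  0.\<close>

lemma circle_mean_ln_dist:
  assumes r: "0 < r" and b: "norm b \<noteq> r"
  shows "circle_mean (\<lambda>z. ln (norm (z - b))) r = ln (max r (norm b))"
proof (cases "norm b < r")
  case True
  have k: "norm (cnj b / of_real (r^2)) * r < 1"
    using True r by (auto simp: norm_divide norm_mult power2_eq_square)
  have nz: "1 - cnj b / of_real (r^2) * z \<noteq> 0" if "norm z = r" for z
  proof
    assume "1 - cnj b / of_real (r^2) * z = 0"
    then have "norm (cnj b / of_real (r^2) * z) = 1" by (metis eq_iff_diff_eq_0 norm_one)
    then show False using k that by (simp only: norm_mult)
  qed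
  have "circle_mean (\<lambda>z. ln (norm (z - b))) r
      = circle_mean (\<lambda>z. ln r + ln (norm (1 - cnj b / of_real (r^2) * z))) r"
    using r nz by (intro circle_mean_cong) (simp_all only: reflect_circle[OF _ r] ln_mult zero_less_norm_iff norm_eq_zero less_imp_le, simp_all)
  also have "\<dots> = ln r + circle_mean (\<lambda>z. ln (norm (1 - cnj b / of_real (r^2) * z))) r"
    using r nz by (subst circle_mean_add) (auto intro!: continuous_intros)
  also have "\<dots> = ln r" using circle_mean_ln_one_minus[OF r k] by simp
  finally show ?thesis using True by simp
next
  case False
  then have br: "norm b > r" and b0: "b \<noteq> 0" using b r by auto
  have k: "norm (1 / b) * r < 1" using br r b0 by (auto simp: norm_divide field_simps)
  have nz: "1 - 1 / b * z \<noteq> 0" if "norm z = r" for z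
    using that br b0 by auto
  have "norm (z - b) = norm b * norm (1 - 1 / b * z)" for z
    unfolding norm_mult[symmetric] using b0 by (simp add: algebra_simps norm_minus_commute)
  then have "circle_mean (\<lambda>z. ln (norm (z - b))) r = circle_mean (\<lambda>z. ln (norm b) + ln (norm (1 - 1 / b * z))) r"
    using r nz b0 by (intro circle_mean_cong) (auto simp: ln_mult)
  also have "\<dots> = ln (norm b) + circle_mean (\<lambda>z. ln (norm (1 - 1 / b * z))) r"
    using r nz br b0 by (subst circle_mean_add) (auto intro!: continuous_intros)
  also have "\<dots> = ln (norm b)" using circle_mean_ln_one_minus[OF r k] by simp
  finally show ?thesis using False br by simp
qed

lemma circle_mean_swap:
  fixes K :: "complex \<Rightarrow> complex \<Rightarrow> real"
  assumes "continuous_on (sphere 0 r \<times> sphere 0 R) (\<lambda>(z, w). K z w)" "0 \<le> r" "0 \<le> R"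
  shows "circle_mean (\<lambda>z. circle_mean (K z) R) r = circle_mean (\<lambda>w. circle_mean (\<lambda>z. K z w) r) R"
proof -
  have "continuous_on (cbox (0, 0) (2 * pi, 2 * pi))
      (\<lambda>x. (\<lambda>(z, w). K z w) (of_real r * cis (fst x), of_real R * cis (snd x)))"
    by (rule continuous_on_compose2[OF assms(1)]) (use assms in \<open>auto intro!: continuous_intros simp: norm_mult\<close>)
  then have c: "continuous_on (cbox (0, 0) (2 * pi, 2 * pi))
      (\<lambda>(s, t). K (of_real r * cis s) (of_real R * cis t))"
    by (simp add: case_prod_unfold)
  show ?thesis unfolding circle_mean_def
    using integral_swap_continuous[OF c] by (simp add: cbox_interval)
qed

subsection \<open>Divisors and Jensen's formula\<close>

definition log_plus :: "complex \<Rightarrow> real" where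
  "log_plus z = ln (max 1 (norm z))"

lemma log_plus_nonneg [simp]: "0 \<le> log_plus z"
  by (simp add: log_plus_def)

lemma proximity_eq_circle_mean: "proximity_fun f r = circle_mean (\<lambda>z. log_plus (f z)) r"
  by (simp add: proximity_fun_def circle_mean_def log_plus_def)

lemma log_plus_mult: "log_plus (x * y) \<le> log_plus x + log_plus y"
proof -
  have "max 1 (norm (x * y)) \<le> max 1 (norm x) * max 1 (norm y)"
    unfolding norm_mult
    by (intro max.boundedI mult_mono) (auto intro: order_trans[OF _ mult_mono[of 1 _ 1]])
  then have "ln (max 1 (norm (x * y))) \<le> ln (max 1 (norm x) * max 1 (norm y))" by (subst ln_le_cancel_iff) auto
  also have "\<dots> = ln (max 1 (norm x)) + ln (max 1 (norm y))" by (rule ln_mult_pos) auto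
  finally show ?thesis by (simp add: log_plus_def)
qed

lemma log_plus_add: "log_plus (x + y) \<le> log_plus x + log_plus y + ln 2"
proof -
  have "max 1 (norm (x + y)) \<le> max 1 (norm x) * max 1 (norm y) * 2"
  proof -
    define p q where "p = max 1 (norm x)" and "q = max 1 (norm y)"
    have pq: "1 \<le> p" "1 \<le> q" by (auto simp: p_def q_def)
    have "norm (x + y) \<le> p + q"
      by (rule order_trans[OF norm_triangle_ineq]) (auto simp: p_def q_def)
    moreover have "p \<le> p * q" "q \<le> p * q" "1 \<le> p * q"
      using pq mult_mono[of 1 p 1 q] by auto
    ultimately have "norm (x + y) \<le> p * q * 2" by linarith
    with \<open>1 \<le> p * q\<close> show ?thesis unfolding p_def q_def by simp
  qed
  then have "ln (max 1 (norm (x + y))) \<le> ln (max 1 (norm x) * max 1 (norm y) * 2)" by (subst ln_le_cancel_iff) auto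
  also have "\<dots> = ln (max 1 (norm x)) + ln (max 1 (norm y)) + ln 2"
    by (subst ln_mult_pos, simp, simp, subst ln_mult_pos) auto
  finally show ?thesis by (simp add: log_plus_def)
qed

lemma log_plus_minus [simp]: "log_plus (- x) = log_plus x"
  by (simp add: log_plus_def)

lemma log_plus_diff: "log_plus (x - y) \<le> log_plus x + log_plus y + ln 2"
  using log_plus_add[of x "-y"] by simp

lemma log_plus_power: "log_plus (x ^ n) = n * log_plus x"
proof -
  have "max 1 (norm (x ^ n)) = max 1 (norm x) ^ n"
    by (cases "norm x \<ge> 1") (auto simp: norm_power max_def power_le_one_iff power_le_one
      intro: antisym one_le_power power_le_one)
  then show ?thesis by (simp add: log_plus_def ln_realpow)
qed

lemma ln_norm_eq_log_plus: "z \<noteq> 0 \<Longrightarrow> ln (norm z) = log_plus z - log_plus (inverse z)"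
  by (cases "norm z \<le> 1") (auto simp: log_plus_def norm_inverse ln_inverse max_def one_le_inverse_iff)

lemma abs_ln_norm_eq_log_plus: "z \<noteq> 0 \<Longrightarrow> \<bar>ln (norm z)\<bar> = log_plus z + log_plus (inverse z)"
  by (cases "norm z \<le> 1") (auto simp: log_plus_def norm_inverse ln_inverse max_def one_le_inverse_iff)

lemma ln_power_int: "0 < (x::real) \<Longrightarrow> ln (x powi n) = of_int n * ln x"
  by (simp add: powr_real_of_int' [symmetric] ln_powr)

lemma continuous_on_log_plus [continuous_intros]:
  "continuous_on S f \<Longrightarrow> continuous_on S (\<lambda>z. log_plus (f z))"
  unfolding log_plus_def by (intro continuous_intros) (auto simp: max_def)

section \<open>Meromorphic functions without singularities or zeros off an exceptional set\<close>

definition regular_off :: "complex set \<Rightarrow> (complex \<Rightarrow> complex) \<Rightarrow> bool" where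
  "regular_off B h \<longleftrightarrow> h meromorphic_on UNIV \<and> (\<forall>z. z \<notin> B \<longrightarrow> h analytic_on {z})"

text \<open>Values at points of \<open>B\<close> are unconstrained, so that pointwise sums, products
  and quotients can be used without first removing singularities.\<close>

definition unit_off :: "complex set \<Rightarrow> (complex \<Rightarrow> complex) \<Rightarrow> bool" where
  "unit_off B h \<longleftrightarrow> regular_off B h \<and> (\<forall>z. z \<notin> B \<longrightarrow> h z \<noteq> 0)"

lemma unit_off_imp_regular: "unit_off B h \<Longrightarrow> regular_off B h"
  by (simp add: unit_off_def)

lemma regular_off_analytic: "regular_off B h \<Longrightarrow> z \<notin> B \<Longrightarrow> h analytic_on {z}"
  by (simp add: regular_off_def)

lemma unit_off_nonzero: "unit_off B h \<Longrightarrow> z \<notin> B \<Longrightarrow> h z \<noteq> 0"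
  by (simp add: unit_off_def)

lemma regular_off_mero: "regular_off B h \<Longrightarrow> h meromorphic_on A"
  using meromorphic_on_subset[of h UNIV A] by (simp add: regular_off_def)

lemma regular_off_const: "regular_off B (\<lambda>_. k)"
  by (auto simp: regular_off_def)

lemma regular_off_add: "regular_off B g \<Longrightarrow> regular_off B h \<Longrightarrow> regular_off B (\<lambda>z. g z + h z)"
  by (auto simp: regular_off_def intro!: meromorphic_intros analytic_intros)

lemma regular_off_diff: "regular_off B g \<Longrightarrow> regular_off B h \<Longrightarrow> regular_off B (\<lambda>z. g z - h z)"
  by (auto simp: regular_off_def intro!: meromorphic_intros analytic_intros)

lemma regular_off_mult: "regular_off B g \<Longrightarrow> regular_off B h \<Longrightarrow> regular_off B (\<lambda>z. g z * h z)"
  by (auto simp: regular_off_def intro!: meromorphic_intros analytic_intros)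

lemma regular_off_power: "regular_off B g \<Longrightarrow> regular_off B (\<lambda>z. g z ^ n)"
  by (auto simp: regular_off_def intro!: meromorphic_intros analytic_intros)

lemma regular_off_deriv: "regular_off B g \<Longrightarrow> regular_off B (deriv g)"
  by (auto simp: regular_off_def intro!: meromorphic_intros analytic_deriv)

lemma regular_off_divide: "regular_off B g \<Longrightarrow> unit_off B h \<Longrightarrow> regular_off B (\<lambda>z. g z / h z)"
  by (auto simp: regular_off_def unit_off_def intro!: meromorphic_intros analytic_intros)

lemma unit_off_mult: "unit_off B g \<Longrightarrow> unit_off B h \<Longrightarrow> unit_off B (\<lambda>z. g z * h z)"
  by (auto simp: unit_off_def regular_off_mult)

lemma unit_off_power: "unit_off B g \<Longrightarrow> unit_off B (\<lambda>z. g z ^ n)"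
  by (auto simp: unit_off_def regular_off_power)

lemma unit_off_divide: "unit_off B g \<Longrightarrow> unit_off B h \<Longrightarrow> unit_off B (\<lambda>z. g z / h z)"
  by (auto simp: unit_off_def regular_off_divide)

lemma unit_off_inverse: "unit_off B h \<Longrightarrow> unit_off B (\<lambda>z. inverse (h z))"
  by (auto simp: unit_off_def regular_off_def intro!: meromorphic_intros analytic_intros)

lemma regular_off_continuous:
  "regular_off B h \<Longrightarrow> S \<inter> B = {} \<Longrightarrow> continuous_on S h"
  by (intro continuous_at_imp_continuous_on ballI analytic_at_imp_isCont) (auto simp: regular_off_def)

lemma continuous_on_ln_norm_unit:
  "unit_off B h \<Longrightarrow> S \<inter> B = {} \<Longrightarrow> continuous_on S (\<lambda>z. ln (norm (h z)))"
  by (intro continuous_intros regular_off_continuous[OF unit_off_imp_regular]) (auto simp: unit_off_def)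

text \<open>On a disc a zero-free holomorphic function is \<open>exp g\<close>, and
  \<open>ln (norm (H z))\<close> is the real part of \<open>g\<close>.\<close>

lemma holomorphic_nonvanishing_ln_mean:
  assumes "H holomorphic_on ball 0 R" "\<And>z. norm z < R \<Longrightarrow> H z \<noteq> 0" "0 < r" "r < R"
  shows "circle_mean (\<lambda>z. ln (norm (H z))) r = ln (norm (H 0))"
proof -
  obtain g where g: "g holomorphic_on ball 0 R" "\<And>z. z \<in> ball 0 R \<Longrightarrow> H z = exp (g z)"
    using contractible_imp_holomorphic_log[OF assms(1)] assms(2) convex_imp_contractible[of "ball 0 R"] by auto
  have "circle_mean (\<lambda>z. ln (norm (H z))) r = circle_mean (\<lambda>z. Re (g z)) r"
    using assms(3,4) g(2) by (intro circle_mean_cong) auto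
  also have "\<dots> = Re (g 0)"
    using assms(3,4) by (intro circle_mean_Re holomorphic_on_imp_continuous_on holomorphic_on_subset[OF g(1)]) auto
  finally show ?thesis using g(2)[of 0] assms(3,4) by simp
qed

lemma isolated_mero: "h meromorphic_on UNIV \<Longrightarrow> isolated_singularity_at h z"
  using meromorphic_on_isolated_singularity[of h z] meromorphic_on_subset[of h UNIV "{z}"] by blast

lemma not_essential_mero: "h meromorphic_on UNIV \<Longrightarrow> not_essential h z"
  using meromorphic_on_not_essential[of h z] meromorphic_on_subset[of h UNIV "{z}"] by blast

text \<open>
  \<open>B\<close> contains all zeros, poles and ill-defined points of the finitely many functions under
  consideration, so that all integrands are continuous on circles avoiding \<open>B\<close>. Counting starts at
  the radius \<open>r0\<close>: compared with the usual \<open>ln (r / norm a)\<close>, the weight below changes a counting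
  function by a bounded amount only and needs no special treatment of the origin.
\<close>

locale divisor =
  fixes B :: "complex set" and r0 :: real
  assumes sparse: "B sparse_in UNIV" and r0: "1 \<le> r0" and base: "sphere 0 r0 \<inter> B = {}"
begin

definition good :: "real \<Rightarrow> bool" where
  "good r \<longleftrightarrow> r0 \<le> r \<and> sphere 0 r \<inter> B = {}"

definition weight :: "real \<Rightarrow> complex \<Rightarrow> real" where
  "weight r a = ln (r / max r0 (norm a))"

text \<open>The multiplicity is an arbitrary integer function, so that zeros, poles, supports and
  linear combinations of them are compared pointwise and the comparison is then summed by
  \<open>counting_mono\<close>.\<close>

definition counting :: "(complex \<Rightarrow> int) \<Rightarrow> real \<Rightarrow> real" where
  "counting n r = (\<Sum>a\<in>B \<inter> ball 0 r. of_int (n a) * weight r a)"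

lemma good_r0: "good r0"
  using base by (simp add: good_def)

lemma good_pos: "good r \<Longrightarrow> 0 < r"
  using r0 by (simp add: good_def)

lemma good_notin: "good r \<Longrightarrow> norm z = r \<Longrightarrow> z \<notin> B"
  by (auto simp: good_def)

lemma finite_B [simp]: "finite (B \<inter> ball 0 r)"
proof -
  have "finite (cball 0 r \<inter> B)"
    using sparse_in_compact_finite[OF sparse_in_subset[OF sparse]] by auto
  then show ?thesis by (rule finite_subset[rotated]) auto
qed

lemma eventually_notin: "eventually (\<lambda>w. w \<notin> B) (at z)"
  using sparse sparse_in_eventually_iff[of UNIV B] by auto

lemma eventually_nonzero: "unit_off B h \<Longrightarrow> eventually (\<lambda>w. h w \<noteq> 0) (at z)"
  using eventually_notin[of z] by eventually_elim (simp add: unit_off_def)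

lemma frequently_nonzero: "unit_off B h \<Longrightarrow> frequently (\<lambda>w. h w \<noteq> 0) (at z)"
  by (rule eventually_frequently) (auto simp: eventually_nonzero)

lemma zorder_unit_off: "unit_off B h \<Longrightarrow> z \<notin> B \<Longrightarrow> zorder h z = 0"
  by (rule zorder_eq_0I) (auto simp: unit_off_def regular_off_def)

lemma weight_nonneg: "r0 \<le> r \<Longrightarrow> norm a < r \<Longrightarrow> 0 \<le> weight r a"
  using r0 by (auto simp: weight_def intro!: ln_ge_zero)

lemma counting_mono:
  assumes "r0 \<le> r" "\<And>a. a \<in> B \<Longrightarrow> norm a < r \<Longrightarrow> m a \<le> n a"
  shows "counting m r \<le> counting n r"
  unfolding counting_def using assms weight_nonneg[OF assms(1)] by (intro sum_mono mult_right_mono) auto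

lemma counting_add: "counting (\<lambda>a. m a + n a) r = counting m r + counting n r"
  by (simp add: counting_def sum.distrib algebra_simps)

lemma counting_diff: "counting (\<lambda>a. m a - n a) r = counting m r - counting n r"
  by (simp add: counting_def sum_subtractf algebra_simps)

lemma counting_cmult: "counting (\<lambda>a. k * n a) r = of_int k * counting n r"
  by (simp add: counting_def sum_distrib_left algebra_simps)

lemma counting_sum: "counting (\<lambda>a. \<Sum>i\<in>I. n i a) r = (\<Sum>i\<in>I. counting (n i) r)"
  unfolding counting_def by (subst sum.swap) (simp add: sum_distrib_right)

lemma counting_nonneg: "r0 \<le> r \<Longrightarrow> (\<And>a. a \<in> B \<Longrightarrow> 0 \<le> n a) \<Longrightarrow> 0 \<le> counting n r"
  using counting_mono[of r "\<lambda>_. 0" n] by (simp add: counting_def)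

text \<open>Multiplying \<open>h\<close> by \<open>(z - a) powi (- zorder h a)\<close> for the
  finitely many \<open>a\<close> in the disc brings every order there to 0. Such a function is
  holomorphic and zero-free once its removable singularities are filled in.\<close>

lemma factorization:
  assumes h: "unit_off B h"
  obtains H where "H holomorphic_on ball 0 R" "\<And>z. norm z < R \<Longrightarrow> H z \<noteq> 0"
    "\<And>z. norm z < R \<Longrightarrow> z \<notin> B \<Longrightarrow> h z = H z * (\<Prod>a\<in>B \<inter> ball 0 R. (z - a) powi zorder h a)"
proof -
  define A where "A = B \<inter> ball 0 R"
  have fA: "finite A" by (simp add: A_def)
  define p where "p = (\<lambda>z. \<Prod>a\<in>A. (z - a) powi (- zorder h a))"
  define k where "k = (\<lambda>z. h z * p z)"
  have p_nz: "p z \<noteq> 0" if "z \<notin> B" for z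
    using that fA by (auto simp: p_def A_def)
  have p: "unit_off B p"
    unfolding unit_off_def regular_off_def
  proof (intro conjI allI impI)
    show "p meromorphic_on UNIV" unfolding p_def by (intro meromorphic_intros)
    show "p analytic_on {z}" if "z \<notin> B" for z
      unfolding p_def by (intro analytic_intros) (use that in \<open>auto simp: A_def\<close>)
  qed (use p_nz in auto)
  have k: "unit_off B k" unfolding k_def by (intro unit_off_mult h p)
  then have km: "k meromorphic_on UNIV" by (simp add: unit_off_def regular_off_def)
  have zp: "zorder p z = (if z \<in> A then - zorder h z else 0)" for z
  proof -
    have "zorder p z = (\<Sum>a\<in>A. zorder (\<lambda>z. (z - a) powi (- zorder h a)) z)"
      unfolding p_def
    proof (rule zorder_prod)
      show "\<forall>\<^sub>F z in at z. (\<Prod>a\<in>A. (z - a) powi (- zorder h a)) \<noteq> 0"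
        using eventually_nonzero[OF p, of z] by (simp add: p_def)
    qed (intro meromorphic_intros)
    also have "\<dots> = (\<Sum>a\<in>A. if a = z then - zorder h z else 0)"
    proof (rule sum.cong[OF refl])
      fix a
      have "zorder (\<lambda>z. (z - a) powi (- zorder h a)) z = - zorder h a * zorder (\<lambda>z. z - a) z"
      proof (rule zorder_power_int)
        show "\<exists>\<^sub>F w in at z. w - a \<noteq> 0"
          by (rule eventually_frequently) (auto simp: eventually_neq_at_within)
      qed (intro meromorphic_intros)
      moreover have "zorder (\<lambda>z. z - a) z = (if a = z then 1 else 0)"
        by (auto intro!: simple_zeroI[of UNIV _ "\<lambda>_. 1"] zorder_eq_0I analytic_intros)
      ultimately show "zorder (\<lambda>z. (z - a) powi (- zorder h a)) z = (if a = z then - zorder h z else 0)"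
        by auto
    qed
    also have "\<dots> = (if z \<in> A then - zorder h z else 0)"
      using fA by simp
    finally show ?thesis .
  qed
  have zk: "zorder k z = 0" if "norm z < R" for z
  proof -
    have "zorder k z = zorder h z + zorder p z" unfolding k_def
      by (intro zorder_mult frequently_nonzero[OF h] frequently_nonzero[OF p] regular_off_mero[OF unit_off_imp_regular[OF h]] regular_off_mero[OF unit_off_imp_regular[OF p]])
    also have "\<dots> = 0" using that zp[of z] zorder_unit_off[OF h, of z] by (auto simp: A_def)
    finally show ?thesis .
  qed
  define H where "H = remove_sings k"
  have Hn: "H nicely_meromorphic_on UNIV" unfolding H_def using km by (rule remove_sings_nicely_meromorphic)
  have iso: "isolated_singularity_at k z" for z using isolated_mero[OF km] .
  have Hz: "zorder H z = 0" if "norm z < R" for z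
    unfolding H_def using zk[OF that] iso by simp
  have Han: "H analytic_on {z}" if "norm z < R" for z
  proof -
    have "\<not> is_pole H z"
    proof
      assume "is_pole H z"
      then have "zorder H z < 0" unfolding H_def using iso
        by (intro isolated_pole_imp_neg_zorder) auto
      then show False using Hz[OF that] by simp
    qed
    then show ?thesis using nicely_meromorphic_on_imp_analytic_at[OF Hn] by auto
  qed
  have Heq: "H z = k z" if "z \<notin> B" for z
    unfolding H_def using k that by (auto simp: unit_off_def regular_off_def)
  have "H z \<noteq> 0" if "norm z < R" for z
  proof -
    have "\<exists>\<^sub>F w in at z. H w \<noteq> 0"
      by (rule eventually_frequently, simp)
         (use eventually_notin[of z] in eventually_elim, use Heq k in \<open>auto simp: unit_off_def\<close>)
    then show ?thesis using zorder_eq_0_iff[OF Han[OF that]] Hz[OF that] by simp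
  qed
  moreover have "H holomorphic_on ball 0 R"
    using Han by (intro analytic_imp_holomorphic, subst analytic_on_analytic_at) auto
  moreover have "h z = H z * (\<Prod>a\<in>B \<inter> ball 0 R. (z - a) powi zorder h a)"
    if "norm z < R" "z \<notin> B" for z
  proof -
    have "p z * (\<Prod>a\<in>A. (z - a) powi zorder h a) = (\<Prod>a\<in>A. (z - a) powi (- zorder h a) * (z - a) powi zorder h a)"
      by (simp add: p_def prod.distrib)
    also have "\<dots> = 1"
      by (intro prod.neutral) (use that in \<open>auto simp: A_def power_int_minus intro!: left_inverse\<close>)
    finally show ?thesis using Heq[OF that(2)] by (simp add: k_def A_def)
  qed
  ultimately show ?thesis using that by blast
qed

text \<open>The radius \<open>R\<close> of the factorisation is independent of the circle, so that
  one factorisation can be evaluated on two circles.\<close>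

lemma jensen_aux:
  assumes H: "H holomorphic_on ball 0 R" "\<And>z. norm z < R \<Longrightarrow> H z \<noteq> 0"
    and eq: "\<And>z. norm z < R \<Longrightarrow> z \<notin> B \<Longrightarrow> h z = H z * (\<Prod>a\<in>B \<inter> ball 0 R. (z - a) powi n a)"
    and r: "good r" "r < R"
  shows "circle_mean (\<lambda>z. ln (norm (h z))) r = ln (norm (H 0)) + (\<Sum>a\<in>B \<inter> ball 0 R. of_int (n a) * ln (max r (norm a)))"
proof -
  have r': "0 < r" "r0 \<le> r" using good_pos[OF r(1)] r by (auto simp: good_def)
  have nB: "z \<notin> B" if "norm z = r" for z using that r by (auto simp: good_def)
  have ba: "norm a \<noteq> r" if "a \<in> B" for a using that nB by auto
  have c1: "continuous_on (sphere 0 r) (\<lambda>z. ln (norm (H z)))"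
    using r H(2) by (intro continuous_intros holomorphic_on_imp_continuous_on holomorphic_on_subset[OF H(1)]) auto
  have c2: "continuous_on (sphere 0 r) (\<lambda>z. of_int (n a) * ln (norm (z - a)))" if "a \<in> B" for a
    using ba[OF that] by (intro continuous_intros) auto
  have "circle_mean (\<lambda>z. ln (norm (h z))) r
      = circle_mean (\<lambda>z. ln (norm (H z)) + (\<Sum>a\<in>B \<inter> ball 0 R. of_int (n a) * ln (norm (z - a)))) r"
  proof (rule circle_mean_cong)
    fix z :: complex assume z: "norm z = r"
    have nz: "z - a \<noteq> 0" if "a \<in> B" for a using that nB[OF z] by auto
    have "ln (norm (h z)) = ln (norm (H z) * (\<Prod>a\<in>B \<inter> ball 0 R. norm (z - a) powi n a))"
      using eq[of z] z r nB[OF z] by (simp add: norm_mult norm_power_int prod_norm[symmetric])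
    also have "\<dots> = ln (norm (H z)) + ln (\<Prod>a\<in>B \<inter> ball 0 R. norm (z - a) powi n a)"
      using H(2)[of z] z r nz by (subst ln_mult) (auto simp: prod_zero_iff)
    also have "ln (\<Prod>a\<in>B \<inter> ball 0 R. norm (z - a) powi n a) = (\<Sum>a\<in>B \<inter> ball 0 R. ln (norm (z - a) powi n a))"
      using nz by (intro ln_prod) auto
    also have "\<dots> = (\<Sum>a\<in>B \<inter> ball 0 R. of_int (n a) * ln (norm (z - a)))"
      using nz by (intro sum.cong) (auto simp: ln_power_int)
    finally show "ln (norm (h z)) = ln (norm (H z)) + (\<Sum>a\<in>B \<inter> ball 0 R. of_int (n a) * ln (norm (z - a)))" .
  qed (use r' in auto)
  also have "\<dots> = circle_mean (\<lambda>z. ln (norm (H z))) r + (\<Sum>a\<in>B \<inter> ball 0 R. circle_mean (\<lambda>z. of_int (n a) * ln (norm (z - a))) r)"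
    using r' c1 c2 by (subst circle_mean_add, simp, force intro: continuous_on_sum, simp, subst circle_mean_sum) auto
  also have "circle_mean (\<lambda>z. ln (norm (H z))) r = ln (norm (H 0))"
    using holomorphic_nonvanishing_ln_mean[OF H] r r' by simp
  also have "(\<Sum>a\<in>B \<inter> ball 0 R. circle_mean (\<lambda>z. of_int (n a) * ln (norm (z - a))) r)
      = (\<Sum>a\<in>B \<inter> ball 0 R. of_int (n a) * ln (max r (norm a)))"
    using circle_mean_ln_dist[OF r'(1) ba] by (intro sum.cong) (auto simp: circle_mean_cmult)
  finally show ?thesis .
qed

text \<open>The unknown constant \<open>ln (norm (H 0))\<close> cancels in the difference of two
  radii. The mean over the base circle thus takes the place of the leading coefficient at the
  origin.\<close>

lemma jensen:
  assumes h: "unit_off B h" and r: "good r"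
  shows "circle_mean (\<lambda>z. ln (norm (h z))) r = circle_mean (\<lambda>z. ln (norm (h z))) r0 + counting (zorder h) r"
proof -
  have r': "0 < r" "r0 \<le> r" "0 < r0" using good_pos[OF r(1)] r r0 by (auto simp: good_def)
  obtain H where H: "H holomorphic_on ball 0 (r + 1)" "\<And>z. norm z < r + 1 \<Longrightarrow> H z \<noteq> 0"
    "\<And>z. norm z < r + 1 \<Longrightarrow> z \<notin> B \<Longrightarrow> h z = H z * (\<Prod>a\<in>B \<inter> ball 0 (r + 1). (z - a) powi zorder h a)"
    using factorization[OF h, of "r + 1"] by metis
  let ?S = "B \<inter> ball 0 (r + 1)"
  have "circle_mean (\<lambda>z. ln (norm (h z))) r - circle_mean (\<lambda>z. ln (norm (h z))) r0
     = (\<Sum>a\<in>?S. of_int (zorder h a) * (ln (max r (norm a)) - ln (max r0 (norm a))))"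
    using jensen_aux[OF H r] jensen_aux[OF H good_r0] r'
    by (simp add: sum_subtractf right_diff_distrib)
  \<comment> \<open>For \<open>norm a \<ge> r\<close> both maxima equal \<open>norm a\<close>, so
    these points drop out.\<close>
  also have "\<dots> = (\<Sum>a\<in>B \<inter> ball 0 r. of_int (zorder h a) * (ln (max r (norm a)) - ln (max r0 (norm a))))"
    using r' by (intro sum.mono_neutral_right) auto
  also have "\<dots> = counting (zorder h) r"
    unfolding counting_def weight_def using r' by (intro sum.cong) (auto simp: ln_div max_def)
  finally show ?thesis by simp
qed

section \<open>The characteristic and the first main theorem\<close>

definition T :: "(complex \<Rightarrow> complex) \<Rightarrow> real \<Rightarrow> real" where
  "T h r = proximity_fun h r + counting (\<lambda>a. max 0 (- zorder h a)) r"

lemma regular_cont: "regular_off B h \<Longrightarrow> good r \<Longrightarrow> continuous_on (sphere 0 r) h"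
  by (rule regular_off_continuous) (auto simp: good_def)

lemma regular_cont_log_plus: "regular_off B h \<Longrightarrow> good r \<Longrightarrow> continuous_on (sphere 0 r) (\<lambda>z. log_plus (h z))"
  by (intro continuous_intros regular_cont)

lemma prox_nonneg: "regular_off B h \<Longrightarrow> good r \<Longrightarrow> 0 \<le> proximity_fun h r"
  unfolding proximity_eq_circle_mean using good_pos[of r] regular_cont_log_plus[of h r] by (intro circle_mean_nonneg) auto

lemma prox_mono_add:
  assumes "regular_off B h" "regular_off B h1" "regular_off B h2" "good r"
    and "\<And>z. norm z = r \<Longrightarrow> log_plus (h z) \<le> log_plus (h1 z) + log_plus (h2 z) + K"
  shows "proximity_fun h r \<le> proximity_fun h1 r + proximity_fun h2 r + K"
proof -
  have c: "continuous_on (sphere 0 r) (\<lambda>z. log_plus (h z))" "continuous_on (sphere 0 r) (\<lambda>z. log_plus (h1 z))"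
    "continuous_on (sphere 0 r) (\<lambda>z. log_plus (h2 z))"
    using assms by (auto intro: regular_cont_log_plus)
  have "circle_mean (\<lambda>z. log_plus (h z)) r \<le> circle_mean (\<lambda>z. (log_plus (h1 z) + log_plus (h2 z)) + K) r"
    using good_pos[OF assms(4)] assms c
    by (intro circle_mean_mono continuous_on_add continuous_on_const) auto
  also have "\<dots> = circle_mean (\<lambda>z. log_plus (h1 z) + log_plus (h2 z)) r + K"
    using good_pos[OF assms(4)] c by (subst circle_mean_add) (auto intro!: continuous_on_add)
  also have "\<dots> = circle_mean (\<lambda>z. log_plus (h1 z)) r + circle_mean (\<lambda>z. log_plus (h2 z)) r + K"
    using good_pos[OF assms(4)] c by (subst circle_mean_add) auto
  finally show ?thesis by (simp add: proximity_eq_circle_mean)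
qed

lemma prox_mult:
  assumes "regular_off B h1" "regular_off B h2" "good r" "\<And>z. norm z = r \<Longrightarrow> h z = h1 z * h2 z" "regular_off B h"
  shows "proximity_fun h r \<le> proximity_fun h1 r + proximity_fun h2 r"
  using prox_mono_add[of h h1 h2 r 0] assms log_plus_mult by simp

lemma prox_add:
  assumes "regular_off B h1" "regular_off B h2" "good r" "\<And>z. norm z = r \<Longrightarrow> h z = h1 z + h2 z" "regular_off B h"
  shows "proximity_fun h r \<le> proximity_fun h1 r + proximity_fun h2 r + ln 2"
  using prox_mono_add[of h h1 h2 r "ln 2"] assms log_plus_add by simp

lemma prox_diff:
  assumes "regular_off B h1" "regular_off B h2" "good r" "\<And>z. norm z = r \<Longrightarrow> h z = h1 z - h2 z" "regular_off B h"
  shows "proximity_fun h r \<le> proximity_fun h1 r + proximity_fun h2 r + ln 2"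
  using prox_mono_add[of h h1 h2 r "ln 2"] assms log_plus_diff by simp

lemma T_ge_prox: "good r \<Longrightarrow> proximity_fun h r \<le> T h r"
  by (simp add: T_def counting_nonneg good_def)

lemma zorder_inverse_unit: "unit_off B h \<Longrightarrow> zorder (\<lambda>z. inverse (h z)) a = - zorder h a"
  by (rule zorder_inverse[OF isolated_mero not_essential_mero frequently_nonzero])
     (auto simp: unit_off_def regular_off_def)

text \<open>Jensen's formula, with \<open>ln\<close> split into \<open>log_plus\<close> of the
  function and of its reciprocal, and with orders split into zeros and poles. The error term is an
  exact constant.\<close>

lemma first_main:
  assumes h: "unit_off B h" and r: "good r"
  shows "T h r = T (\<lambda>z. inverse (h z)) r + circle_mean (\<lambda>z. ln (norm (h z))) r0"
proof -
  note [simp] = zorder_inverse_unit[OF h]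
  note reg = unit_off_imp_regular[OF h] unit_off_imp_regular[OF unit_off_inverse[OF h]]
  have "circle_mean (\<lambda>z. ln (norm (h z))) r = circle_mean (\<lambda>z. log_plus (h z) - log_plus (inverse (h z))) r"
    using r h good_pos[OF r] good_notin[OF r]
    by (intro circle_mean_cong) (auto simp: ln_norm_eq_log_plus unit_off_def)
  also have "\<dots> = proximity_fun h r - proximity_fun (\<lambda>z. inverse (h z)) r"
    using good_pos[OF r] reg r unfolding proximity_eq_circle_mean
    by (subst circle_mean_diff) (auto intro!: regular_cont_log_plus)
  finally have 1: "proximity_fun h r - proximity_fun (\<lambda>z. inverse (h z)) r
      = circle_mean (\<lambda>z. ln (norm (h z))) r0 + counting (zorder h) r"
    using jensen[OF h r] by simp
  have "zorder h = (\<lambda>a. max 0 (zorder h a) - max 0 (- zorder h a))" by (auto simp: max_def)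
  then have "counting (zorder h) r = counting (\<lambda>a. max 0 (zorder h a)) r - counting (\<lambda>a. max 0 (- zorder h a)) r"
    by (metis counting_diff)
  then show ?thesis using 1 by (simp add: T_def)
qed

end

subsection \<open>Logarithmic derivatives and shift quotients\<close>

text \<open>With \<open>S\<close> the sum, \<open>S powr \<alpha>\<close> is the sum of the terms
  \<open>x a * S powr (\<alpha> - 1)\<close>; the exponent is nonpositive, so replacing
  \<open>S\<close> by the smaller \<open>x a\<close> increases each term.\<close>

lemma powr_sum_le:
  fixes x :: "'a \<Rightarrow> real"
  assumes \<alpha>: "0 < \<alpha>" "\<alpha> \<le> 1" and fin: "finite A" and nn: "\<And>a. a \<in> A \<Longrightarrow> 0 \<le> x a"
  shows "(\<Sum>a\<in>A. x a) powr \<alpha> \<le> (\<Sum>a\<in>A. x a powr \<alpha>)"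
proof (cases "(\<Sum>a\<in>A. x a) = 0")
  case True
  then show ?thesis by (simp add: sum_nonneg)
next
  case False
  define S where "S = (\<Sum>a\<in>A. x a)"
  have S: "0 < S" using False nn by (auto simp: S_def less_le intro!: sum_nonneg)
  have "S powr \<alpha> = S * S powr (\<alpha> - 1)"
    using S by (simp add: powr_mult_base)
  also have "\<dots> = (\<Sum>a\<in>A. x a * S powr (\<alpha> - 1))" by (simp add: S_def sum_distrib_right)
  also have "\<dots> \<le> (\<Sum>a\<in>A. x a powr \<alpha>)"
  proof (rule sum_mono)
    fix a assume a: "a \<in> A"
    show "x a * S powr (\<alpha> - 1) \<le> x a powr \<alpha>"
    proof (cases "x a = 0")
      case xa: False
      have "x a \<le> S" unfolding S_def using a nn fin by (intro member_le_sum) auto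
      then have "x a * S powr (\<alpha> - 1) \<le> x a * x a powr (\<alpha> - 1)"
        using nn[OF a] xa \<alpha> by (intro mult_left_mono powr_mono2') auto
      also have "\<dots> = x a powr \<alpha>" using nn[OF a] xa by (simp add: powr_mult_base)
      finally show ?thesis .
    qed simp
  qed
  finally show ?thesis by (simp add: S_def)
qed

lemma powr_add_le:
  fixes x y :: real
  assumes "0 < \<alpha>" "\<alpha> \<le> 1" "0 \<le> x" "0 \<le> y"
  shows "(x + y) powr \<alpha> \<le> x powr \<alpha> + y powr \<alpha>"
  using powr_sum_le[of \<alpha> UNIV "\<lambda>b::bool. if b then x else y"] assms by (simp add: UNIV_bool add.commute)

text \<open>An integer is 0 or at least 1 in absolute value, so multiplicities leave the power
  linearly and later add up to \<open>order_sum\<close>.\<close>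

lemma powr_of_nat_mult_le:
  fixes x :: real
  assumes "0 < \<alpha>" "\<alpha> \<le> 1" "0 \<le> x"
  shows "(\<bar>of_int n\<bar> * x) powr \<alpha> \<le> \<bar>of_int n\<bar> * x powr \<alpha>"
proof (cases "n = 0")
  case False
  then have "1 \<le> \<bar>of_int n :: real\<bar>" by linarith
  then have "\<bar>of_int n :: real\<bar> powr \<alpha> \<le> \<bar>of_int n\<bar> powr 1" using assms by (intro powr_mono) auto
  then show ?thesis using assms by (simp add: powr_mult mult_right_mono)
qed simp

lemma ln_one_plus_le_powr:
  fixes t :: real
  assumes \<alpha>: "0 < \<alpha>" "\<alpha> \<le> 1" and t: "0 \<le> t"
  shows "ln (1 + t) \<le> t powr \<alpha> / \<alpha>"
proof -
  have "\<alpha> * ln (1 + t) = ln ((1 + t) powr \<alpha>)" using t by (simp add: ln_powr)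
  also have "\<dots> \<le> ln (1 + t powr \<alpha>)"
    using powr_add_le[OF \<alpha>, of 1 t] t by (subst ln_le_cancel_iff) (auto intro: add_pos_nonneg)
  also have "\<dots> \<le> t powr \<alpha>" using ln_add_one_self_le_self by simp
  finally show ?thesis using \<alpha> by (simp add: field_simps)
qed

text \<open>Both signs come from one one-sided estimate, applied to the step \<open>c\<close> from
  \<open>x\<close> and to the step \<open>- c\<close> from \<open>x + c\<close>. The kernels are
  powers with exponent \<open>- \<alpha>\<close> because their circle means are uniformly
  bounded.\<close>

lemma abs_ln_shift_le:
  fixes x c :: complex
  assumes \<alpha>: "0 < \<alpha>" "\<alpha> \<le> 1" and x: "x \<noteq> 0" "x + c \<noteq> 0"
  shows "\<bar>ln (norm (x + c)) - ln (norm x)\<bar>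
     \<le> norm c powr \<alpha> / \<alpha> * (norm x powr (-\<alpha>) + norm (x + c) powr (-\<alpha>))"
proof -
  have *: "ln (norm (y + d)) - ln (norm y) \<le> norm d powr \<alpha> / \<alpha> * norm y powr (-\<alpha>)"
    if "y \<noteq> 0" "y + d \<noteq> 0" for y d :: complex
  proof -
    have "ln (norm (y + d)) - ln (norm y) = ln (norm (y + d) / norm y)"
      using that by (simp add: ln_div)
    also have "\<dots> \<le> ln (1 + norm d / norm y)"
    proof (subst ln_le_cancel_iff)
      show "0 < 1 + norm d / norm y" by (intro add_pos_nonneg) auto
      show "norm (y + d) / norm y \<le> 1 + norm d / norm y"
        using that norm_triangle_ineq[of y d] by (simp add: field_simps)
    qed (use that in auto)
    also have "\<dots> \<le> (norm d / norm y) powr \<alpha> / \<alpha>" using \<alpha> by (intro ln_one_plus_le_powr) auto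
    also have "\<dots> = norm d powr \<alpha> / \<alpha> * norm y powr (-\<alpha>)"
      by (simp add: powr_divide powr_minus field_simps)
    finally show ?thesis .
  qed
  have 1: "ln (norm (x + c)) - ln (norm x) \<le> norm c powr \<alpha> / \<alpha> * norm x powr (-\<alpha>)" using *[of x c] x by simp
  have 2: "ln (norm x) - ln (norm (x + c)) \<le> norm c powr \<alpha> / \<alpha> * norm (x + c) powr (-\<alpha>)"
    using *[of "x + c" "- c"] x by simp
  have 3: "0 \<le> norm c powr \<alpha> / \<alpha> * norm x powr (-\<alpha>)" "0 \<le> norm c powr \<alpha> / \<alpha> * norm (x + c) powr (-\<alpha>)"
    using \<alpha> by auto
  show ?thesis using 1 2 3 unfolding distrib_left abs_le_iff by linarith
qed

lemma blaschke_norm: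
  fixes a w :: complex
  assumes "norm w = R" "0 < R" "norm a < R"
  shows "norm ((w - a) * of_real R / (of_real (R^2) - cnj a * w)) = 1"
proof -
  have "of_real (R^2) - cnj a * w = of_real (R^2) * (1 - cnj a / of_real (R^2) * w)"
    using assms by (simp add: field_simps)
  then have "norm (of_real (R^2) - cnj a * w) = R^2 * norm (1 - cnj a / of_real (R^2) * w)"
    by (simp only: norm_mult norm_of_real) simp
  also have "\<dots> = norm (w - a) * R"
    using reflect_circle[OF assms(1,2), of a] by (simp add: power2_eq_square)
  finally have "norm (of_real (R^2) - cnj a * w) = norm (w - a) * R" .
  moreover have "w \<noteq> a" using assms by auto
  ultimately show ?thesis using assms by (simp add: norm_divide norm_mult)
qed

lemma denom_nz:
  fixes a z :: complex
  assumes "norm a * norm z < R^2"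
  shows "of_real (R^2) - cnj a * z \<noteq> 0"
proof
  assume "of_real (R^2) - cnj a * z = 0"
  then have "norm (cnj a * z) = norm (of_real (R^2) :: complex)" by (metis eq_iff_diff_eq_0)
  then show False using assms by (simp add: norm_mult norm_power)
qed

context divisor begin

text \<open>Only finitely many points of \<open>B\<close> lie in \<open>ball 0 (R + 1)\<close>, so a
  slightly larger disc captures no new point of \<open>B\<close> and does not reach the poles of the
  Blaschke factors, which lie at modulus \<open>R^2 / norm a\<close>.\<close>

lemma eventually_near_good:
  assumes R: "good R"
  shows "\<forall>\<^sub>F x in at_right R. B \<inter> ball 0 x = B \<inter> ball 0 R \<and> (\<forall>a\<in>B \<inter> ball 0 R. norm a * x < R^2)"
proof -
  have R0: "0 < R" using good_pos[OF R] .
  have "\<forall>a\<in>B \<inter> ball 0 (R+1). \<forall>\<^sub>F x in at_right R. (norm a < R \<longrightarrow> norm a * x < R^2) \<and> (R < norm a \<longrightarrow> x < norm a)"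
  proof
    fix a
    have "\<forall>\<^sub>F x in at_right R. norm a * x < R^2" if "norm a < R"
    proof -
      have "((\<lambda>x. norm a * x) \<longlongrightarrow> norm a * R) (at_right R)" by (intro tendsto_intros)
      moreover have "norm a * R < R^2" using that R0 by (simp add: power2_eq_square)
      ultimately show ?thesis by (rule order_tendstoD(2))
    qed
    moreover have "\<forall>\<^sub>F x in at_right R. x < norm a" if "R < norm a"
      using eventually_at_right_less order_tendstoD(2)[OF tendsto_ident_at that] by blast
    ultimately show "\<forall>\<^sub>F x in at_right R. (norm a < R \<longrightarrow> norm a * x < R^2) \<and> (R < norm a \<longrightarrow> x < norm a)"
      by (cases "norm a < R"; cases "R < norm a") (auto simp: eventually_conj_iff)
  qed
  then have "\<forall>\<^sub>F x in at_right R. \<forall>a\<in>B \<inter> ball 0 (R+1). (norm a < R \<longrightarrow> norm a * x < R^2) \<and> (R < norm a \<longrightarrow> x < norm a)"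
    by (intro eventually_ball_finite) simp_all
  moreover have "\<forall>\<^sub>F x in at_right R. R < x \<and> x < R + 1"
    using eventually_at_right_less[of R] order_tendstoD(2)[OF tendsto_ident_at, of R "R+1" "{R<..}"]
    by (simp add: eventually_conj_iff)
  ultimately show ?thesis
  proof eventually_elim
    case (elim x)
    have "norm a < R" if "a \<in> B" "norm a < x" for a
    proof (rule ccontr)
      assume "\<not> norm a < R"
      then have "R < norm a" using R that(1) by (auto simp: good_def)
      then show False using elim that by auto
    qed
    then show ?case using elim by auto
  qed
qed

section \<open>Blaschke factorisation and a majorant for the zero-free part\<close>

definition blaschke :: "real \<Rightarrow> complex \<Rightarrow> complex \<Rightarrow> complex" where
  "blaschke R a z = (z - a) * of_real R / (of_real (R^2) - cnj a * z)"

text \<open>Blaschke factors have modulus 1 on the circle of radius \<open>R\<close>, so the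
  logarithm of the zero-free part has real part \<open>ln (norm (h z))\<close> there. The slightly
  larger disc gives continuity up to that circle.\<close>

lemma blaschke_factorization:
  assumes h: "unit_off B h" and R: "good R"
  obtains L R' where "R < R'" "L holomorphic_on ball 0 R'"
    "\<And>z. norm z < R' \<Longrightarrow> z \<notin> B \<Longrightarrow> h z = exp (L z) * (\<Prod>a\<in>B \<inter> ball 0 R. blaschke R a z powi zorder h a)"
    "\<And>z. norm z = R \<Longrightarrow> Re (L z) = ln (norm (h z))"
proof -
  have R0: "0 < R" using good_pos[OF R] .
  let ?A = "B \<inter> ball 0 R"
  have "\<exists>x. R < x \<and> B \<inter> ball 0 x = ?A \<and> (\<forall>a\<in>?A. norm a * x < R^2)"
    using eventually_happens[OF eventually_conj[OF eventually_at_right_less eventually_near_good[OF R]]]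
    by (auto simp: trivial_limit_at_right_real)
  then obtain R' where R': "R < R'" "B \<inter> ball 0 R' = ?A" "\<And>a. a \<in> ?A \<Longrightarrow> norm a * R' < R^2" by blast
  have dz: "of_real (R^2) - cnj a * z \<noteq> 0" if "a \<in> ?A" "norm z < R'" for a z
  proof (rule denom_nz)
    have "norm a * norm z \<le> norm a * R'" using that by (intro mult_left_mono) auto
    then show "norm a * norm z < R^2" using R'(3)[OF that(1)] by simp
  qed
  obtain H where H: "H holomorphic_on ball 0 R'" "\<And>z. norm z < R' \<Longrightarrow> H z \<noteq> 0"
    "\<And>z. norm z < R' \<Longrightarrow> z \<notin> B \<Longrightarrow> h z = H z * (\<Prod>a\<in>B \<inter> ball 0 R'. (z - a) powi zorder h a)"
    using factorization[OF h, of R'] by metis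
  \<comment> \<open>\<open>blaschke R a z\<close> times \<open>(R^2 - cnj a * z) / R\<close> is
    \<open>z - a\<close>. \<open>G\<close> collects these denominators, which have no zero on the
    enlarged disc.\<close>
  define G where "G = (\<lambda>z. H z * (\<Prod>a\<in>?A. ((of_real (R^2) - cnj a * z) / of_real R) powi zorder h a))"
  have G: "G holomorphic_on ball 0 R'" unfolding G_def
    by (intro holomorphic_intros H(1)) (use dz R0 in \<open>auto simp flip: of_real_power\<close>)
  have Gnz: "G z \<noteq> 0" if "z \<in> ball 0 R'" for z
    unfolding G_def using H(2) dz that R0 by (auto simp: prod_zero_iff simp flip: of_real_power)
  obtain L where L: "L holomorphic_on ball 0 R'" "\<And>z. z \<in> ball 0 R' \<Longrightarrow> G z = exp (L z)"
    using contractible_imp_holomorphic_log[OF G] Gnz convex_imp_contractible[of "ball 0 R'"] by auto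
  have eq: "h z = exp (L z) * (\<Prod>a\<in>?A. blaschke R a z powi zorder h a)" if z: "norm z < R'" "z \<notin> B" for z
  proof -
    have "G z * (\<Prod>a\<in>?A. blaschke R a z powi zorder h a)
       = H z * (\<Prod>a\<in>?A. (((of_real (R^2) - cnj a * z) / of_real R) * blaschke R a z) powi zorder h a)"
      unfolding G_def mult.assoc prod.distrib[symmetric] power_int_mult_distrib[symmetric] ..
    also have "\<dots> = H z * (\<Prod>a\<in>?A. (z - a) powi zorder h a)"
      using dz z R0 unfolding blaschke_def by (intro arg_cong2[where f = "(*)"] refl prod.cong) auto
    also have "\<dots> = h z" using H(3)[OF z] R'(2) by simp
    finally show ?thesis using L(2)[of z] z by simp
  qed
  show ?thesis
  proof (rule that[OF R'(1) L(1) eq])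
    fix z :: complex assume z: "norm z = R"
    have "norm (\<Prod>a\<in>?A. blaschke R a z powi zorder h a) = (\<Prod>a\<in>?A. norm (blaschke R a z) powi zorder h a)"
      by (simp add: prod_norm[symmetric] norm_power_int)
    also have "\<dots> = 1"
      by (intro prod.neutral) (use blaschke_norm[OF z R0] in \<open>auto simp: blaschke_def\<close>)
    finally have "norm (h z) = exp (Re (L z))"
      using eq[of z] z R'(1) good_notin[OF R z] by (simp add: norm_mult)
    then show "Re (L z) = ln (norm (h z))" by simp
  qed auto
qed

text \<open>Half of the bound that \<open>deriv_circle_mean_Re\<close> yields for the derivative of
  the zero-free part. It depends on \<open>z\<close> only through \<open>R / norm (w - z)^2\<close>,
  so the Poisson formula evaluates its circle means.\<close>

definition potential :: "(complex \<Rightarrow> complex) \<Rightarrow> real \<Rightarrow> complex \<Rightarrow> real" where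
  "potential h R z = circle_mean (\<lambda>w. \<bar>ln (norm (h w))\<bar> * (R / norm (w - z)^2)) R"

lemma potential_bound:
  assumes h: "unit_off B h" and R: "good R"
    and L: "R < R'" "L holomorphic_on ball 0 R'" "\<And>z. norm z = R \<Longrightarrow> Re (L z) = ln (norm (h z))"
    and z: "norm z < R"
  shows "norm (deriv L z) \<le> 2 * potential h R z"
proof -
  have R0: "0 < R" using good_pos[OF R] .
  have "continuous_on (cball 0 R) L"
    using L by (intro holomorphic_on_imp_continuous_on holomorphic_on_subset[OF L(2)]) auto
  moreover have "L holomorphic_on ball 0 R"
    using L by (intro holomorphic_on_subset[OF L(2)]) auto
  ultimately have i: "((\<lambda>\<theta>. 2 * Re (L (of_real R * cis \<theta>)) * (of_real R * cis \<theta>) / (of_real R * cis \<theta> - z)^2)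
           has_integral (2 * pi * deriv L z)) {0..2 * pi}"
    using z by (rule deriv_circle_mean_Re)
  define u where "u = (\<lambda>w. 2 * (\<bar>ln (norm (h w))\<bar> * (R / norm (w - z)^2)))"
  have cu: "continuous_on (sphere 0 R) u" unfolding u_def
    using h R z good_notin[OF R]
    by (intro continuous_intros continuous_on_ln_norm_unit regular_cont unit_off_imp_regular)
       (auto simp: unit_off_def)
  have "norm (integral {0..2*pi} (\<lambda>\<theta>. 2 * Re (L (of_real R * cis \<theta>)) * (of_real R * cis \<theta>) / (of_real R * cis \<theta> - z)^2))
     \<le> integral {0..2*pi} (\<lambda>\<theta>. u (of_real R * cis \<theta>))"
  proof (rule Henstock_Kurzweil_Integration.integral_norm_bound_integral)
    show "(\<lambda>\<theta>. u (of_real R * cis \<theta>)) integrable_on {0..2 * pi}"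
      using cu R0 by (intro circle_integrable) auto
    fix \<theta> :: real
    have "norm (of_real R * cis \<theta>) = R" using R0 by (simp add: norm_mult)
    then show "norm (2 * Re (L (of_real R * cis \<theta>)) * (of_real R * cis \<theta>) / (of_real R * cis \<theta> - z)^2) \<le> u (of_real R * cis \<theta>)"
      using L(3)[of "of_real R * cis \<theta>"] R0 by (simp add: u_def norm_mult norm_divide norm_power)
  qed (use i in blast)
  then have "norm (2 * pi * deriv L z) \<le> 2 * pi * circle_mean u R"
    using i by (simp add: integral_unique circle_mean_def)
  moreover have "circle_mean u R = 2 * potential h R z"
    unfolding u_def potential_def by (rule circle_mean_cmult)
  ultimately show ?thesis by (simp add: norm_mult)
qed

lemma continuous_on_potential_kernel:
  assumes h: "unit_off B h" and R: "good R" and r: "r < R"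
  shows "continuous_on (sphere 0 r \<times> sphere 0 R) (\<lambda>(z, w). \<bar>ln (norm (h w))\<bar> * (R / norm (w - z)^2))"
proof -
  have "continuous_on (sphere 0 R) (\<lambda>w. ln (norm (h w)))"
    using R by (intro continuous_on_ln_norm_unit[OF h]) (auto simp: good_def)
  then have c: "continuous_on (sphere 0 r \<times> sphere 0 R) (\<lambda>x. ln (norm (h (snd x))))"
    by (rule continuous_on_compose2) (auto intro: continuous_intros)
  show ?thesis unfolding case_prod_unfold
    by (intro continuous_on_mult[OF continuous_on_rabs[OF c]] continuous_intros) (use r in auto)
qed

lemma continuous_on_potential:
  assumes h: "unit_off B h" and R: "good R" and r: "r < R"
  shows "continuous_on (sphere 0 r) (potential h R)"
proof -
  have "continuous_on (sphere 0 r \<times> cbox 0 (2 * pi))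
      (\<lambda>x. (\<lambda>(z, w). \<bar>ln (norm (h w))\<bar> * (R / norm (w - z)^2)) (fst x, of_real R * cis (snd x)))"
    by (rule continuous_on_compose2[OF continuous_on_potential_kernel[OF assms]])
       (use good_pos[OF R] in \<open>auto intro!: continuous_intros simp: norm_mult\<close>)
  then have "continuous_on (sphere 0 r \<times> cbox 0 (2 * pi))
      (\<lambda>(z, t). \<bar>ln (norm (h (of_real R * cis t)))\<bar> * (R / norm (of_real R * cis t - z)^2))"
    by (simp add: case_prod_unfold)
  then have "continuous_on (sphere 0 r)
      (\<lambda>z. integral (cbox 0 (2 * pi)) (\<lambda>t. \<bar>ln (norm (h (of_real R * cis t)))\<bar> * (R / norm (of_real R * cis t - z)^2)))"
    by (rule integral_continuous_on_param)
  then show ?thesis unfolding potential_def circle_mean_def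
    by (intro continuous_intros) (simp add: cbox_interval)
qed

lemma potential_nonneg:
  assumes h: "unit_off B h" and R: "good R" and z: "norm z < R"
  shows "0 \<le> potential h R z"
  unfolding potential_def using z good_pos[OF R] R
  by (intro circle_mean_nonneg continuous_intros continuous_on_ln_norm_unit[OF h] regular_cont unit_off_imp_regular[OF h])
     (auto simp: good_def dest: unit_off_nonzero[OF h])

text \<open>Exchanging the two means leaves the Poisson mean \<open>1 / (R^2 - r^2)\<close> of the
  kernel; then \<open>R / (R + r) \<le> 1\<close>.\<close>

lemma circle_mean_potential:
  assumes h: "unit_off B h" and R: "good R" and r: "0 < r" "r < R"
  shows "circle_mean (potential h R) r \<le> circle_mean (\<lambda>w. \<bar>ln (norm (h w))\<bar>) R / (R - r)"
proof -
  have R0: "0 < R" using good_pos[OF R] .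
  let ?A = "circle_mean (\<lambda>w. \<bar>ln (norm (h w))\<bar>) R"
  have A0: "0 \<le> ?A" using R0 R
    by (intro circle_mean_nonneg continuous_intros continuous_on_ln_norm_unit[OF h] regular_cont unit_off_imp_regular[OF h])
       (auto simp: good_def dest: unit_off_nonzero[OF h])
  have "circle_mean (potential h R) r = circle_mean (\<lambda>w. circle_mean (\<lambda>z. \<bar>ln (norm (h w))\<bar> * (R / norm (w - z)^2)) r) R"
    unfolding potential_def
    using circle_mean_swap[OF continuous_on_potential_kernel[OF h R r(2)]] r R0 by simp
  also have "\<dots> = circle_mean (\<lambda>w. (R / (R^2 - r^2)) * \<bar>ln (norm (h w))\<bar>) R"
  proof (rule circle_mean_cong)
    fix w :: complex assume w: "norm w = R"
    have "circle_mean (\<lambda>z. \<bar>ln (norm (h w))\<bar> * (R / norm (w - z)^2)) r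
       = circle_mean (\<lambda>z. (\<bar>ln (norm (h w))\<bar> * R) * (1 / norm (w - z)^2)) r" by simp
    also have "\<dots> = (\<bar>ln (norm (h w))\<bar> * R) * (1 / (R^2 - r^2))"
      unfolding circle_mean_cmult circle_mean_Poisson[OF w r] ..
    finally show "circle_mean (\<lambda>z. \<bar>ln (norm (h w))\<bar> * (R / norm (w - z)^2)) r = R / (R^2 - r^2) * \<bar>ln (norm (h w))\<bar>" by simp
  qed (use R0 in simp)
  also have "\<dots> = R / (R^2 - r^2) * ?A" by (rule circle_mean_cmult)
  also have "\<dots> \<le> 1 / (R - r) * ?A"
  proof (rule mult_right_mono[OF _ A0])
    have eq: "R^2 - r^2 = (R - r) * (R + r)" by (simp add: power2_eq_square algebra_simps)
    have "R / (R + r) \<le> 1" using r by simp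
    then have "R / (R + r) / (R - r) \<le> 1 / (R - r)" using r by (intro divide_right_mono) auto
    then show "R / (R^2 - r^2) \<le> 1 / (R - r)" unfolding eq by (simp add: mult.commute)
  qed
  finally show ?thesis by simp
qed

text \<open>A Harnack-type comparison. Since \<open>norm (w - z) \<ge> 2 * norm c\<close> on the
  outer circle, moving \<open>z\<close> by at most \<open>norm c\<close> at worst halves the
  distance, which costs a factor 4 in the kernel.\<close>

lemma potential_shift:
  assumes h: "unit_off B h" and R: "good R" and z: "norm z = r" and r: "0 < r" "r + 2 * norm c \<le> R" "r < R"
    and y: "norm (y - z) \<le> norm c"
  shows "potential h R y \<le> 4 * potential h R z"
proof -
  have yR: "norm y < R"
  proof -
    have "norm y \<le> norm z + norm (y - z)" by (metis add.commute diff_add_cancel norm_triangle_ineq)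
    then have "norm y \<le> r + norm c" using z y by linarith
    then show ?thesis using r norm_ge_zero[of c] by linarith
  qed
  have c: "continuous_on (sphere 0 R) (\<lambda>w. \<bar>ln (norm (h w))\<bar>)"
    using R by (intro continuous_intros continuous_on_ln_norm_unit[OF h] regular_cont unit_off_imp_regular[OF h])
       (auto simp: good_def dest: unit_off_nonzero[OF h])
  have "circle_mean (\<lambda>w. \<bar>ln (norm (h w))\<bar> * (R / norm (w - y)^2)) R \<le> circle_mean (\<lambda>w. 4 * (\<bar>ln (norm (h w))\<bar> * (R / norm (w - z)^2))) R"
  proof (rule circle_mean_mono)
    fix w :: complex assume w: "norm w = R"
    have "norm (w - z) \<ge> R - r" using norm_triangle_ineq2[of w z] w z by simp
    moreover have "norm (w - z) \<le> norm (w - y) + norm (y - z)" using norm_triangle_ineq[of "w - y" "y - z"] by simp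
    ultimately have "norm (w - z) \<le> 2 * norm (w - y)" using y r by linarith
    then have "norm (w - z)^2 \<le> (2 * norm (w - y))^2" by (intro power_mono) auto
    moreover have "w \<noteq> z" "w \<noteq> y" using w z r yR by auto
    ultimately have "1 / norm (w - y)^2 \<le> 4 / norm (w - z)^2" by (simp add: field_simps power2_eq_square)
    then have "\<bar>ln (norm (h w))\<bar> * R * (1 / norm (w - y)^2) \<le> \<bar>ln (norm (h w))\<bar> * R * (4 / norm (w - z)^2)"
      using r by (intro mult_left_mono) auto
    then show "\<bar>ln (norm (h w))\<bar> * (R / norm (w - y)^2) \<le> 4 * (\<bar>ln (norm (h w))\<bar> * (R / norm (w - z)^2))"
      by (simp add: algebra_simps)
  next
    show "continuous_on (sphere 0 R) (\<lambda>w. \<bar>ln (norm (h w))\<bar> * (R / norm (w - y)^2))"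
      by (intro continuous_on_mult c continuous_intros) (use yR in auto)
    show "continuous_on (sphere 0 R) (\<lambda>w. 4 * (\<bar>ln (norm (h w))\<bar> * (R / norm (w - z)^2)))"
      by (intro continuous_on_mult c continuous_intros) (use z r in auto)
  qed (use r in auto)
  then show ?thesis unfolding potential_def circle_mean_cmult .
qed

section \<open>Zeros, poles and their reflections\<close>

definition order_sum :: "(complex \<Rightarrow> complex) \<Rightarrow> real \<Rightarrow> real" where
  "order_sum h R = (\<Sum>a\<in>B \<inter> ball 0 R. \<bar>of_int (zorder h a)\<bar>)"

definition abs_log_mean :: "(complex \<Rightarrow> complex) \<Rightarrow> real \<Rightarrow> real" where
  "abs_log_mean h R = circle_mean (\<lambda>w. \<bar>ln (norm (h w))\<bar>) R"

definition mirror :: "real \<Rightarrow> complex \<Rightarrow> complex" where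
  "mirror R a = of_real (R^2) / cnj a"

text \<open>\<open>mirror R a\<close> is the pole of the Blaschke factor at \<open>a\<close>; there is none for \<open>a = 0\<close>.\<close>

definition pole_pow :: "real \<Rightarrow> real \<Rightarrow> complex \<Rightarrow> complex \<Rightarrow> real" where
  "pole_pow \<alpha> R a z = (if a = 0 then 0 else norm (z - mirror R a) powr (-\<alpha>))"

lemma mirror_denom:
  assumes "a \<noteq> 0"
  shows "of_real (R^2) - cnj a * z = - cnj a * (z - mirror R a)"
  using assms by (simp add: mirror_def field_simps)

lemma norm_mirror:
  assumes "a \<noteq> 0" "norm a < R"
  shows "R < norm (mirror R a)"
proof -
  have "0 < R" using assms(2) norm_ge_zero[of a] by linarith
  then have "R * norm a < R * R" using assms by simp
  then have "R < R^2 / norm a" using assms by (simp add: less_divide_eq power2_eq_square)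
  then show ?thesis by (simp add: mirror_def norm_divide norm_power)
qed

lemma circle_mean_pole_pow:
  assumes "0 < \<alpha>" "\<alpha> < 1" "0 < r" "r < R" "norm a < R"
  shows "circle_mean (pole_pow \<alpha> R a) r \<le> r powr (-\<alpha>) / cos (\<alpha> * pi / 2)"
proof (cases "a = 0")
  case True
  have "0 < cos (\<alpha> * pi / 2)" by (rule cos_mult_half_pi_pos[OF assms(1,2)])
  then show ?thesis using True assms by (simp add: pole_pow_def [abs_def])
next
  case False
  then show ?thesis using norm_mirror[OF False assms(5)] circle_mean_powr_le[of \<alpha> r "mirror R a"] assms
    by (simp add: pole_pow_def [abs_def])
qed

lemma continuous_on_pole_pow:
  assumes "norm a < R" "\<And>z. z \<in> S \<Longrightarrow> norm (g z) \<le> R" "continuous_on S g"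
  shows "continuous_on S (\<lambda>z. pole_pow \<alpha> R a (g z))"
proof (cases "a = 0")
  case False
  then have "g z \<noteq> mirror R a" if "z \<in> S" for z
    using norm_mirror[OF False assms(1)] assms(2)[OF that] by auto
  then show ?thesis using False by (simp add: pole_pow_def [abs_def]) (intro continuous_intros assms(3), auto)
qed (simp add: pole_pow_def [abs_def])

text \<open>Logarithmic differentiation of the Blaschke factorisation: each \<open>a\<close>
  contributes \<open>1 / (z - a)\<close> and a term from its reflection, and the zero-free part is
  bounded by the potential.\<close>

lemma log_deriv_pointwise:
  assumes h: "unit_off B h" and R: "good R" and z: "norm z < R" "z \<notin> B"
  shows "norm (deriv h z / h z) \<le> 2 * potential h R z +
    (\<Sum>a\<in>B \<inter> ball 0 R. \<bar>of_int (zorder h a)\<bar> * (1 / norm (z - a) + pole_pow 1 R a z))"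
proof -
  let ?A = "B \<inter> ball 0 R"
  have R0: "0 < R" using good_pos[OF R] .
  obtain L R' where L: "R < R'" "L holomorphic_on ball 0 R'"
    "\<And>z. norm z < R' \<Longrightarrow> z \<notin> B \<Longrightarrow> h z = exp (L z) * (\<Prod>a\<in>?A. blaschke R a z powi zorder h a)"
    "\<And>z. norm z = R \<Longrightarrow> Re (L z) = ln (norm (h z))"
    by (rule blaschke_factorization[OF h R], rule that)
  have dz: "of_real (R^2) - cnj a * z \<noteq> 0" if "a \<in> ?A" for a
  proof (rule denom_nz)
    have "norm a * norm z \<le> R * norm z" using that by (intro mult_right_mono) auto
    also have "\<dots> < R * R" using z R0 by simp
    finally show "norm a * norm z < R^2" by (simp add: power2_eq_square)
  qed
  have za: "z - a \<noteq> 0" if "a \<in> ?A" for a using that z by auto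
  define f' where "f' = (\<lambda>a. of_int (zorder h a) * blaschke R a z powi (zorder h a - 1) *
      (of_real R / (of_real (R^2) - cnj a * z) + (z - a) * of_real R * cnj a / (of_real (R^2) - cnj a * z)^2))"
  have bnz: "blaschke R a z \<noteq> 0" if "a \<in> ?A" for a
    unfolding blaschke_def using dz[OF that] za[OF that] R0 by (simp del: of_real_power)
  have d: "((\<lambda>z. blaschke R a z powi zorder h a) has_field_derivative f' a) (at z)" if "a \<in> ?A" for a
  proof -
    have "((\<lambda>z. blaschke R a z) has_field_derivative
       (of_real R / (of_real (R^2) - cnj a * z) + (z - a) * of_real R * cnj a / (of_real (R^2) - cnj a * z)^2)) (at z)"
    proof -
      define D where "D = of_real (R^2) - cnj a * z"
      have D: "D \<noteq> 0" using dz[OF that] by (simp add: D_def)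
      have "((\<lambda>z. (z - a) * of_real R / (of_real (R^2) - cnj a * z)) has_field_derivative
         (of_real R * D - (z - a) * of_real R * (- cnj a)) / (D * D)) (at z)"
        unfolding D_def using dz[OF that]
        by (intro DERIV_divide) (auto intro!: derivative_eq_intros simp del: of_real_power)
      moreover have "(of_real R * D - (z - a) * of_real R * (- cnj a)) / (D * D)
          = of_real R / D + (z - a) * of_real R * cnj a / D^2"
        using D by (simp add: add_divide_distrib power2_eq_square)
      ultimately show ?thesis unfolding blaschke_def D_def by simp
    qed
    then show ?thesis unfolding f'_def using bnz[OF that] by (intro DERIV_power_int) auto
  qed
  have "(L has_field_derivative deriv L z) (at z)"
    using L(1) z by (intro holomorphic_derivI[OF L(2)]) auto
  then have "((\<lambda>z. exp (L z) * (\<Prod>a\<in>?A. blaschke R a z powi zorder h a)) has_field_derivative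
     (exp (L z) * (\<Prod>a\<in>?A. blaschke R a z powi zorder h a)) * (deriv L z + (\<Sum>a\<in>?A. f' a / (blaschke R a z powi zorder h a)))) (at z)"
    using bnz by (auto intro!: derivative_eq_intros has_field_derivative_prod' d simp: algebra_simps)
  moreover have "\<forall>\<^sub>F w in nhds z. h w = exp (L w) * (\<Prod>a\<in>?A. blaschke R a w powi zorder h a)"
  proof -
    have "open (ball 0 R' - B)" using sparse_in_UNIV_imp_closed[OF sparse] by auto
    then have "\<forall>\<^sub>F w in nhds z. w \<in> ball 0 R' - B" using z L(1) by (intro eventually_nhds_in_open) auto
    then show ?thesis by eventually_elim (auto intro: L(3))
  qed
  ultimately have "(h has_field_derivative
     (exp (L z) * (\<Prod>a\<in>?A. blaschke R a z powi zorder h a)) * (deriv L z + (\<Sum>a\<in>?A. f' a / (blaschke R a z powi zorder h a)))) (at z)"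
    by (subst DERIV_cong_ev[OF refl _ refl]) auto
  moreover have "exp (L z) * (\<Prod>a\<in>?A. blaschke R a z powi zorder h a) = h z" using L(3)[of z] L(1) z by simp
  ultimately have "deriv h z / h z = deriv L z + (\<Sum>a\<in>?A. f' a / (blaschke R a z powi zorder h a))"
    using unit_off_nonzero[OF h z(2)] by (auto dest!: DERIV_imp_deriv)
  also have "(\<Sum>a\<in>?A. f' a / (blaschke R a z powi zorder h a))
     = (\<Sum>a\<in>?A. of_int (zorder h a) * (1 / (z - a) + cnj a / (of_real (R^2) - cnj a * z)))"
  proof (rule sum.cong[OF refl])
    fix a assume a: "a \<in> ?A"
    define D where "D = of_real (R^2) - cnj a * z"
    have nz: "D \<noteq> 0" "z - a \<noteq> 0" "of_real R \<noteq> (0::complex)" using dz[OF a] za[OF a] R0 by (auto simp: D_def)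
    define d where "d = of_real R / D + (z - a) * of_real R * cnj a / D^2"
    have pd: "blaschke R a z powi (zorder h a - 1) = blaschke R a z powi zorder h a / blaschke R a z"
      using bnz[OF a] by (simp add: power_int_diff)
    have "blaschke R a z = (z - a) * of_real R / D" by (simp add: blaschke_def D_def)
    moreover have "d / ((z - a) * of_real R / D) = 1 / (z - a) + cnj a / D"
      unfolding d_def using nz by (simp add: field_simps power2_eq_square)
    ultimately have "d / blaschke R a z = 1 / (z - a) + cnj a / D" by simp
    moreover have "f' a / (blaschke R a z powi zorder h a) = of_int (zorder h a) * (d / blaschke R a z)"
      unfolding f'_def pd D_def[symmetric] d_def[symmetric] using bnz[OF a] by simp
    ultimately show "f' a / (blaschke R a z powi zorder h a)
      = of_int (zorder h a) * (1 / (z - a) + cnj a / (of_real (R^2) - cnj a * z))"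
      unfolding D_def by simp
  qed
  finally have eq: "deriv h z / h z = deriv L z + (\<Sum>a\<in>?A. of_int (zorder h a) * (1 / (z - a) + cnj a / (of_real (R^2) - cnj a * z)))" .
  have "norm (deriv h z / h z) \<le> norm (deriv L z) + (\<Sum>a\<in>?A. norm (of_int (zorder h a) * (1 / (z - a) + cnj a / (of_real (R^2) - cnj a * z))))"
    unfolding eq by (intro order_trans[OF norm_triangle_ineq] add_left_mono norm_sum)
  also have "\<dots> \<le> 2 * potential h R z + (\<Sum>a\<in>?A. \<bar>of_int (zorder h a)\<bar> * (1 / norm (z - a) + pole_pow 1 R a z))"
  proof (intro add_mono sum_mono)
    show "norm (deriv L z) \<le> 2 * potential h R z"
      by (rule potential_bound[OF h R L(1,2,4) z(1)])
    fix a assume a: "a \<in> ?A"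
    have "norm (cnj a / (of_real (R^2) - cnj a * z)) = pole_pow 1 R a z"
    proof (cases "a = 0")
      case False
      then show ?thesis unfolding mirror_denom[OF False]
        by (simp add: pole_pow_def norm_divide norm_mult powr_minus_divide)
    qed (simp add: pole_pow_def)
    moreover have "norm (1 / (z - a)) = 1 / norm (z - a)" by (simp add: norm_divide)
    ultimately show "norm (of_int (zorder h a) * (1 / (z - a) + cnj a / (of_real (R^2) - cnj a * z)))
        \<le> \<bar>of_int (zorder h a)\<bar> * (1 / norm (z - a) + pole_pow 1 R a z)"
      unfolding norm_mult by (intro mult_mono) (auto intro: order_trans[OF norm_triangle_ineq])
  qed
  finally show ?thesis .
qed

lemma pole_pow_powr: "pole_pow 1 R a z powr \<alpha> = pole_pow \<alpha> R a z"
  by (cases "a = 0", simp add: pole_pow_def, simp only: pole_pow_def if_False powr_powr) simp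

lemma pole_pow_nonneg [simp]: "0 \<le> pole_pow \<alpha> R a z"
  by (simp add: pole_pow_def)

lemma abs_log_mean_nonneg: "unit_off B h \<Longrightarrow> good R \<Longrightarrow> 0 \<le> abs_log_mean h R"
  unfolding abs_log_mean_def using good_pos[of R]
  by (intro circle_mean_nonneg continuous_on_rabs continuous_on_ln_norm_unit) (auto simp: good_def)

lemma order_sum_nonneg: "0 \<le> order_sum h R"
  by (simp add: order_sum_def sum_nonneg)

text \<open>The mean of \<open>1 / norm (z - a)\<close> is not bounded uniformly in
  \<open>a\<close>, but that of its power with exponent \<open>\<alpha>\<close> is. So the power of
  the logarithmic derivative is averaged, and concavity of \<open>ln\<close> moves the mean inside
  the logarithm at the cost of the factor \<open>1 / \<alpha>\<close>.\<close>

theorem log_deriv_lemma: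
  assumes h: "unit_off B h" and r: "good r" and R: "good R" and rR: "r < R" and \<alpha>: "0 < \<alpha>" "\<alpha> < 1"
  shows "proximity_fun (\<lambda>z. deriv h z / h z) r
    \<le> 1 / \<alpha> * ln (2 + 2 * (abs_log_mean h R / (R - r)) + order_sum h R * (2 * (r powr (-\<alpha>) / cos (\<alpha> * pi / 2))))"
proof -
  let ?A = "B \<inter> ball 0 R"
  have r0': "0 < r" using good_pos[OF r] .
  define e where "e = r powr (-\<alpha>) / cos (\<alpha> * pi / 2)"
  have e0: "0 \<le> e" using cos_mult_half_pi_pos[OF \<alpha>] by (simp add: e_def)
  define t where "t = (\<lambda>a z. norm (z - a) powr (-\<alpha>) + pole_pow \<alpha> R a z)"
  define Y where "Y = (\<lambda>z. (2 + 2 * potential h R z) + (\<Sum>a\<in>?A. \<bar>of_int (zorder h a)\<bar> * t a z))"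
  \<comment> \<open>\<open>M\<close> will bound the mean of \<open>Y\<close>. The summand 2 in both
    is 1 from \<open>max 1 q\<close> plus 1 from
    \<open>(2 * p) powr \<alpha> \<le> 1 + 2 * p\<close>.\<close>
  define M where "M = 2 + 2 * (abs_log_mean h R / (R - r)) + order_sum h R * (2 * e)"
  have M2: "2 \<le> M" unfolding M_def
    using abs_log_mean_nonneg[OF h R] order_sum_nonneg[of h R] e0 rR by simp
  have nB: "norm a \<noteq> r" if "a \<in> B" for a using good_notin[OF r] that by auto
  have ct1: "continuous_on (sphere 0 r) (\<lambda>z. norm (z - a) powr (-\<alpha>))" if "a \<in> ?A" for a
    using nB that by (intro continuous_intros) auto
  have ct2: "continuous_on (sphere 0 r) (\<lambda>z. pole_pow \<alpha> R a z)" if "a \<in> ?A" for a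
    using that rR by (intro continuous_on_pole_pow) auto
  have ct: "continuous_on (sphere 0 r) (\<lambda>z. \<bar>of_int (zorder h a)\<bar> * t a z)" if "a \<in> ?A" for a
    unfolding t_def by (intro continuous_on_mult continuous_on_add ct1[OF that] ct2[OF that] continuous_on_const)
  have cp: "continuous_on (sphere 0 r) (\<lambda>z. 2 + 2 * potential h R z)"
    by (intro continuous_on_add continuous_on_mult continuous_on_const continuous_on_potential[OF h R rR])
  have cs: "continuous_on (sphere 0 r) (\<lambda>z. \<Sum>a\<in>?A. \<bar>of_int (zorder h a)\<bar> * t a z)"
    using ct by (intro continuous_on_sum) auto
  have cY: "continuous_on (sphere 0 r) Y"
    unfolding Y_def by (intro continuous_on_add cp cs)
  have meanY: "circle_mean Y r \<le> M"
  proof -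
    have "circle_mean Y r = circle_mean (\<lambda>z. 2 + 2 * potential h R z) r + (\<Sum>a\<in>?A. circle_mean (\<lambda>z. \<bar>of_int (zorder h a)\<bar> * t a z) r)"
      unfolding Y_def using r0'
      by (subst circle_mean_add[OF cp cs], simp, subst circle_mean_sum[OF finite_B ct]) simp_all
    also have "circle_mean (\<lambda>z. 2 + 2 * potential h R z) r = 2 + 2 * circle_mean (potential h R) r"
      using r0' continuous_on_potential[OF h R rR]
      by (subst circle_mean_add) (auto simp: circle_mean_cmult intro!: continuous_on_mult continuous_on_const)
    also have "(\<Sum>a\<in>?A. circle_mean (\<lambda>z. \<bar>of_int (zorder h a)\<bar> * t a z) r) \<le> (\<Sum>a\<in>?A. \<bar>of_int (zorder h a)\<bar> * (2 * e))"
    proof (rule sum_mono)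
      fix a assume a: "a \<in> ?A"
      have "circle_mean (t a) r = circle_mean (\<lambda>z. norm (z - a) powr (-\<alpha>)) r + circle_mean (pole_pow \<alpha> R a) r"
        unfolding t_def using ct1[OF a] ct2[OF a] r0' by (subst circle_mean_add) auto
      also have "\<dots> \<le> e + e" unfolding e_def
        using a nB rR by (intro add_mono circle_mean_powr_le circle_mean_pole_pow \<alpha> r0') auto
      finally show "circle_mean (\<lambda>z. \<bar>of_int (zorder h a)\<bar> * t a z) r \<le> \<bar>of_int (zorder h a)\<bar> * (2 * e)"
        unfolding circle_mean_cmult by (intro mult_left_mono) auto
    qed
    also have "(\<Sum>a\<in>?A. \<bar>of_int (zorder h a)\<bar> * (2 * e)) = order_sum h R * (2 * e)"
      by (simp add: order_sum_def sum_distrib_right)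
    finally show ?thesis using circle_mean_potential[OF h R r0' rR] unfolding M_def abs_log_mean_def by simp
  qed
  have pt: "log_plus (deriv h z / h z) \<le> 1 / \<alpha> * (1 / M * Y z + (ln M - 1))" if z: "norm z = r" for z
  proof -
    define q where "q = norm (deriv h z / h z)"
    have p0: "0 \<le> potential h R z" using potential_nonneg[OF h R] z rR by simp
    have q: "q \<le> 2 * potential h R z + (\<Sum>a\<in>?A. \<bar>of_int (zorder h a)\<bar> * (1 / norm (z - a) + pole_pow 1 R a z))"
      unfolding q_def using z rR good_notin[OF r z] by (intro log_deriv_pointwise h R) auto
    have "q powr \<alpha> \<le> (2 * potential h R z + (\<Sum>a\<in>?A. \<bar>of_int (zorder h a)\<bar> * (1 / norm (z - a) + pole_pow 1 R a z))) powr \<alpha>"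
      using q \<alpha> by (intro powr_mono2) (auto simp: q_def)
    also have "\<dots> \<le> (2 * potential h R z) powr \<alpha> + (\<Sum>a\<in>?A. \<bar>of_int (zorder h a)\<bar> * (1 / norm (z - a) + pole_pow 1 R a z)) powr \<alpha>"
      using \<alpha> p0 by (intro powr_add_le) (auto intro!: sum_nonneg)
    also have "(\<Sum>a\<in>?A. \<bar>of_int (zorder h a)\<bar> * (1 / norm (z - a) + pole_pow 1 R a z)) powr \<alpha>
       \<le> (\<Sum>a\<in>?A. (\<bar>of_int (zorder h a)\<bar> * (1 / norm (z - a) + pole_pow 1 R a z)) powr \<alpha>)"
      using \<alpha> by (intro powr_sum_le) auto
    also have "\<dots> \<le> (\<Sum>a\<in>?A. \<bar>of_int (zorder h a)\<bar> * t a z)"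
    proof (rule sum_mono)
      fix a
      have "(\<bar>of_int (zorder h a)\<bar> * (1 / norm (z - a) + pole_pow 1 R a z)) powr \<alpha>
        \<le> \<bar>of_int (zorder h a)\<bar> * (1 / norm (z - a) + pole_pow 1 R a z) powr \<alpha>"
        using \<alpha> by (intro powr_of_nat_mult_le) auto
      also have "\<dots> \<le> \<bar>of_int (zorder h a)\<bar> * ((1 / norm (z - a)) powr \<alpha> + pole_pow 1 R a z powr \<alpha>)"
        using \<alpha> by (intro mult_left_mono powr_add_le) auto
      also have "(1 / norm (z - a)) powr \<alpha> = norm (z - a) powr (-\<alpha>)"
        by (simp add: powr_divide powr_minus_divide)
      finally show "(\<bar>of_int (zorder h a)\<bar> * (1 / norm (z - a) + pole_pow 1 R a z)) powr \<alpha> \<le> \<bar>of_int (zorder h a)\<bar> * t a z"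
        by (simp add: t_def pole_pow_powr)
    qed
    also have "(2 * potential h R z) powr \<alpha> \<le> 1 + 2 * potential h R z"
    proof (cases "2 * potential h R z \<le> 1")
      case True
      then have "(2 * potential h R z) powr \<alpha> \<le> 1" using \<alpha> p0 by (intro powr_le1) auto
      then show ?thesis using p0 by linarith
    next
      case False
      then have "(2 * potential h R z) powr \<alpha> \<le> (2 * potential h R z) powr 1" using \<alpha> by (intro powr_mono) auto
      then show ?thesis using p0 by simp
    qed
    finally have qY: "1 + q powr \<alpha> \<le> Y z" by (simp add: Y_def)
    have "max 1 q powr \<alpha> \<le> 1 + q powr \<alpha>" by (simp add: max_def)
    then have mY: "max 1 q powr \<alpha> \<le> Y z" using qY by simp
    have Y1: "0 < Y z" using qY by (smt (verit) powr_ge_zero)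
    have "\<alpha> * ln (max 1 q) = ln (max 1 q powr \<alpha>)" by (simp add: ln_powr)
    also have "\<dots> \<le> ln (Y z)" using mY Y1 by (subst ln_le_cancel_iff) auto
    also have "\<dots> = ln (Y z / M) + ln M" using Y1 M2 by (simp add: ln_div)
    \<comment> \<open>The tangent of \<open>ln\<close> at 1 does the work of Jensen's inequality for
      concave functions: the mean of \<open>Y / M - 1\<close> is nonpositive.\<close>
    also have "\<dots> \<le> (Y z / M - 1) + ln M" using Y1 M2 ln_le_minus_one[of "Y z / M"] by simp
    finally have "\<alpha> * log_plus (deriv h z / h z) \<le> 1 / M * Y z + (ln M - 1)" by (simp add: log_plus_def q_def)
    then show ?thesis using \<alpha> by (simp add: field_simps)
  qed
  have "proximity_fun (\<lambda>z. deriv h z / h z) r \<le> circle_mean (\<lambda>z. 1 / \<alpha> * (1 / M * Y z + (ln M - 1))) r"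
    unfolding proximity_eq_circle_mean
    using r0' pt cY by (intro circle_mean_mono regular_cont_log_plus[OF regular_off_divide[OF regular_off_deriv[OF unit_off_imp_regular[OF h]] h] r]
        continuous_on_mult continuous_on_add continuous_on_const) auto
  also have "\<dots> = 1 / \<alpha> * (1 / M * circle_mean Y r + (ln M - 1))"
    unfolding circle_mean_cmult using r0' cY
    by (subst circle_mean_add) (auto simp: circle_mean_cmult simp del: times_divide_eq_left intro!: continuous_on_mult continuous_on_const)
  also have "\<dots> \<le> 1 / \<alpha> * ln M"
    using meanY M2 \<alpha> by (intro mult_left_mono) (auto simp: field_simps)
  finally show ?thesis unfolding M_def e_def .
qed

text \<open>The difference of logarithms is estimated term by term: the zero-free part by a
  derivative bound along the segment from \<open>z\<close> to \<open>z + c\<close>, each Blaschke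
  factor by \<open>abs_ln_shift_le\<close> at its zero and at its reflected pole. The result is
  linear in the growth of \<open>h\<close>, with factors \<open>1 / (R - r)\<close> and
  \<open>r powr (- \<alpha>)\<close> to beat it.\<close>

theorem shift_quotient_lemma:
  assumes h: "unit_off B h" and r: "good r" and R: "good R" and rR: "r < R" "r + 2 * norm c \<le> R"
    and \<alpha>: "0 < \<alpha>" "\<alpha> < 1" and shift: "\<And>z. norm z = r \<Longrightarrow> z + c \<notin> B"
  shows "circle_mean (\<lambda>z. \<bar>ln (norm (h (z + c))) - ln (norm (h z))\<bar>) r
    \<le> 8 * norm c * (abs_log_mean h R / (R - r))
      + order_sum h R * (4 * (norm c powr \<alpha> / \<alpha>) * (r powr (-\<alpha>) / cos (\<alpha> * pi / 2)))"
proof (cases "c = 0")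
  case True
  then show ?thesis by (simp)
next
  case c0: False
  let ?A = "B \<inter> ball 0 R"
  have r0': "0 < r" using good_pos[OF r] .
  have R0: "0 < R" using good_pos[OF R] .
  have rc: "r + norm c < R" using rR c0 zero_less_norm_iff[of c] by linarith
  define e where "e = r powr (-\<alpha>) / cos (\<alpha> * pi / 2)"
  obtain L R' where L: "R < R'" "L holomorphic_on ball 0 R'"
    "\<And>z. norm z < R' \<Longrightarrow> z \<notin> B \<Longrightarrow> h z = exp (L z) * (\<Prod>a\<in>?A. blaschke R a z powi zorder h a)"
    "\<And>z. norm z = R \<Longrightarrow> Re (L z) = ln (norm (h z))"
    by (rule blaschke_factorization[OF h R], rule that)
  define k where "k = norm c powr \<alpha> / \<alpha>"
  have k0: "0 \<le> k" using \<alpha> by (simp add: k_def)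
  \<comment> \<open>Four kernels per point: \<open>z\<close> and \<open>z + c\<close> against the
    zero \<open>a\<close>, then both against its reflection. The second is centred at
    \<open>a - c\<close> to fit \<open>circle_mean_powr_le\<close>.\<close>
  define t where "t = (\<lambda>a z. k * ((norm (z - a) powr (-\<alpha>) + norm (z - (a - c)) powr (-\<alpha>)) + (pole_pow \<alpha> R a z + pole_pow \<alpha> R a (z + c))))"
  have nB: "norm a \<noteq> r" "norm (a - c) \<noteq> r" if "a \<in> B" for a
    using good_notin[OF r] shift[of "a - c"] that by auto
  have zc: "norm (z + c) < R" if "norm z = r" for z
    using norm_triangle_ineq[of z c] that rc by simp
  have ct1: "continuous_on (sphere 0 r) (\<lambda>z. norm (z - a) powr (-\<alpha>))" if "norm a \<noteq> r" for a
    using that by (intro continuous_intros) auto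
  have ct2: "continuous_on (sphere 0 r) (\<lambda>z. pole_pow \<alpha> R a z)" if "a \<in> ?A" for a
    using that rR by (intro continuous_on_pole_pow) auto
  have ct3: "continuous_on (sphere 0 r) (\<lambda>z. pole_pow \<alpha> R a (z + c))" if "a \<in> ?A" for a
    using that zc by (intro continuous_on_pole_pow continuous_intros) (auto intro: less_imp_le)
  have ct: "continuous_on (sphere 0 r) (\<lambda>z. \<bar>of_int (zorder h a)\<bar> * t a z)" if "a \<in> ?A" for a
    unfolding t_def using that nB by (intro continuous_on_mult continuous_on_add ct1 ct2 ct3 continuous_on_const) auto
  have mp3: "circle_mean (\<lambda>z. pole_pow \<alpha> R a (z + c)) r \<le> e" if a: "a \<in> ?A" for a
  proof (cases "a = 0")
    case True
    then show ?thesis using cos_mult_half_pi_pos[OF \<alpha>] by (simp add: pole_pow_def e_def)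
  next
    case False
    have "R < norm (mirror R a)" using norm_mirror[OF False] a by auto
    then have "norm (mirror R a - c) > r" using norm_triangle_ineq2[of "mirror R a" c] rc by linarith
    then have "circle_mean (\<lambda>z. norm (z - (mirror R a - c)) powr (-\<alpha>)) r \<le> e"
      unfolding e_def by (intro circle_mean_powr_le \<alpha> r0') auto
    then show ?thesis using False by (simp add: pole_pow_def algebra_simps)
  qed
  have mt: "circle_mean (t a) r \<le> 4 * k * e" if a: "a \<in> ?A" for a
  proof -
    have aB: "a \<in> B" using a by auto
    have r0le: "0 \<le> r" using r0' by simp
    note c1 = ct1[OF nB(1)[OF aB]] and c2 = ct1[OF nB(2)[OF aB]]
    have "circle_mean (t a) r = k * ((circle_mean (\<lambda>z. norm (z - a) powr (-\<alpha>)) r + circle_mean (\<lambda>z. norm (z - (a - c)) powr (-\<alpha>)) r)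
       + (circle_mean (pole_pow \<alpha> R a) r + circle_mean (\<lambda>z. pole_pow \<alpha> R a (z + c)) r))"
      unfolding t_def circle_mean_cmult
      by (simp only: circle_mean_add[OF continuous_on_add[OF c1 c2] continuous_on_add[OF ct2[OF a] ct3[OF a]] r0le]
          circle_mean_add[OF c1 c2 r0le] circle_mean_add[OF ct2[OF a] ct3[OF a] r0le])
    also have "\<dots> \<le> k * ((e + e) + (e + e))"
      using mp3[OF a] k0 a rR unfolding e_def
      by (intro mult_left_mono add_mono circle_mean_powr_le circle_mean_pole_pow \<alpha> r0' nB[OF aB]) auto
    finally show ?thesis by (simp add: algebra_simps)
  qed
  have pt: "\<bar>ln (norm (h (z + c))) - ln (norm (h z))\<bar>
      \<le> (8 * norm c) * potential h R z + (\<Sum>a\<in>?A. \<bar>of_int (zorder h a)\<bar> * t a z)" if z: "norm z = r" for z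
  proof -
    have dz: "of_real (R^2) - cnj a * y \<noteq> 0" if "a \<in> ?A" "norm y < R" for a y
    proof (rule denom_nz)
      have "norm a * norm y \<le> R * norm y" using that by (intro mult_right_mono) auto
      also have "\<dots> < R * R" using that R0 by simp
      finally show "norm a * norm y < R^2" by (simp add: power2_eq_square)
    qed
    have lnh: "ln (norm (h y)) = Re (L y) + (\<Sum>a\<in>?A. of_int (zorder h a) * ln (norm (blaschke R a y)))"
      if y: "norm y < R" "y \<notin> B" for y
    proof -
      have bnz: "blaschke R a y \<noteq> 0" if "a \<in> ?A" for a
        unfolding blaschke_def using dz[OF that y(1)] that y R0 by (auto simp del: of_real_power)
      have "ln (norm (h y)) = ln (exp (Re (L y)) * (\<Prod>a\<in>?A. norm (blaschke R a y) powi zorder h a))"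
        using L(3)[of y] y L(1) by (simp add: norm_mult prod_norm[symmetric] norm_power_int)
      also have "\<dots> = Re (L y) + ln (\<Prod>a\<in>?A. norm (blaschke R a y) powi zorder h a)"
        using bnz by (subst ln_mult) (auto simp: prod_zero_iff)
      also have "ln (\<Prod>a\<in>?A. norm (blaschke R a y) powi zorder h a) = (\<Sum>a\<in>?A. ln (norm (blaschke R a y) powi zorder h a))"
        using bnz by (intro ln_prod) auto
      also have "\<dots> = (\<Sum>a\<in>?A. of_int (zorder h a) * ln (norm (blaschke R a y)))"
        using bnz by (intro sum.cong refl ln_power_int) auto
      finally show ?thesis .
    qed
    have lnb: "\<bar>ln (norm (blaschke R a (z + c))) - ln (norm (blaschke R a z))\<bar> \<le> t a z" if a: "a \<in> ?A" for a
    proof -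
      have za: "z - a \<noteq> 0" "z + c - a \<noteq> 0" using a good_notin[OF r z] shift[OF z] by auto
      have zR: "norm z < R" using z rR by simp
      have lb: "ln (norm (blaschke R a y)) = ln (norm (y - a)) + ln R - ln (norm (of_real (R^2) - cnj a * y))"
        if "norm y < R" "y - a \<noteq> 0" for y
        unfolding blaschke_def norm_divide norm_mult using that(2) dz[OF a that(1)] R0
        by (simp add: ln_mult ln_div del: of_real_power)
      have 1: "\<bar>ln (norm (z + c - a)) - ln (norm (z - a))\<bar> \<le> k * (norm (z - a) powr (-\<alpha>) + norm (z - (a - c)) powr (-\<alpha>))"
        using abs_ln_shift_le[of \<alpha> "z - a" c] za \<alpha> unfolding k_def by (simp add: algebra_simps)
      have 2: "\<bar>ln (norm (of_real (R^2) - cnj a * (z + c))) - ln (norm (of_real (R^2) - cnj a * z))\<bar>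
         \<le> k * (pole_pow \<alpha> R a z + pole_pow \<alpha> R a (z + c))"
      proof (cases "a = 0")
        case False
        define b where "b = mirror R a"
        have "R < norm b" unfolding b_def using norm_mirror[OF False] a by auto
        then have nz: "z - b \<noteq> 0" "z - b + c \<noteq> 0" using zR zc[OF z] by (auto simp: algebra_simps)
        have l: "ln (norm (of_real (R^2) - cnj a * y)) = ln (norm a) + ln (norm (y - b))" if "y - b \<noteq> 0" for y
          unfolding mirror_denom[OF False] b_def[symmetric] norm_mult using that False by (simp add: ln_mult)
        have e: "z - b + c = z + c - b" by simp
        have "\<bar>ln (norm (z - b + c)) - ln (norm (z - b))\<bar> \<le> k * (norm (z - b) powr (-\<alpha>) + norm (z - b + c) powr (-\<alpha>))"
          unfolding k_def using nz \<alpha> by (intro abs_ln_shift_le) auto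
        then have "\<bar>ln (norm (z + c - b)) - ln (norm (z - b))\<bar>
            \<le> k * (pole_pow \<alpha> R a z + pole_pow \<alpha> R a (z + c))"
          unfolding e using False by (simp add: pole_pow_def b_def)
        then show ?thesis unfolding l[OF nz(1)] l[OF nz(2)[unfolded e]] add_diff_cancel_left .
      qed (use k0 in \<open>auto simp: pole_pow_def\<close>)
      have "ln (norm (blaschke R a (z + c))) - ln (norm (blaschke R a z))
         = (ln (norm (z + c - a)) - ln (norm (z - a))) - (ln (norm (of_real (R^2) - cnj a * (z + c))) - ln (norm (of_real (R^2) - cnj a * z)))"
        using lb[OF zR za(1)] lb[OF zc[OF z] za(2)] by simp
      then show ?thesis using 1 2 unfolding t_def distrib_left[of k "_ + _" "_ + _"] by linarith
    qed
    have "\<bar>Re (L (z + c)) - Re (L z)\<bar> \<le> 8 * norm c * potential h R z"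
    proof -
      \<comment> \<open>The constant 8 is 2 from \<open>potential_bound\<close> times 4 from
        \<open>potential_shift\<close>.\<close>
      have "norm (L (z + c) - L z) \<le> (8 * potential h R z) * norm (z + c - z)"
      proof (rule field_differentiable_bound)
        fix y assume "y \<in> closed_segment z (z + c)"
        then have yz: "norm (y - z) \<le> norm c" using segment_bound1[of y z "z + c"] by simp
        then have yR: "norm y < R" using norm_triangle_ineq[of z "y - z"] z rc by simp
        show "(L has_field_derivative deriv L y) (at y within closed_segment z (z + c))"
          using L(1) yR by (intro holomorphic_derivI[OF L(2)]) auto
        have "norm (deriv L y) \<le> 2 * potential h R y"
          by (rule potential_bound[OF h R L(1,2,4) yR])
        also have "\<dots> \<le> 8 * potential h R z"
          using potential_shift[OF h R z r0' rR(2,1) yz] by simp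
        finally show "norm (deriv L y) \<le> 8 * potential h R z" .
      qed auto
      then have "norm (L (z + c) - L z) \<le> 8 * norm c * potential h R z" by (simp add: algebra_simps)
      then show ?thesis using abs_Re_le_cmod[of "L (z + c) - L z"] by simp
    qed
    moreover have "\<bar>(\<Sum>a\<in>?A. of_int (zorder h a) * ln (norm (blaschke R a (z + c)))) - (\<Sum>a\<in>?A. of_int (zorder h a) * ln (norm (blaschke R a z)))\<bar>
       \<le> (\<Sum>a\<in>?A. \<bar>of_int (zorder h a)\<bar> * t a z)"
      unfolding sum_subtractf[symmetric]
    proof (rule order_trans[OF sum_abs], rule sum_mono)
      fix a assume "a \<in> ?A"
      from mult_left_mono[OF lnb[OF this], of "\<bar>of_int (zorder h a)\<bar>"]
      show "\<bar>of_int (zorder h a) * ln (norm (blaschke R a (z + c))) - of_int (zorder h a) * ln (norm (blaschke R a z))\<bar>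
        \<le> \<bar>of_int (zorder h a)\<bar> * t a z"
        by (simp add: abs_mult flip: right_diff_distrib)
    qed
    ultimately show ?thesis
      using lnh[OF zc[OF z] shift[OF z]] lnh[of z] good_notin[OF r z] z rR by linarith
  qed
  have ch: "continuous_on (sphere 0 r) (\<lambda>z. \<bar>ln (norm (h (z + c))) - ln (norm (h z))\<bar>)"
  proof -
    have "continuous_on ((\<lambda>z. z + c) ` sphere 0 r) (\<lambda>z. ln (norm (h z)))"
      using shift by (intro continuous_on_ln_norm_unit[OF h]) auto
    then have c1: "continuous_on (sphere 0 r) (\<lambda>z. ln (norm (h (z + c))))"
      by (rule continuous_on_compose2) (auto intro: continuous_intros)
    have c2: "continuous_on (sphere 0 r) (\<lambda>z. ln (norm (h z)))"
      using r by (intro continuous_on_ln_norm_unit[OF h]) (auto simp: good_def)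
    show ?thesis by (intro continuous_on_rabs continuous_on_diff c1 c2)
  qed
  have cp: "continuous_on (sphere 0 r) (\<lambda>z. 8 * norm c * potential h R z)"
    by (intro continuous_on_mult continuous_on_const continuous_on_potential[OF h R rR(1)])
  have cs: "continuous_on (sphere 0 r) (\<lambda>z. \<Sum>a\<in>?A. \<bar>of_int (zorder h a)\<bar> * t a z)"
    using ct by (intro continuous_on_sum) auto
  have "circle_mean (\<lambda>z. \<bar>ln (norm (h (z + c))) - ln (norm (h z))\<bar>) r
     \<le> circle_mean (\<lambda>z. (8 * norm c) * potential h R z + (\<Sum>a\<in>?A. \<bar>of_int (zorder h a)\<bar> * t a z)) r"
    using pt r0' by (intro circle_mean_mono ch continuous_on_add cp cs) auto
  also have "\<dots> = 8 * norm c * circle_mean (potential h R) r + (\<Sum>a\<in>?A. \<bar>of_int (zorder h a)\<bar> * circle_mean (t a) r)"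
    using r0' by (subst circle_mean_add[OF cp cs], simp, subst circle_mean_sum[OF finite_B ct]) (simp_all add: circle_mean_cmult)
  also have "\<dots> \<le> 8 * norm c * (abs_log_mean h R / (R - r)) + (\<Sum>a\<in>?A. \<bar>of_int (zorder h a)\<bar> * (4 * k * e))"
    using circle_mean_potential[OF h R r0' rR(1)] mt unfolding abs_log_mean_def
    by (intro add_mono sum_mono mult_left_mono) auto
  also have "(\<Sum>a\<in>?A. \<bar>of_int (zorder h a)\<bar> * (4 * k * e)) = order_sum h R * (4 * k * e)"
    by (simp add: order_sum_def sum_distrib_right)
  finally show ?thesis unfolding k_def e_def .
qed

end

subsection \<open>Growth\<close>

text \<open>If every large radius failed, one could iterate: \<open>T\<close> doubles at each step
  while the radius advances by at most \<open>t powr \<beta>\<close>. After \<open>k\<close> steps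
  \<open>T\<close> is at least \<open>2 ^ k\<close>, but \<open>t powr (1 - \<beta>)\<close> has
  grown at most linearly in \<open>k\<close>, so the order bound is the exponential of a sublinear
  power of \<open>k\<close>. The choice of \<open>\<beta>\<close> ensures
  \<open>\<zeta> < 1 - \<beta>\<close>.\<close>

lemma doubling_radius:
  fixes T :: "real \<Rightarrow> real"
  assumes \<zeta>: "0 < \<zeta>" "\<zeta> < 1"
    and unb: "\<And>K x. \<exists>t\<in>\<Gamma>. x \<le> t \<and> K \<le> T t"
    and order: "\<And>t. t \<in> \<Gamma> \<Longrightarrow> \<rho> \<le> t \<Longrightarrow> T t \<le> exp (t powr \<zeta>)"
  defines "\<beta> \<equiv> (1 - \<zeta>) / 2"
  shows "\<exists>t\<in>\<Gamma>. x \<le> t \<and> K \<le> T t \<and> (\<forall>R\<in>\<Gamma>. t \<le> R \<longrightarrow> R \<le> t + t powr \<beta> \<longrightarrow> T R \<le> 2 * T t)"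
proof (rule ccontr)
  assume neg: "\<not> ?thesis"
  define x1 K1 where "x1 = max 1 (max \<rho> x)" and "K1 = max 1 K"
  have "\<exists>R\<in>\<Gamma>. t \<le> R \<and> R \<le> t + t powr \<beta> \<and> 2 * T t < T R" if "t \<in> \<Gamma>" "x1 \<le> t" "K1 \<le> T t" for t
    using neg that by (force simp: x1_def K1_def not_le)
  then obtain nxt where nxt: "\<And>t. t \<in> \<Gamma> \<Longrightarrow> x1 \<le> t \<Longrightarrow> K1 \<le> T t \<Longrightarrow>
      nxt t \<in> \<Gamma> \<and> t \<le> nxt t \<and> nxt t \<le> t + t powr \<beta> \<and> 2 * T t < T (nxt t)" by metis
  obtain t0 where t0: "t0 \<in> \<Gamma>" "x1 \<le> t0" "K1 \<le> T t0" using unb by blast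
  define t where "t = (\<lambda>k. (nxt ^^ k) t0)"
  have \<beta>: "0 < \<beta>" "\<beta> < 1" "\<zeta> < 1 - \<beta>" using \<zeta> by (auto simp: \<beta>_def field_simps)
  have inv: "t k \<in> \<Gamma> \<and> x1 \<le> t k \<and> K1 \<le> T (t k) \<and> 2 ^ k \<le> T (t k) \<and> t k powr (1 - \<beta>) \<le> t0 powr (1 - \<beta>) + k" for k
  proof (induction k)
    case 0
    then show ?case using t0 by (auto simp: t_def K1_def)
  next
    case (Suc k)
    have n: "t (Suc k) \<in> \<Gamma>" "t k \<le> t (Suc k)" "t (Suc k) \<le> t k + t k powr \<beta>" "2 * T (t k) < T (t (Suc k))"
      using nxt[of "t k"] Suc by (auto simp: t_def)
    have t1: "1 \<le> t k" using Suc by (auto simp: x1_def)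
    \<comment> \<open>The step length is matched to the power \<open>1 - \<beta>\<close>: each step
      increases \<open>t powr (1 - \<beta>)\<close> by at most 1.\<close>
    have "t (Suc k) powr (1 - \<beta>) \<le> (t k + t k powr \<beta>) powr (1 - \<beta>)"
      using n t1 \<beta> by (intro powr_mono2) auto
    also have "\<dots> = (t k * (1 + t k powr (\<beta> - 1))) powr (1 - \<beta>)"
      using t1 by (simp add: distrib_left powr_mult_base)
    also have "\<dots> = t k powr (1 - \<beta>) * (1 + t k powr (\<beta> - 1)) powr (1 - \<beta>)"
      using t1 by (simp add: powr_mult)
    also have "\<dots> \<le> t k powr (1 - \<beta>) * (1 + t k powr (\<beta> - 1)) powr 1"
      using \<beta> by (intro mult_left_mono powr_mono) auto
    also have "\<dots> = t k powr (1 - \<beta>) + 1"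
      using t1 by (simp add: distrib_left powr_add[symmetric])
    finally show ?case using n Suc t1 by (auto simp: K1_def)
  qed
  \<comment> \<open>\<open>q < 1\<close> because \<open>\<zeta> < 1 - \<beta>\<close>; hence
    \<open>(D + k) powr q\<close> eventually loses against \<open>k * ln 2\<close>.\<close>
  define D q where "D = t0 powr (1 - \<beta>)" and "q = \<zeta> / (1 - \<beta>)"
  have q: "0 < q" "q < 1" using \<zeta> \<beta> by (auto simp: q_def)
  have "eventually (\<lambda>k::nat. (D + real k) powr q < real k * ln 2) at_top"
    using q by real_asymp
  then obtain k where k: "(D + real k) powr q < real k * ln 2"
    by (meson eventually_happens' sequentially_bot)
  have tk: "1 \<le> t k" "\<rho> \<le> t k" using inv[of k] by (auto simp: x1_def)
  have "2 ^ k \<le> exp (t k powr \<zeta>)" using inv[of k] order[of "t k"] tk by force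
  then have "ln (2 ^ k) \<le> t k powr \<zeta>" by (metis exp_gt_zero ln_exp ln_le_cancel_iff zero_less_numeral zero_less_power)
  then have "real k * ln 2 \<le> t k powr \<zeta>" by (simp add: ln_realpow)
  also have "t k powr \<zeta> = (t k powr (1 - \<beta>)) powr q"
    using \<beta> by (simp add: powr_powr q_def)
  also have "\<dots> \<le> (D + k) powr q" using inv[of k] q by (intro powr_mono2) (auto simp: D_def)
  finally show False using k by simp
qed

context divisor begin

section \<open>Means and point counts against the characteristic\<close>

lemma abs_log_mean_eq:
  assumes h: "unit_off B h" and r: "good r"
  shows "abs_log_mean h r = proximity_fun h r + proximity_fun (\<lambda>z. inverse (h z)) r"
proof -
  note reg = unit_off_imp_regular[OF h] unit_off_imp_regular[OF unit_off_inverse[OF h]]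
  have "abs_log_mean h r = circle_mean (\<lambda>z. log_plus (h z) + log_plus (inverse (h z))) r"
    unfolding abs_log_mean_def using good_pos[OF r] good_notin[OF r] unit_off_nonzero[OF h]
    by (intro circle_mean_cong) (auto simp: abs_ln_norm_eq_log_plus)
  then show ?thesis using good_pos[OF r]
    by (simp add: proximity_eq_circle_mean circle_mean_add regular_cont_log_plus[OF reg(1) r] regular_cont_log_plus[OF reg(2) r])
qed

text \<open>A point of the smaller disc has weight at least \<open>(R' - R) / R'\<close> at the
  larger radius, because \<open>ln (y / R') \<le> y / R' - 1\<close>. So the weighted count at
  \<open>R'\<close> controls the unweighted one at \<open>R\<close>.\<close>

lemma order_sum_le:
  assumes h: "unit_off B h" and R: "good R" "good R'" "R < R'"
  shows "order_sum h R \<le> R' / (R' - R) * (T h R' + T (\<lambda>z. inverse (h z)) R')"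
proof -
  have R0: "0 < R" "r0 \<le> R" "r0 \<le> R'" using good_pos R by (auto simp: good_def)
  have "order_sum h R * ((R' - R) / R') = (\<Sum>a\<in>B \<inter> ball 0 R. of_int \<bar>zorder h a\<bar> * ((R' - R) / R'))"
    unfolding order_sum_def sum_distrib_right by simp
  also have "\<dots> \<le> (\<Sum>a\<in>B \<inter> ball 0 R. of_int \<bar>zorder h a\<bar> * weight R' a)"
  proof (intro sum_mono mult_left_mono)
    fix a assume a: "a \<in> B \<inter> ball 0 R"
    define y where "y = max r0 (norm a)"
    have y: "0 < y" "y \<le> R" using a R0 r0 by (auto simp: y_def)
    have "ln (y / R') \<le> y / R' - 1" using y R R0 by (intro ln_le_minus_one) auto
    also have "\<dots> \<le> R / R' - 1" using y R R0 by (simp add: divide_right_mono)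
    finally show "(R' - R) / R' \<le> weight R' a"
      unfolding weight_def y_def[symmetric] using y R R0 by (simp add: ln_div diff_divide_distrib)
  qed auto
  also have "\<dots> \<le> counting (\<lambda>a. \<bar>zorder h a\<bar>) R'"
    unfolding counting_def using R R0 by (intro sum_mono2) (auto intro!: mult_nonneg_nonneg weight_nonneg)
  also have "(\<lambda>a. \<bar>zorder h a\<bar>) = (\<lambda>a. max 0 (- zorder h a) + max 0 (zorder h a))" by auto
  also have "counting \<dots> R' \<le> T h R' + T (\<lambda>z. inverse (h z)) R'"
    using prox_nonneg[OF unit_off_imp_regular[OF h] R(2)]
      prox_nonneg[OF unit_off_imp_regular[OF unit_off_inverse[OF h]] R(2)]
    unfolding counting_add T_def by (simp add: zorder_inverse_unit[OF h])
  finally show ?thesis using R R0 by (simp add: field_simps)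
qed

lemma T_sum_eq:
  assumes h: "unit_off B h" and r: "good r"
  shows "T h r + T (\<lambda>z. inverse (h z)) r = 2 * T h r - circle_mean (\<lambda>z. ln (norm (h z))) r0"
  using first_main[OF assms] by simp

lemma abs_log_mean_le:
  assumes h: "unit_off B h" and r: "good r"
  shows "abs_log_mean h r \<le> 2 * T h r - circle_mean (\<lambda>z. ln (norm (h z))) r0"
  unfolding T_sum_eq[OF assms, symmetric] abs_log_mean_eq[OF assms] by (intro add_mono T_ge_prox r)

end

text \<open>
  \<open>X\<close> is a sequence of admissible radii after which the characteristic of \<open>f\<close> at most doubles on an
  interval of length \<open>X powr \<beta>\<close>. Intervals of length \<open>gap\<close> meet \<open>\<Gamma>\<close>, so the auxiliary radii required by
  the quotient lemmas can be found in that interval.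
\<close>

locale growth = divisor +
  fixes \<Gamma> :: "real set" and X :: "nat \<Rightarrow> real" and f :: "complex \<Rightarrow> complex" and c :: complex
    and \<beta> gap :: real
  assumes \<Gamma>_good: "r \<in> \<Gamma> \<Longrightarrow> good r"
    and \<Gamma>_shift: "r \<in> \<Gamma> \<Longrightarrow> norm z = r \<Longrightarrow> z + c \<notin> B"
    and \<Gamma>_dense: "r0 \<le> x \<Longrightarrow> x + gap \<le> y \<Longrightarrow> \<exists>r\<in>\<Gamma>. x \<le> r \<and> r \<le> y"
    and X_\<Gamma>: "X k \<in> \<Gamma>"
    and X_lim: "filterlim X at_top sequentially"
    and f_lim: "filterlim (\<lambda>k. proximity_fun f (X k)) at_top sequentially"
    and \<beta>: "0 < \<beta>" "\<beta> < 1"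
    and doubling: "R \<in> \<Gamma> \<Longrightarrow> X k \<le> R \<Longrightarrow> R \<le> X k + X k powr \<beta> \<Longrightarrow>
        proximity_fun f R \<le> 2 * proximity_fun f (X k)"
    and f_unit: "unit_off B f" and f_entire: "f holomorphic_on UNIV"
begin

definition T0 :: "nat \<Rightarrow> real" where
  "T0 k = proximity_fun f (X k)"

text \<open>Only half of the doubling interval, so that auxiliary radii up to
  \<open>X k powr \<beta> / 2\<close> beyond a near radius still lie inside it.\<close>

definition near :: "nat \<Rightarrow> real \<Rightarrow> bool" where
  "near k R \<longleftrightarrow> R \<in> \<Gamma> \<and> X k \<le> R \<and> R \<le> X k + X k powr \<beta> / 2"

text \<open>The logarithmic derivative at \<open>X k\<close> is estimated by the characteristic at
  larger radii, so a bound at \<open>X k\<close> alone would not suffice.\<close>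

definition tame :: "(complex \<Rightarrow> complex) \<Rightarrow> bool" where
  "tame h \<longleftrightarrow> (\<exists>C. \<forall>\<^sub>F k in sequentially. \<forall>R. near k R \<longrightarrow> T h R \<le> C * T0 k)"

text \<open>One-sided: only upper bounds enter, and \<open>u\<close> may be negative without
  restriction. Agreement up to \<open>o(T0)\<close> is expressed by two instances with opposite
  signs.\<close>

definition negl :: "(nat \<Rightarrow> real) \<Rightarrow> bool" where
  "negl u \<longleftrightarrow> (\<forall>\<epsilon>>0. \<forall>\<^sub>F k in sequentially. u k \<le> \<epsilon> * T0 k)"

section \<open>Calculus of negligible quantities\<close>

lemma T0_ge: "\<forall>\<^sub>F k in sequentially. K \<le> T0 k"
  using f_lim by (simp add: T0_def filterlim_at_top)

lemma X_ge: "\<forall>\<^sub>F k in sequentially. K \<le> X k"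
  using X_lim by (simp add: filterlim_at_top)

lemma good_X: "good (X k)"
  using \<Gamma>_good X_\<Gamma> by blast

lemma near_X: "near k (X k)"
  using X_\<Gamma> by (simp add: near_def)

lemma negl_const: "negl (\<lambda>_. K)"
  unfolding negl_def
proof (intro allI impI)
  fix \<epsilon> :: real assume "0 < \<epsilon>"
  then show "\<forall>\<^sub>F k in sequentially. K \<le> \<epsilon> * T0 k"
    by (intro eventually_mono[OF T0_ge[of "K / \<epsilon>"]]) (simp add: field_simps)
qed

lemma negl_add: "negl u \<Longrightarrow> negl v \<Longrightarrow> negl (\<lambda>k. u k + v k)"
  unfolding negl_def
proof (intro allI impI)
  fix \<epsilon> :: real assume *: "\<forall>\<epsilon>>0. \<forall>\<^sub>F k in sequentially. u k \<le> \<epsilon> * T0 k" "\<forall>\<epsilon>>0. \<forall>\<^sub>F k in sequentially. v k \<le> \<epsilon> * T0 k" "0 < \<epsilon>"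
  then have "\<forall>\<^sub>F k in sequentially. u k \<le> \<epsilon> / 2 * T0 k" "\<forall>\<^sub>F k in sequentially. v k \<le> \<epsilon> / 2 * T0 k"
    by (metis half_gt_zero)+
  then show "\<forall>\<^sub>F k in sequentially. u k + v k \<le> \<epsilon> * T0 k" by eventually_elim (simp add: field_simps)
qed

lemma negl_cmult: "0 \<le> K \<Longrightarrow> negl u \<Longrightarrow> negl (\<lambda>k. K * u k)"
  unfolding negl_def
proof (intro allI impI)
  fix \<epsilon> :: real assume *: "0 \<le> K" "\<forall>\<epsilon>>0. \<forall>\<^sub>F k in sequentially. u k \<le> \<epsilon> * T0 k" "0 < \<epsilon>"
  then have "\<forall>\<^sub>F k in sequentially. u k \<le> \<epsilon> / (K + 1) * T0 k" by (metis add_nonneg_pos divide_pos_pos zero_less_one)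
  with T0_ge[of 0] show "\<forall>\<^sub>F k in sequentially. K * u k \<le> \<epsilon> * T0 k"
  proof eventually_elim
    case (elim k)
    have "K * u k \<le> K * (\<epsilon> / (K + 1) * T0 k)" using elim * by (intro mult_left_mono) auto
    also have "\<dots> = (K / (K + 1)) * (\<epsilon> * T0 k)" by simp
    also have "\<dots> \<le> 1 * (\<epsilon> * T0 k)" using elim * by (intro mult_right_mono) auto
    finally show ?case by simp
  qed
qed

lemma negl_mono_eventually:
  assumes "negl v" "\<forall>\<^sub>F k in sequentially. u k \<le> v k"
  shows "negl u"
  unfolding negl_def
proof (intro allI impI)
  fix \<epsilon> :: real assume "0 < \<epsilon>"
  then have "\<forall>\<^sub>F k in sequentially. v k \<le> \<epsilon> * T0 k" using assms(1) by (simp add: negl_def)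
  with assms(2) show "\<forall>\<^sub>F k in sequentially. u k \<le> \<epsilon> * T0 k"
    by eventually_elim (rule order_trans)
qed

lemma negl_mono: "negl v \<Longrightarrow> (\<And>k. u k \<le> v k) \<Longrightarrow> negl u"
  by (rule negl_mono_eventually) auto

lemma negl_sum: "finite I \<Longrightarrow> (\<And>i. i \<in> I \<Longrightarrow> negl (u i)) \<Longrightarrow> negl (\<lambda>k. \<Sum>i\<in>I. u i k)"
proof (induction rule: finite_induct)
  case empty
  then show ?case using negl_const[of 0] by simp
next
  case (insert i I)
  then show ?case using negl_add[of "u i" "\<lambda>k. \<Sum>i\<in>I. u i k"] by simp
qed

text \<open>Two radii are needed: the logarithmic mean is taken at \<open>R\<close>, and the point
  count at \<open>R\<close> is controlled by the counting function at \<open>R' > R\<close>. Each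
  window has length \<open>X k powr \<beta> / 8\<close>, which is eventually at least
  \<open>gap\<close>, and the windows are separated by the same length.\<close>

lemma eventually_radii:
  "\<forall>\<^sub>F k in sequentially. \<forall>r. near k r \<longrightarrow> (\<exists>R R'. R \<in> \<Gamma> \<and> R' \<in> \<Gamma> \<and>
     r + X k powr \<beta> / 8 \<le> R \<and> R \<le> r + X k powr \<beta> / 4 \<and>
     r + 3 * X k powr \<beta> / 8 \<le> R' \<and> R' \<le> r + X k powr \<beta> / 2)"
proof -
  have "filterlim (\<lambda>k. X k powr \<beta>) at_top sequentially"
    by (rule filterlim_compose[OF _ X_lim]) (use \<beta> in real_asymp)
  then have "\<forall>\<^sub>F k in sequentially. max 0 (8 * gap) \<le> X k powr \<beta>" by (simp add: filterlim_at_top)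
  then show ?thesis
  proof (rule eventually_mono)
    fix k assume elim: "max 0 (8 * gap) \<le> X k powr \<beta>"
    show "\<forall>r. near k r \<longrightarrow> (\<exists>R R'. R \<in> \<Gamma> \<and> R' \<in> \<Gamma> \<and>
     r + X k powr \<beta> / 8 \<le> R \<and> R \<le> r + X k powr \<beta> / 4 \<and>
     r + 3 * X k powr \<beta> / 8 \<le> R' \<and> R' \<le> r + X k powr \<beta> / 2)"
    proof (intro allI impI)
      fix r assume r: "near k r"
      then have r0: "r0 \<le> r" using \<Gamma>_good by (auto simp: near_def good_def)
      have s: "0 \<le> X k powr \<beta>" "8 * gap \<le> X k powr \<beta>" using elim by auto
      have "r0 \<le> r + X k powr \<beta> / 8" "r + X k powr \<beta> / 8 + gap \<le> r + X k powr \<beta> / 4"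
        using r0 s by linarith+
      from \<Gamma>_dense[OF this] obtain R where "R \<in> \<Gamma>" "r + X k powr \<beta> / 8 \<le> R" "R \<le> r + X k powr \<beta> / 4"
        by blast
      moreover have "r0 \<le> r + 3 * X k powr \<beta> / 8" "r + 3 * X k powr \<beta> / 8 + gap \<le> r + X k powr \<beta> / 2"
        using r0 s by linarith+
      from \<Gamma>_dense[OF this] obtain R' where "R' \<in> \<Gamma>" "r + 3 * X k powr \<beta> / 8 \<le> R'" "R' \<le> r + X k powr \<beta> / 2"
        by blast
      ultimately show "\<exists>R R'. R \<in> \<Gamma> \<and> R' \<in> \<Gamma> \<and>
         r + X k powr \<beta> / 8 \<le> R \<and> R \<le> r + X k powr \<beta> / 4 \<and>
         r + 3 * X k powr \<beta> / 8 \<le> R' \<and> R' \<le> r + X k powr \<beta> / 2" by blast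
    qed
  qed
qed

text \<open>The exponent used in both quotient lemmas; it beats the loss \<open>X powr (1 - \<beta>)\<close> incurred when
  the number of zeros and poles is estimated by the counting function.\<close>

definition \<alpha> :: real where
  "\<alpha> = 1 - \<beta> / 2"

lemma \<alpha>: "0 < \<alpha>" "\<alpha> < 1"
  using \<beta> by (auto simp: \<alpha>_def)

text \<open>\<open>R - r\<close> and \<open>R' - R\<close> are at least
  \<open>X k powr \<beta> / 8\<close>, and
  \<open>R' \<le> X k + X k powr \<beta> \<le> 2 * X k\<close>; this gives 8 and 16. The second
  exponent is \<open>1 - \<beta> - \<alpha> = - \<beta> / 2\<close>.\<close>

lemma circle_terms:
  assumes h: "unit_off B h" and K: "0 < K"
    and r: "r \<in> \<Gamma>" "X k \<le> r" "r \<le> X k + X k powr \<beta> / 2" and R: "R \<in> \<Gamma>" "R' \<in> \<Gamma>"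
    and Rr: "r + X k powr \<beta> / 8 \<le> R" "R \<le> r + X k powr \<beta> / 4" "r + 3 * X k powr \<beta> / 8 \<le> R'" "R' \<le> r + X k powr \<beta> / 2"
    and TR: "2 * T h R - circle_mean (\<lambda>z. ln (norm (h z))) r0 \<le> K" "2 * T h R' - circle_mean (\<lambda>z. ln (norm (h z))) r0 \<le> K"
  shows "abs_log_mean h R / (R - r) \<le> 8 * K * X k powr (-\<beta>)"
    and "order_sum h R * r powr (-\<alpha>) \<le> 16 * K * X k powr (- \<beta> / 2)"
proof -
  have gR: "good R" "good R'" using R \<Gamma>_good by auto
  have x1: "1 \<le> X k" using good_X[of k] r0 by (simp add: good_def)
  then have xb: "0 < X k powr \<beta>" by simp
  have RR: "X k powr \<beta> / 8 \<le> R' - R" "R < R'" using Rr xb by linarith+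
  have "abs_log_mean h R \<le> K" using abs_log_mean_le[OF h gR(1)] TR by simp
  then have "abs_log_mean h R / (R - r) \<le> K / (X k powr \<beta> / 8)"
    using Rr xb K by (intro frac_le) auto
  then show "abs_log_mean h R / (R - r) \<le> 8 * K * X k powr (-\<beta>)"
    by (simp add: powr_minus_divide field_simps)
  have xbx: "X k powr \<beta> \<le> X k" using x1 \<beta> powr_mono[of \<beta> 1 "X k"] by simp
  have "order_sum h R \<le> R' / (R' - R) * (2 * T h R' - circle_mean (\<lambda>z. ln (norm (h z))) r0)"
    using order_sum_le[OF h gR RR(2)] T_sum_eq[OF h gR(2)] by simp
  also have "\<dots> \<le> R' / (R' - R) * K"
    using TR RR good_pos[OF gR(2)] by (intro mult_left_mono) auto
  also have "\<dots> \<le> (2 * X k) / (X k powr \<beta> / 8) * K"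
    using RR Rr xb xbx r K good_pos[OF gR(2)] by (intro mult_right_mono frac_le) auto
  also have "\<dots> = 16 * K * X k powr (1 - \<beta>)"
    using x1 by (simp add: powr_diff field_simps)
  finally have n: "order_sum h R \<le> 16 * K * X k powr (1 - \<beta>)" .
  have "r powr (-\<alpha>) \<le> X k powr (-\<alpha>)" using r x1 \<alpha> by (intro powr_mono2') auto
  then have "order_sum h R * r powr (-\<alpha>) \<le> (16 * K * X k powr (1 - \<beta>)) * X k powr (-\<alpha>)"
    using n K by (intro mult_mono) auto
  also have "\<dots> = 16 * K * X k powr (1 - \<beta> - \<alpha>)" by (simp add: powr_add[symmetric])
  also have "\<dots> = 16 * K * X k powr (- \<beta> / 2)" by (simp add: \<alpha>_def)
  finally show "order_sum h R * r powr (-\<alpha>) \<le> 16 * K * X k powr (- \<beta> / 2)" .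
qed

lemma X_powr_small: "0 < d \<Longrightarrow> 0 < \<gamma> \<Longrightarrow> \<forall>\<^sub>F k in sequentially. K * X k powr (-\<gamma>) \<le> d"
proof -
  assume d: "0 < d" "0 < \<gamma>"
  have "((\<lambda>x. K * x powr (-\<gamma>)) \<longlongrightarrow> 0) at_top" using d by real_asymp
  then have "((\<lambda>k. K * X k powr (-\<gamma>)) \<longlongrightarrow> 0) sequentially" by (rule filterlim_compose[OF _ X_lim])
  then have "\<forall>\<^sub>F k in sequentially. K * X k powr (-\<gamma>) < d" using d by (intro order_tendstoD) auto
  then show ?thesis by eventually_elim simp
qed

lemma negl_ln: "negl (\<lambda>k. ln (2 + K * T0 k))" if "0 \<le> K"
  unfolding negl_def
proof (intro allI impI)
  fix \<epsilon> :: real assume "0 < \<epsilon>"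
  then have "\<forall>\<^sub>F x in at_top. ln (2 + (K + 1) * x) \<le> \<epsilon> * x"
    using that by real_asymp
  then have "\<forall>\<^sub>F x in at_top. ln (2 + K * x) \<le> \<epsilon> * x"
    using eventually_ge_at_top[of 0]
  proof eventually_elim
    case (elim x)
    have "ln (2 + K * x) \<le> ln (2 + (K + 1) * x)"
      using that elim by (subst ln_le_cancel_iff) (auto simp: distrib_right intro: add_pos_nonneg)
    then show ?case using elim by simp
  qed
  then show "\<forall>\<^sub>F k in sequentially. ln (2 + K * T0 k) \<le> \<epsilon> * T0 k"
    using f_lim unfolding T0_def by (rule eventually_compose_filterlim)
qed

text \<open>The bound is the logarithm of a quantity linear in \<open>T0\<close>, so any linear
  bound near \<open>X k\<close> is enough; the negative powers of \<open>X k\<close> are merely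
  estimated by 1.\<close>

theorem log_deriv_negl:
  assumes h: "unit_off B h" and tame: "tame h"
  shows "negl (\<lambda>k. proximity_fun (\<lambda>z. deriv h z / h z) (X k))"
proof -
  obtain C where C: "\<forall>\<^sub>F k in sequentially. \<forall>R. near k R \<longrightarrow> T h R \<le> C * T0 k"
    using tame by (auto simp: tame_def)
  \<comment> \<open>\<open>2 * \<bar>C\<bar>\<close> for twice the characteristic, and 1 for the
    constant from the base circle, which \<open>T0\<close> eventually dominates.\<close>
  define K where "K = 2 * \<bar>C\<bar> + 1"
  define co where "co = cos (\<alpha> * pi / 2)"
  have co: "0 < co" unfolding co_def by (rule cos_mult_half_pi_pos[OF \<alpha>])
  define M where "M = 16 * K + 32 * K / co"
  have K: "0 < K" by (simp add: K_def)
  have M: "0 \<le> M" using K co by (simp add: M_def)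
  have ev: "\<forall>\<^sub>F k in sequentially. proximity_fun (\<lambda>z. deriv h z / h z) (X k) \<le> 1 / \<alpha> * ln (2 + M * T0 k)"
  proof (rule eventually_mono[OF eventually_conj[OF eventually_conj[OF C eventually_radii]
        eventually_conj[OF T0_ge[of 1] T0_ge[of "- circle_mean (\<lambda>z. ln (norm (h z))) r0"]]]], elim conjE)
    fix k
    assume elim: "\<forall>R. near k R \<longrightarrow> T h R \<le> C * T0 k"
      "\<forall>r. near k r \<longrightarrow> (\<exists>R R'. R \<in> \<Gamma> \<and> R' \<in> \<Gamma> \<and>
       r + X k powr \<beta> / 8 \<le> R \<and> R \<le> r + X k powr \<beta> / 4 \<and>
       r + 3 * X k powr \<beta> / 8 \<le> R' \<and> R' \<le> r + X k powr \<beta> / 2)"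
      "1 \<le> T0 k" "- circle_mean (\<lambda>z. ln (norm (h z))) r0 \<le> T0 k"
    obtain R R' where R: "R \<in> \<Gamma>" "R' \<in> \<Gamma>" "X k + X k powr \<beta> / 8 \<le> R" "R \<le> X k + X k powr \<beta> / 4"
       "X k + 3 * X k powr \<beta> / 8 \<le> R'" "R' \<le> X k + X k powr \<beta> / 2"
      using elim(2) near_X[of k] by blast
    have x1: "1 \<le> X k" using good_X[of k] r0 by (simp add: good_def)
    then have xb: "0 < X k powr \<beta>" by simp
    have "near k R" "near k R'" unfolding near_def using R xb by auto
    then have TT: "T h R \<le> C * T0 k" "T h R' \<le> C * T0 k" using elim(1) by auto
    have CT: "C * T0 k \<le> \<bar>C\<bar> * T0 k" using elim(3) by (intro mult_right_mono) auto
    have b: "2 * T h R - circle_mean (\<lambda>z. ln (norm (h z))) r0 \<le> K * T0 k" "2 * T h R' - circle_mean (\<lambda>z. ln (norm (h z))) r0 \<le> K * T0 k"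
      using TT CT elim(4) unfolding K_def by (simp_all add: algebra_simps)
    have KT: "0 < K * T0 k" using K elim(3) by simp
    note ct = circle_terms[OF h KT X_\<Gamma> _ _ R(1,2,3,4,5,6) b, simplified]
    have p1: "X k powr (-\<beta>) \<le> 1" "X k powr (- \<beta> / 2) \<le> 1"
      using x1 \<beta> powr_mono[of "-\<beta>" 0 "X k"] powr_mono[of "-\<beta>/2" 0 "X k"] by auto
    have e1: "abs_log_mean h R / (R - X k) \<le> 8 * (K * T0 k)"
      using ct(1) xb mult_left_mono[OF p1(1), of "8 * (K * T0 k)"] KT by simp
    have e2: "order_sum h R * X k powr (-\<alpha>) \<le> 16 * (K * T0 k)"
      using ct(2) xb mult_left_mono[OF p1(2), of "16 * (K * T0 k)"] KT by simp
    have "order_sum h R * (2 * (X k powr (-\<alpha>) / co)) = 2 / co * (order_sum h R * X k powr (-\<alpha>))" by simp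
    also have "\<dots> \<le> 2 / co * (16 * (K * T0 k))" using e2 co by (intro mult_left_mono) auto
    finally have e3: "order_sum h R * (2 * (X k powr (-\<alpha>) / co)) \<le> 32 * K / co * T0 k" by simp
    have "X k < R" using R xb by linarith
    then have "proximity_fun (\<lambda>z. deriv h z / h z) (X k)
      \<le> 1 / \<alpha> * ln (2 + 2 * (abs_log_mean h R / (R - X k)) + order_sum h R * (2 * (X k powr (-\<alpha>) / co)))"
      unfolding co_def by (intro log_deriv_lemma h good_X \<Gamma>_good R(1) \<alpha>)
    also have "\<dots> \<le> 1 / \<alpha> * ln (2 + M * T0 k)"
    proof (intro mult_left_mono)
      have "0 \<le> abs_log_mean h R / (R - X k)" using abs_log_mean_nonneg[OF h \<Gamma>_good[OF R(1)]] \<open>X k < R\<close> by simp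
      moreover have "0 \<le> order_sum h R * (2 * (X k powr (-\<alpha>) / co))" using order_sum_nonneg[of h R] co by simp
      moreover have "2 + 2 * (abs_log_mean h R / (R - X k)) + order_sum h R * (2 * (X k powr (-\<alpha>) / co)) \<le> 2 + M * T0 k"
        using e1 e3 by (simp add: M_def algebra_simps)
      ultimately show "ln (2 + 2 * (abs_log_mean h R / (R - X k)) + order_sum h R * (2 * (X k powr (-\<alpha>) / co))) \<le> ln (2 + M * T0 k)"
        by (subst ln_le_cancel_iff) auto
    qed (use \<alpha> in auto)
    finally show "proximity_fun (\<lambda>z. deriv h z / h z) (X k) \<le> 1 / \<alpha> * ln (2 + M * T0 k)" .
  qed
  have "negl (\<lambda>k. 1 / \<alpha> * ln (2 + M * T0 k))" using \<alpha> by (intro negl_cmult negl_ln M) auto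
  then show ?thesis using ev by (rule negl_mono_eventually)
qed

lemma zorder_f_nonneg: "0 \<le> zorder f a"
  using f_entire by (intro zorder_ge_0 frequently_nonzero f_unit) (simp add: analytic_on_open holomorphic_on_subset analytic_on_subset[of f UNIV])

lemma T_f: "T f r = proximity_fun f r"
proof -
  have "max 0 (- zorder f a) = 0" for a using zorder_f_nonneg[of a] by simp
  then show ?thesis by (simp add: T_def counting_def)
qed

text \<open>Here the bound is linear in \<open>T0\<close>, so the decay of the powers of
  \<open>X k\<close> is essential. All near radii are covered because the growth of the shifted
  function must be controlled on them too.\<close>

theorem shift_quotient_negl:
  assumes \<epsilon>: "0 < \<epsilon>"
  shows "\<forall>\<^sub>F k in sequentially. \<forall>r. near k r \<longrightarrow>
    circle_mean (\<lambda>z. \<bar>ln (norm (f (z + c))) - ln (norm (f z))\<bar>) r \<le> \<epsilon> * T0 k"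
proof -
  define co where "co = cos (\<alpha> * pi / 2)"
  have co: "0 < co" unfolding co_def by (rule cos_mult_half_pi_pos[OF \<alpha>])
  \<comment> \<open>The factor 5 in \<open>40 = 8 * 5\<close> and \<open>80 = 16 * 5\<close> is
    \<open>2 * 2 + 1\<close>: doubling bounds the characteristic by \<open>2 * T0\<close>,
    \<open>circle_terms\<close> asks for twice that, and the base circle adds one.\<close>
  have e1: "\<forall>\<^sub>F k in sequentially. (8 * norm c * 40) * X k powr (-\<beta>) \<le> \<epsilon> / 2"
    using \<epsilon> \<beta> by (intro X_powr_small) auto
  have e2: "\<forall>\<^sub>F k in sequentially. (4 * (norm c powr \<alpha> / \<alpha>) / co * 80) * X k powr (-(\<beta>/2)) \<le> \<epsilon> / 2"
    using \<epsilon> \<beta> by (intro X_powr_small) auto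
  \<comment> \<open>This makes \<open>2 * norm c \<le> X k powr \<beta> / 8\<close>, hence
    \<open>r + 2 * norm c \<le> R\<close>.\<close>
  have e3: "\<forall>\<^sub>F k in sequentially. 16 * norm c * X k powr (-\<beta>) \<le> 1"
    using \<beta> by (intro X_powr_small) auto
  show ?thesis
  proof (rule eventually_mono[OF eventually_conj[OF eventually_conj[OF eventually_conj[OF e1 e2] eventually_conj[OF e3 eventually_radii]]
        eventually_conj[OF T0_ge[of 1] T0_ge[of "- circle_mean (\<lambda>z. ln (norm (f z))) r0"]]]], elim conjE)
    fix k
    assume elim: "(8 * norm c * 40) * X k powr (-\<beta>) \<le> \<epsilon> / 2"
      "(4 * (norm c powr \<alpha> / \<alpha>) / co * 80) * X k powr (-(\<beta>/2)) \<le> \<epsilon> / 2"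
      "16 * norm c * X k powr (-\<beta>) \<le> 1"
      "\<forall>r. near k r \<longrightarrow> (\<exists>R R'. R \<in> \<Gamma> \<and> R' \<in> \<Gamma> \<and>
       r + X k powr \<beta> / 8 \<le> R \<and> R \<le> r + X k powr \<beta> / 4 \<and>
       r + 3 * X k powr \<beta> / 8 \<le> R' \<and> R' \<le> r + X k powr \<beta> / 2)"
      "1 \<le> T0 k" "- circle_mean (\<lambda>z. ln (norm (f z))) r0 \<le> T0 k"
    show "\<forall>r. near k r \<longrightarrow>
      circle_mean (\<lambda>z. \<bar>ln (norm (f (z + c))) - ln (norm (f z))\<bar>) r \<le> \<epsilon> * T0 k"
    proof (intro allI impI)
      fix r assume r: "near k r"
      then have r': "r \<in> \<Gamma>" "X k \<le> r" "r \<le> X k + X k powr \<beta> / 2" by (auto simp: near_def)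
      obtain R R' where R: "R \<in> \<Gamma>" "R' \<in> \<Gamma>" "r + X k powr \<beta> / 8 \<le> R" "R \<le> r + X k powr \<beta> / 4"
         "r + 3 * X k powr \<beta> / 8 \<le> R'" "R' \<le> r + X k powr \<beta> / 2"
        using elim(4) r by blast
      have x1: "1 \<le> X k" using good_X[of k] r0 by (simp add: good_def)
      then have xb: "0 < X k powr \<beta>" by simp
      have "T f R \<le> 2 * T0 k" "T f R' \<le> 2 * T0 k"
        unfolding T_f T0_def using R r' xb by (auto intro!: doubling)
      then have b: "2 * T f R - circle_mean (\<lambda>z. ln (norm (f z))) r0 \<le> 5 * T0 k" "2 * T f R' - circle_mean (\<lambda>z. ln (norm (f z))) r0 \<le> 5 * T0 k"
        using elim(6) by auto
      have KT: "0 < 5 * T0 k" using elim(5) by simp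
      note ct = circle_terms[OF f_unit KT r' R(1,2,3,4,5,6) b]
      have rR: "r < R" using R xb by linarith
      have "16 * norm c \<le> X k powr \<beta>" using elim(3) xb by (simp add: powr_minus_divide field_simps)
      then have rcR: "r + 2 * norm c \<le> R" using R by simp
      have "circle_mean (\<lambda>z. \<bar>ln (norm (f (z + c))) - ln (norm (f z))\<bar>) r
        \<le> 8 * norm c * (abs_log_mean f R / (R - r)) + order_sum f R * (4 * (norm c powr \<alpha> / \<alpha>) * (r powr (-\<alpha>) / co))"
        unfolding co_def by (rule shift_quotient_lemma[OF f_unit \<Gamma>_good[OF r'(1)] \<Gamma>_good[OF R(1)] rR rcR \<alpha> \<Gamma>_shift[OF r'(1)]])
      moreover have "8 * norm c * (abs_log_mean f R / (R - r)) \<le> \<epsilon> / 2 * T0 k"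
      proof -
        have "8 * norm c * (abs_log_mean f R / (R - r)) \<le> 8 * norm c * (8 * (5 * T0 k) * X k powr (-\<beta>))"
          using ct(1) by (intro mult_left_mono) auto
        also have "\<dots> = (8 * norm c * 40) * X k powr (-\<beta>) * T0 k" by simp
        also have "\<dots> \<le> \<epsilon> / 2 * T0 k" using elim(1) elim(5) by (intro mult_right_mono) auto
        finally show ?thesis .
      qed
      moreover have "order_sum f R * (4 * (norm c powr \<alpha> / \<alpha>) * (r powr (-\<alpha>) / co)) \<le> \<epsilon> / 2 * T0 k"
      proof -
        have "order_sum f R * (4 * (norm c powr \<alpha> / \<alpha>) * (r powr (-\<alpha>) / co))
          = (4 * (norm c powr \<alpha> / \<alpha>) / co) * (order_sum f R * r powr (-\<alpha>))" by simp
        also have "\<dots> \<le> (4 * (norm c powr \<alpha> / \<alpha>) / co) * (16 * (5 * T0 k) * X k powr (- \<beta> / 2))"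
          using ct(2) co \<alpha> by (intro mult_left_mono) auto
        also have "\<dots> = (4 * (norm c powr \<alpha> / \<alpha>) / co * 80) * X k powr (-(\<beta>/2)) * T0 k" by simp
        also have "\<dots> \<le> \<epsilon> / 2 * T0 k" using elim(2) elim(5) by (intro mult_right_mono) auto
        finally show ?thesis .
      qed
      ultimately show "circle_mean (\<lambda>z. \<bar>ln (norm (f (z + c))) - ln (norm (f z))\<bar>) r \<le> \<epsilon> * T0 k" by linarith
    qed
  qed
qed

end

subsection \<open>Sharing two small functions\<close>

text \<open>Small functions may vanish identically, and then \<open>zorder\<close> is a junk value.\<close>

definition pole_mult :: "(complex \<Rightarrow> complex) \<Rightarrow> complex \<Rightarrow> int" where
  "pole_mult h z = (if is_pole h z then - zorder h z else 0)"

lemma pole_mult_pos: "h meromorphic_on UNIV \<Longrightarrow> is_pole h z \<Longrightarrow> 0 < pole_mult h z"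
  using isolated_pole_imp_neg_zorder[OF isolated_mero] by (simp add: pole_mult_def)

lemma pole_mult_nonneg: "h meromorphic_on UNIV \<Longrightarrow> 0 \<le> pole_mult h z"
  using pole_mult_pos[of h z] by (cases "is_pole h z") (auto simp: pole_mult_def)

lemma pole_mult_ge_neg_zorder:
  assumes "h meromorphic_on UNIV" "frequently (\<lambda>w. h w \<noteq> 0) (at z)"
  shows "- zorder h z \<le> pole_mult h z"
proof (cases "is_pole h z")
  case False
  have m: "h meromorphic_on {z}" using assms(1) by (rule meromorphic_on_subset) simp
  have "zorder h z \<ge> 0"
  proof (cases "isolated_zero h z")
    case True
    then show ?thesis using zorder_isolated_zero_pos'[OF _ isolated_mero[OF assms(1)]] by force
  next
    case f: False
    then show ?thesis using not_pole_not_isolated_zero_imp_zorder_eq_0[OF m False f assms(2)] by simp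
  qed
  then show ?thesis using False by (simp add: pole_mult_def)
qed (simp add: pole_mult_def)

lemma pole_mult_analytic: "h analytic_on {z} \<Longrightarrow> pole_mult h z = 0"
  using analytic_at_imp_isCont[of h z] not_tendsto_and_filterlim_at_infinity[of "at z" h "h z"]
  by (auto simp: pole_mult_def is_pole_def isCont_def)

context divisor begin

section \<open>Orders of differences and of logarithmic derivatives\<close>

lemma zorder_cong_off: "(\<And>z. z \<notin> B \<Longrightarrow> h z = h' z) \<Longrightarrow> zorder h z = zorder h' z"
  by (rule zorder_cong) (use eventually_notin[of z] in \<open>auto elim!: eventually_mono\<close>)

text \<open>Where \<open>u\<close> or \<open>v\<close> vanishes near \<open>z\<close> its order is
  meaningless, but then \<open>h\<close> is, up to sign, the other function; hence the case
  distinction.\<close>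

lemma neg_zorder_le_pole_mult:
  assumes h: "unit_off B h" and u: "regular_off B u" and v: "regular_off B v"
    and eq: "\<And>z. z \<notin> B \<Longrightarrow> h z = u z - v z"
  shows "- zorder h z \<le> max (pole_mult u z) (pole_mult v z)"
proof -
  have um: "u meromorphic_on UNIV" and vm: "v meromorphic_on UNIV" using u v by (auto simp: regular_off_def)
  then have um': "u meromorphic_on {z}" and vm': "v meromorphic_on {z}" by (auto intro: meromorphic_on_subset)
  have ev: "\<forall>\<^sub>F w in at z. h w = u w - v w" using eventually_notin[of z] by eventually_elim (rule eq)
  have zd: "zorder h z = zorder (\<lambda>w. u w - v w) z" using ev by (intro zorder_cong) auto
  show ?thesis
  proof (cases "frequently (\<lambda>w. u w \<noteq> 0) (at z)")
    case False
    then have "\<forall>\<^sub>F w in at z. u w = 0" by (simp add: frequently_def)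
    with ev have e: "\<forall>\<^sub>F w in at z. h w = - v w" by eventually_elim simp
    then have z: "zorder h z = zorder v z" using zorder_cong[OF e refl] by simp
    have "\<forall>\<^sub>F w in at z. v w \<noteq> 0" using e eventually_nonzero[OF h, of z] by eventually_elim auto
    then have "frequently (\<lambda>w. v w \<noteq> 0) (at z)" by (intro eventually_frequently) auto
    then show ?thesis using pole_mult_ge_neg_zorder[OF vm] z by fastforce
  next
    case fu: True
    show ?thesis
    proof (cases "frequently (\<lambda>w. v w \<noteq> 0) (at z)")
      case False
      then have "\<forall>\<^sub>F w in at z. v w = 0" by (simp add: frequently_def)
      with ev have e: "\<forall>\<^sub>F w in at z. h w = u w" by eventually_elim simp
      then have z: "zorder h z = zorder u z" using zorder_cong[OF e refl] by simp
      then show ?thesis using pole_mult_ge_neg_zorder[OF um fu] by simp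
    next
      case fv: True
      have fd: "frequently (\<lambda>w. u w \<noteq> v w) (at z)"
      proof (intro eventually_frequently)
        show "\<forall>\<^sub>F w in at z. u w \<noteq> v w" using ev eventually_nonzero[OF h, of z] by eventually_elim auto
      qed auto
      have "zorder (\<lambda>w. u w - v w) z \<ge> - max (pole_mult u z) (pole_mult v z)"
        using pole_mult_ge_neg_zorder[OF um fu] pole_mult_ge_neg_zorder[OF vm fv]
        by (intro zorder_diff_ge um' vm' fu fv fd) auto
      then show ?thesis using zd by simp
    qed
  qed
qed

lemma zorder_mult_unit: "unit_off B g \<Longrightarrow> unit_off B h \<Longrightarrow> zorder (\<lambda>z. g z * h z) a = zorder g a + zorder h a"
  by (intro zorder_mult frequently_nonzero regular_off_mero unit_off_imp_regular)

lemma zorder_divide_unit: "unit_off B g \<Longrightarrow> unit_off B h \<Longrightarrow> zorder (\<lambda>z. g z / h z) a = zorder g a - zorder h a"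
  by (intro zorder_divide frequently_nonzero regular_off_mero unit_off_imp_regular)

lemma zorder_power_unit: "unit_off B g \<Longrightarrow> zorder (\<lambda>z. g z ^ n) a = int n * zorder g a"
  by (intro zorder_power frequently_nonzero regular_off_mero unit_off_imp_regular)

lemma unit_pole_mult: "unit_off B h \<Longrightarrow> pole_mult h a \<le> max 0 (- zorder h a)"
  by (auto simp: pole_mult_def)

lemma open_off: "open (- B)"
  using sparse_in_UNIV_imp_closed[OF sparse] by (simp add: open_Compl)

lemma eventually_nhds_off: "z \<notin> B \<Longrightarrow> \<forall>\<^sub>F w in nhds z. w \<notin> B"
  using eventually_nhds_in_open[OF open_off, of z] by simp

lemma regular_has_deriv: "regular_off B h \<Longrightarrow> z \<notin> B \<Longrightarrow> (h has_field_derivative deriv h z) (at z)"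
  by (rule analytic_derivI) (simp add: regular_off_analytic)

lemma deriv_cong_off:
  assumes "\<And>z. z \<notin> B \<Longrightarrow> h z = h' z" "z \<notin> B"
  shows "deriv h z = deriv h' z"
  by (rule deriv_cong_ev[OF _ refl]) (use eventually_nhds_off[OF assms(2)] assms(1) in \<open>auto elim!: eventually_mono\<close>)

text \<open>A logarithmic derivative has at most simple poles, and only at zeros and poles of
  \<open>h\<close>. That \<open>q\<close> is a unit excludes an identically vanishing derivative,
  for which orders mean nothing.\<close>

lemma zorder_log_deriv:
  assumes h: "unit_off B h" and q: "unit_off B q" and eq: "\<And>z. z \<notin> B \<Longrightarrow> q z = deriv h z / h z"
  shows "- 1 \<le> zorder q a" and "zorder h a = 0 \<Longrightarrow> 0 \<le> zorder q a"
proof -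
  have hm: "h meromorphic_on UNIV" using h by (simp add: unit_off_def regular_off_def)
  have zq: "zorder q a = zorder (\<lambda>z. deriv h z / h z) a" by (rule zorder_cong_off) (rule eq)
  have 0: "0 \<le> zorder q a" if zh: "zorder h a = 0"
  proof -
    \<comment> \<open>\<open>h\<close> may have a wrong value at \<open>a\<close>; filling in the
      singularity gives a function that is analytic and nonzero there.\<close>
    define H where "H = remove_sings h"
    have iso: "isolated_singularity_at h a" using isolated_mero[OF hm] .
    have Hn: "H nicely_meromorphic_on UNIV" unfolding H_def using hm by (rule remove_sings_nicely_meromorphic)
    have zH: "zorder H a = 0" unfolding H_def using zh iso by simp
    have "\<not> is_pole H a"
    proof
      assume "is_pole H a"
      then have "zorder H a < 0" unfolding H_def using iso by (intro isolated_pole_imp_neg_zorder) auto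
      then show False using zH by simp
    qed
    then have Ha: "H analytic_on {a}" using nicely_meromorphic_on_imp_analytic_at[OF Hn] by auto
    have Heq: "H z = h z" if "z \<notin> B" for z
      unfolding H_def using regular_off_analytic[OF unit_off_imp_regular[OF h] that] by simp
    have "\<exists>\<^sub>F w in at a. H w \<noteq> 0"
      by (rule eventually_frequently, simp)
         (use eventually_notin[of a] in eventually_elim, use Heq h in \<open>auto simp: unit_off_def\<close>)
    then have H0: "H a \<noteq> 0" using zorder_eq_0_iff[OF Ha] zH by simp
    have "zorder q a = zorder (\<lambda>z. deriv H z / H z) a"
    proof (rule zorder_cong_off)
      fix z assume z: "z \<notin> B"
      have "deriv H z = deriv h z" by (rule deriv_cong_off[OF Heq z])
      then show "q z = deriv H z / H z" using eq[OF z] Heq[OF z] by simp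
    qed
    moreover have "(\<lambda>z. deriv H z / H z) analytic_on {a}"
      using Ha H0 by (intro analytic_intros analytic_deriv) auto
    moreover have "\<exists>\<^sub>F w in at a. deriv H w / H w \<noteq> 0"
    proof (rule eventually_frequently)
      show "\<forall>\<^sub>F w in at a. deriv H w / H w \<noteq> 0"
        using eventually_notin[of a]
      proof eventually_elim
        case (elim w)
        have "deriv H w = deriv h w" by (rule deriv_cong_off[OF Heq elim])
        then show ?case using unit_off_nonzero[OF q elim] eq[OF elim] Heq[OF elim] by simp
      qed
    qed simp
    ultimately show ?thesis using zorder_ge_0 by metis
  qed
  then show "zorder h a = 0 \<Longrightarrow> 0 \<le> zorder q a" .
  show "- 1 \<le> zorder q a"
  proof (cases "zorder h a = 0")
    case False
    have "zorder (deriv h) a = zorder h a - 1"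
      by (rule zorder_deriv_minus_1[OF isolated_mero[OF hm] not_essential_mero[OF hm] frequently_nonzero[OF h] False])
    moreover have "zorder (\<lambda>z. deriv h z / h z) a = zorder (deriv h) a - zorder h a"
    proof (rule zorder_divide)
      show "\<exists>\<^sub>F w in at a. deriv h w \<noteq> 0"
      proof (rule eventually_frequently)
        show "\<forall>\<^sub>F w in at a. deriv h w \<noteq> 0"
          using eventually_notin[of a]
          by eventually_elim (use unit_off_nonzero[OF q] eq in force)
      qed simp
    qed (auto intro: frequently_nonzero[OF h] regular_off_mero unit_off_imp_regular h regular_off_deriv)
    ultimately show ?thesis using zq by simp
  qed (use 0 in simp)
qed

text \<open>The combination is itself a logarithmic derivative. Its poles are therefore governed by
  the orders of \<open>U ^ n / V ^ m\<close>, and its vanishing means that this quotient is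
  constant.\<close>

lemma log_deriv_quotient_powers:
  assumes U: "unit_off B U" and V: "unit_off B V" and z: "z \<notin> B"
  shows "deriv (\<lambda>z. U z ^ n / V z ^ m) z / (U z ^ n / V z ^ m)
     = of_nat n * (deriv U z / U z) - of_nat m * (deriv V z / V z)"
proof -
  have dU: "(U has_field_derivative deriv U z) (at z)" and dV: "(V has_field_derivative deriv V z) (at z)"
    using regular_has_deriv[OF unit_off_imp_regular] U V z by auto
  have nz: "U z \<noteq> 0" "V z \<noteq> 0" using U V z by (auto simp: unit_off_def)
  have "((\<lambda>z. U z ^ n / V z ^ m) has_field_derivative
      ((of_nat n * U z ^ (n - 1) * deriv U z) * V z ^ m - U z ^ n * (of_nat m * V z ^ (m - 1) * deriv V z)) / (V z ^ m * V z ^ m)) (at z)"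
    using nz by (auto intro!: derivative_eq_intros dU dV simp: mult_ac)
  then have d: "deriv (\<lambda>z. U z ^ n / V z ^ m) z = ((of_nat n * U z ^ (n - 1) * deriv U z) * V z ^ m - U z ^ n * (of_nat m * V z ^ (m - 1) * deriv V z)) / (V z ^ m * V z ^ m)"
    by (rule DERIV_imp_deriv)
  have 1: "of_nat n * U z ^ (n - 1) = of_nat n * U z ^ n / U z" using nz by (cases n) auto
  have 2: "of_nat m * V z ^ (m - 1) = of_nat m * V z ^ m / V z" using nz by (cases m) auto
  define P Q where "P = U z ^ n" and "Q = V z ^ m"
  have "P \<noteq> 0" "Q \<noteq> 0" using nz by (auto simp: P_def Q_def)
  then show ?thesis unfolding d 1 2 P_def[symmetric] Q_def[symmetric] using nz by (simp add: field_simps)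
qed

text \<open>The complement of a sparse set is open and connected, so a vanishing derivative forces a
  constant; the base circle supplies a point where \<open>W\<close> is nonzero.\<close>

lemma constant_off_if_log_deriv_zero:
  assumes W: "unit_off B W" and 0: "\<And>z. z \<notin> B \<Longrightarrow> deriv W z = 0"
  obtains k where "k \<noteq> 0" "\<And>z. z \<notin> B \<Longrightarrow> W z = k"
proof -
  have "connected (- B)"
    using sparse_imp_connected[of UNIV B] sparse convex_connected[OF convex_UNIV] by (simp add: Compl_eq_Diff_UNIV)
  moreover have "(W has_field_derivative 0) (at z)" if "z \<in> - B" for z
    using regular_has_deriv[OF unit_off_imp_regular[OF W], of z] 0[of z] that by simp
  ultimately have "W constant_on (- B)"
    by (intro has_field_derivative_0_imp_constant_on open_off)
  then obtain k where k: "\<And>z. z \<notin> B \<Longrightarrow> W z = k" by (auto simp: constant_on_def)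
  obtain z where "z \<notin> B" using good_notin[OF good_r0, of "of_real r0"] r0 by auto
  then have "k \<noteq> 0" using k W by (auto simp: unit_off_def)
  then show ?thesis using k that by blast
qed

lemma proximity_cong_off:
  "good r \<Longrightarrow> (\<And>z. z \<notin> B \<Longrightarrow> h z = h' z) \<Longrightarrow> proximity_fun h r = proximity_fun h' r"
  unfolding proximity_eq_circle_mean using good_pos[of r] good_notin[of r] by (intro circle_mean_cong) auto

lemma T_cong_off:
  assumes "good r" "\<And>z. z \<notin> B \<Longrightarrow> h z = h' z"
  shows "T h r = T h' r"
  using proximity_cong_off[OF assms] zorder_cong_off[of h h', OF assms(2)] by (simp add: T_def)

lemma T_power:
  assumes "unit_off B h" "good r"
  shows "T (\<lambda>z. h z ^ n) r = n * T h r"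
proof -
  have "proximity_fun (\<lambda>z. h z ^ n) r = n * proximity_fun h r"
    by (simp add: proximity_eq_circle_mean log_plus_power circle_mean_cmult)
  moreover have "max 0 (- (int n * zorder h a)) = int n * max 0 (- zorder h a)" for a
    by (auto simp: max_def mult_le_0_iff)
  ultimately show ?thesis
    by (simp add: T_def zorder_power_unit[OF assms(1)] counting_cmult algebra_simps)
qed

lemma T_cmult:
  assumes h: "unit_off B h" and r: "good r" and k: "k \<noteq> 0"
  shows "T (\<lambda>z. k * h z) r \<le> T h r + log_plus k"
proof -
  have "proximity_fun (\<lambda>z. k * h z) r \<le> proximity_fun (\<lambda>_. k) r + proximity_fun h r"
    by (intro prox_mult regular_off_const regular_off_mult unit_off_imp_regular h r) auto
  also have "proximity_fun (\<lambda>_. k) r = log_plus k" by (simp add: proximity_eq_circle_mean)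
  finally show ?thesis
    using k by (simp add: T_def zorder_cmult)
qed

text \<open>The analogue of \<open>T\<close> for functions that may vanish identically, where
  \<open>pole_mult\<close> is 0 but \<open>zorder\<close> is unreliable.\<close>

definition Tm :: "(complex \<Rightarrow> complex) \<Rightarrow> real \<Rightarrow> real" where
  "Tm h r = proximity_fun h r + counting (pole_mult h) r"

lemma prox_one: "proximity_fun (\<lambda>_. k) r = log_plus k"
  by (simp add: proximity_eq_circle_mean)

lemma counting_pole_mult_nonneg: "regular_off B h \<Longrightarrow> good r \<Longrightarrow> 0 \<le> counting (pole_mult h) r"
  by (intro counting_nonneg pole_mult_nonneg) (auto simp: good_def regular_off_def)

end

text \<open>The unit assumptions say that none of the listed functions vanishes identically.
  \<open>a1\<close> and \<open>a2\<close> are only regular, since a small function may be 0.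
  Logarithmic derivatives are left open; their vanishing is the alternative treated in
  \<open>contradiction\<close>.\<close>

locale shared = growth +
  fixes a1 a2 :: "complex \<Rightarrow> complex"
  assumes a1_nice: "a1 nicely_meromorphic_on UNIV" and a2_nice: "a2 nicely_meromorphic_on UNIV"
    and a1_reg: "regular_off B a1" and a2_reg: "regular_off B a2"
    and g_unit: "unit_off B (\<lambda>z. f (z + c))"
    and diff_unit: "unit_off B (\<lambda>z. f z - f (z + c))"
    and d_unit: "unit_off B (\<lambda>z. a2 z - a1 z)"
    and fa1: "unit_off B (\<lambda>z. f z - a1 z)" and fa2: "unit_off B (\<lambda>z. f z - a2 z)"
    and ga1: "unit_off B (\<lambda>z. f (z + c) - a1 z)" and ga2: "unit_off B (\<lambda>z. f (z + c) - a2 z)"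
    and share1: "share_IM f (\<lambda>z. f (z + c)) a1" and share2: "share_IM f (\<lambda>z. f (z + c)) a2"
    and small1: "negl (\<lambda>k. Tm a1 (X k))" and small2: "negl (\<lambda>k. Tm a2 (X k))"
    and tame_a: "\<exists>C. \<forall>\<^sub>F k in sequentially. \<forall>R. near k R \<longrightarrow> Tm a1 R + Tm a2 R \<le> C * T0 k"
begin

abbreviation g :: "complex \<Rightarrow> complex" where
  "g \<equiv> \<lambda>z. f (z + c)"

definition d :: "complex \<Rightarrow> complex" where
  "d z = a2 z - a1 z"

definition cross :: "(complex \<Rightarrow> complex) \<Rightarrow> complex \<Rightarrow> complex" where
  "cross \<phi> z = (\<phi> z - a2 z) / (\<phi> z - a1 z)"

text \<open>\<open>aff \<phi> a1\<close> is the affine coordinate in which \<open>a1\<close> becomes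
  0 and \<open>a2\<close> becomes 1, and \<open>aff \<phi> a2\<close> is that coordinate minus 1. In
  it \<open>cross \<phi>\<close> is a fixed Moebius transformation.\<close>

definition aff :: "(complex \<Rightarrow> complex) \<Rightarrow> (complex \<Rightarrow> complex) \<Rightarrow> complex \<Rightarrow> complex" where
  "aff \<phi> a z = (\<phi> z - a z) / d z"

text \<open>The properties common to \<open>f\<close> and its shift on which the estimates rest, so
  that both are treated at once. The last two conjuncts say that the proximity function agrees with
  \<open>T0\<close> up to negligible terms.\<close>

definition admissible :: "(complex \<Rightarrow> complex) \<Rightarrow> bool" where
  "admissible \<phi> \<longleftrightarrow> \<phi> holomorphic_on UNIV \<and> unit_off B \<phi> \<and>
     unit_off B (\<lambda>z. \<phi> z - a1 z) \<and> unit_off B (\<lambda>z. \<phi> z - a2 z) \<and>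
     (\<exists>C. \<forall>\<^sub>F k in sequentially. \<forall>R. near k R \<longrightarrow> proximity_fun \<phi> R \<le> C * T0 k) \<and>
     negl (\<lambda>k. proximity_fun \<phi> (X k) - T0 k) \<and> negl (\<lambda>k. T0 k - proximity_fun \<phi> (X k))"

lemma du: "unit_off B d"
  using d_unit by (simp add: d_def [abs_def])

lemma g_entire: "g holomorphic_on UNIV"
proof -
  have "(f \<circ> (\<lambda>z. z + c)) holomorphic_on UNIV"
    by (rule holomorphic_on_compose[OF _ holomorphic_on_subset[OF f_entire]]) (auto intro!: holomorphic_intros)
  then show ?thesis by (simp add: o_def)
qed

lemma shift_quotient_prox:
  assumes r: "r \<in> \<Gamma>"
  shows "proximity_fun (\<lambda>z. g z / f z) r \<le> circle_mean (\<lambda>z. \<bar>ln (norm (g z)) - ln (norm (f z))\<bar>) r"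
    and "proximity_fun (\<lambda>z. f z / g z) r \<le> circle_mean (\<lambda>z. \<bar>ln (norm (g z)) - ln (norm (f z))\<bar>) r"
proof -
  have gr: "good r" using \<Gamma>_good[OF r] .
  have le: "log_plus (x / y) \<le> \<bar>ln (norm x) - ln (norm y)\<bar>" if "x \<noteq> 0" "y \<noteq> 0" for x y
    using that by (simp add: log_plus_def norm_divide max_def ln_div)
  have c: "continuous_on (sphere 0 r) (\<lambda>z. \<bar>ln (norm (g z)) - ln (norm (f z))\<bar>)"
    using gr by (intro continuous_on_rabs continuous_on_diff continuous_on_ln_norm_unit[OF g_unit]
        continuous_on_ln_norm_unit[OF f_unit]) (auto simp: good_def)
  show "proximity_fun (\<lambda>z. g z / f z) r \<le> circle_mean (\<lambda>z. \<bar>ln (norm (g z)) - ln (norm (f z))\<bar>) r"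
    unfolding proximity_eq_circle_mean using good_pos[OF gr] good_notin[OF gr]
    by (intro circle_mean_mono c regular_cont_log_plus[OF unit_off_imp_regular[OF unit_off_divide[OF g_unit f_unit]] gr] le)
       (auto dest: unit_off_nonzero[OF f_unit] unit_off_nonzero[OF g_unit])
  have le': "log_plus (x / y) \<le> \<bar>ln (norm y) - ln (norm x)\<bar>" if "x \<noteq> 0" "y \<noteq> 0" for x y
    using le[OF that] by (simp add: abs_minus_commute)
  show "proximity_fun (\<lambda>z. f z / g z) r \<le> circle_mean (\<lambda>z. \<bar>ln (norm (g z)) - ln (norm (f z))\<bar>) r"
    unfolding proximity_eq_circle_mean using good_pos[OF gr] good_notin[OF gr]
    by (intro circle_mean_mono c regular_cont_log_plus[OF unit_off_imp_regular[OF unit_off_divide[OF f_unit g_unit]] gr] le')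
       (auto dest: unit_off_nonzero[OF f_unit] unit_off_nonzero[OF g_unit])
qed

text \<open>Poles are deliberately ignored here: this notion is closed under ring operations, and
  poles are later bounded through orders at the exceptional places.\<close>

definition small_prox :: "(complex \<Rightarrow> complex) \<Rightarrow> bool" where
  "small_prox h \<longleftrightarrow> regular_off B h \<and> negl (\<lambda>k. proximity_fun h (X k))"

lemma small_prox_negl: "small_prox h \<Longrightarrow> negl (\<lambda>k. proximity_fun h (X k))"
  by (simp add: small_prox_def)

lemma small_prox_const: "small_prox (\<lambda>_. k)"
  by (simp add: small_prox_def regular_off_const prox_one negl_const)

lemma small_prox_mult:
  assumes "small_prox h1" "small_prox h2"
  shows "small_prox (\<lambda>z. h1 z * h2 z)"
proof -
  have r: "regular_off B h1" "regular_off B h2" using assms by (auto simp: small_prox_def)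
  note m = regular_off_mult[OF r]
  have "negl (\<lambda>k. proximity_fun (\<lambda>z. h1 z * h2 z) (X k))"
    by (rule negl_mono[OF negl_add[OF small_prox_negl[OF assms(1)] small_prox_negl[OF assms(2)]]], rule prox_mult[OF r good_X refl m])
  then show ?thesis using m by (simp add: small_prox_def)
qed

lemma small_prox_add:
  assumes "small_prox h1" "small_prox h2"
  shows "small_prox (\<lambda>z. h1 z + h2 z)"
proof -
  have r: "regular_off B h1" "regular_off B h2" using assms by (auto simp: small_prox_def)
  note m = regular_off_add[OF r]
  have "negl (\<lambda>k. proximity_fun (\<lambda>z. h1 z + h2 z) (X k))"
    by (rule negl_mono[OF negl_add[OF negl_add[OF small_prox_negl[OF assms(1)] small_prox_negl[OF assms(2)]] negl_const[of "ln 2"]]],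
        rule prox_add[OF r good_X refl m])
  then show ?thesis using m by (simp add: small_prox_def)
qed

lemma small_prox_diff:
  assumes "small_prox h1" "small_prox h2"
  shows "small_prox (\<lambda>z. h1 z - h2 z)"
proof -
  have r: "regular_off B h1" "regular_off B h2" using assms by (auto simp: small_prox_def)
  note m = regular_off_diff[OF r]
  have "negl (\<lambda>k. proximity_fun (\<lambda>z. h1 z - h2 z) (X k))"
    by (rule negl_mono[OF negl_add[OF negl_add[OF small_prox_negl[OF assms(1)] small_prox_negl[OF assms(2)]] negl_const[of "ln 2"]]],
        rule prox_diff[OF r good_X refl m])
  then show ?thesis using m by (simp add: small_prox_def)
qed

lemma small_prox_cong: "regular_off B h \<Longrightarrow> small_prox h' \<Longrightarrow> (\<And>z. z \<notin> B \<Longrightarrow> h z = h' z) \<Longrightarrow> small_prox h"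
  unfolding small_prox_def using proximity_cong_off[OF good_X, of h h'] by simp

lemma small_prox_a1: "small_prox a1"
  unfolding small_prox_def
proof
  show "negl (\<lambda>k. proximity_fun a1 (X k))"
    by (rule negl_mono[OF small1]) (use counting_pole_mult_nonneg[OF a1_reg good_X] in \<open>simp add: Tm_def\<close>)
qed (rule a1_reg)

lemma small_prox_a2: "small_prox a2"
  unfolding small_prox_def
proof
  show "negl (\<lambda>k. proximity_fun a2 (X k))"
    by (rule negl_mono[OF small2]) (use counting_pole_mult_nonneg[OF a2_reg good_X] in \<open>simp add: Tm_def\<close>)
qed (rule a2_reg)

lemma small_prox_d: "small_prox d"
  using small_prox_diff[OF small_prox_a2 small_prox_a1] by (simp add: d_def [abs_def])

lemma small_prox_shift: "small_prox (\<lambda>z. g z / f z)" "small_prox (\<lambda>z. f z / g z)"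
proof -
  have n: "negl (\<lambda>k. circle_mean (\<lambda>z. \<bar>ln (norm (g z)) - ln (norm (f z))\<bar>) (X k))"
    unfolding negl_def
  proof (intro allI impI)
    fix \<epsilon> :: real assume "0 < \<epsilon>"
    from shift_quotient_negl[OF this]
    show "\<forall>\<^sub>F k in sequentially. circle_mean (\<lambda>z. \<bar>ln (norm (g z)) - ln (norm (f z))\<bar>) (X k) \<le> \<epsilon> * T0 k"
      by (rule eventually_mono) (use near_X in blast)
  qed
  show "small_prox (\<lambda>z. g z / f z)" "small_prox (\<lambda>z. f z / g z)"
    unfolding small_prox_def
    by (intro conjI unit_off_imp_regular unit_off_divide f_unit g_unit; rule negl_mono[OF n], rule shift_quotient_prox[OF X_\<Gamma>])+
qed

lemma not_negl_T0: "\<not> negl T0"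
proof
  assume "negl T0"
  then have "\<forall>\<^sub>F k in sequentially. T0 k \<le> 1 / 2 * T0 k" unfolding negl_def by (elim allE[of _ "1/2"]) auto
  then have "\<forall>\<^sub>F k in sequentially. False" using T0_ge[of 1] by eventually_elim simp
  then show False by simp
qed

lemma admissible_f: "admissible f"
proof -
  have "\<forall>\<^sub>F k in sequentially. \<forall>R. near k R \<longrightarrow> proximity_fun f R \<le> 2 * T0 k"
  proof (rule always_eventually, intro allI impI)
    fix k R assume "near k R"
    then have R: "R \<in> \<Gamma>" "X k \<le> R" "R \<le> X k + X k powr \<beta> / 2" by (auto simp: near_def)
    have "X k + X k powr \<beta> / 2 \<le> X k + X k powr \<beta>" by simp
    then show "proximity_fun f R \<le> 2 * T0 k" unfolding T0_def using R by (intro doubling) auto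
  qed
  then show ?thesis
    unfolding admissible_def using f_entire f_unit fa1 fa2 negl_const[of 0] by (auto simp: T0_def)
qed

text \<open>Writing \<open>g = f * (g / f)\<close> and \<open>f = g * (f / g)\<close> transfers
  growth in both directions, up to the proximity of the shift quotients.\<close>

lemma admissible_g: "admissible g"
proof -
  have reg: "regular_off B g" "regular_off B f" "regular_off B (\<lambda>z. g z / f z)" "regular_off B (\<lambda>z. f z / g z)"
    by (rule unit_off_imp_regular, (rule f_unit g_unit unit_off_divide[OF f_unit g_unit] unit_off_divide[OF g_unit f_unit]))+
  have gf: "proximity_fun g r \<le> proximity_fun f r + proximity_fun (\<lambda>z. g z / f z) r" if "good r" for r
    using good_notin[OF that] unit_off_nonzero[OF f_unit] by (intro prox_mult reg that) auto
  have fg: "proximity_fun f r \<le> proximity_fun g r + proximity_fun (\<lambda>z. f z / g z) r" if "good r" for r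
    using good_notin[OF that] unit_off_nonzero[OF g_unit] by (intro prox_mult reg that) auto
  obtain C where C: "\<forall>\<^sub>F k in sequentially. \<forall>R. near k R \<longrightarrow> proximity_fun f R \<le> C * T0 k"
    using admissible_f by (auto simp: admissible_def)
  have "\<forall>\<^sub>F k in sequentially. \<forall>R. near k R \<longrightarrow> proximity_fun g R \<le> (C + 1) * T0 k"
  proof (rule eventually_mono[OF eventually_conj[OF C shift_quotient_negl[OF zero_less_one]]], intro allI impI)
    fix k R
    assume *: "(\<forall>R. near k R \<longrightarrow> proximity_fun f R \<le> C * T0 k) \<and>
      (\<forall>r. near k r \<longrightarrow> circle_mean (\<lambda>z. \<bar>ln (norm (f (z + c))) - ln (norm (f z))\<bar>) r \<le> 1 * T0 k)" and R: "near k R"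
    then have R\<Gamma>: "R \<in> \<Gamma>" by (simp add: near_def)
    have "proximity_fun f R \<le> C * T0 k" "circle_mean (\<lambda>z. \<bar>ln (norm (f (z + c))) - ln (norm (f z))\<bar>) R \<le> 1 * T0 k"
      using * R by blast+
    then have "proximity_fun g R \<le> C * T0 k + T0 k"
      using gf[OF \<Gamma>_good[OF R\<Gamma>]] shift_quotient_prox(1)[OF R\<Gamma>] by linarith
    then show "proximity_fun g R \<le> (C + 1) * T0 k" by (simp add: distrib_right)
  qed
  moreover have "negl (\<lambda>k. proximity_fun g (X k) - T0 k)"
    by (rule negl_mono[OF small_prox_negl[OF small_prox_shift(1)]]) (use gf[OF good_X] in \<open>simp add: T0_def algebra_simps\<close>)
  moreover have "negl (\<lambda>k. T0 k - proximity_fun g (X k))"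
    by (rule negl_mono[OF small_prox_negl[OF small_prox_shift(2)]]) (use fg[OF good_X] in \<open>simp add: T0_def algebra_simps\<close>)
  ultimately show ?thesis
    unfolding admissible_def using g_entire g_unit ga1 ga2 by blast
qed

lemma admissible_unit: "admissible \<phi> \<Longrightarrow> unit_off B \<phi>"
  and admissible_unit1: "admissible \<phi> \<Longrightarrow> unit_off B (\<lambda>z. \<phi> z - a1 z)"
  and admissible_unit2: "admissible \<phi> \<Longrightarrow> unit_off B (\<lambda>z. \<phi> z - a2 z)"
  by (auto simp: admissible_def)

lemma cross_unit: "admissible \<phi> \<Longrightarrow> unit_off B (cross \<phi>)"
  using unit_off_divide[OF admissible_unit2 admissible_unit1] by (simp add: cross_def [abs_def])

lemma affine_unit: "admissible \<phi> \<Longrightarrow> unit_off B (aff \<phi> a1)" "admissible \<phi> \<Longrightarrow> unit_off B (aff \<phi> a2)"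
  using unit_off_divide[OF admissible_unit1 du] unit_off_divide[OF admissible_unit2 du] by (simp_all add: aff_def [abs_def])

lemma pole_mult_entire: "admissible \<phi> \<Longrightarrow> pole_mult \<phi> z = 0"
proof -
  assume "admissible \<phi>"
  then have "\<phi> holomorphic_on UNIV" unfolding admissible_def by (elim conjE)
  then have "\<phi> analytic_on {z}" using analytic_on_subset[of \<phi> UNIV "{z}"] analytic_on_open[of UNIV \<phi>] by simp
  then show ?thesis by (rule pole_mult_analytic)
qed

section \<open>Characteristics of the normalised functions\<close>

lemma Tm_nonneg: "good r \<Longrightarrow> 0 \<le> Tm a1 r" "good r \<Longrightarrow> 0 \<le> Tm a2 r"
  using prox_nonneg[OF a1_reg] counting_pole_mult_nonneg[OF a1_reg] prox_nonneg[OF a2_reg] counting_pole_mult_nonneg[OF a2_reg]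
  by (auto simp: Tm_def intro: add_nonneg_nonneg)

lemma T_d:
  assumes r: "good r"
  shows "T d r \<le> Tm a1 r + Tm a2 r + ln 2"
proof -
  have "proximity_fun d r \<le> proximity_fun a2 r + proximity_fun a1 r + ln 2"
    by (intro prox_diff a1_reg a2_reg r unit_off_imp_regular du) (simp add: d_def)
  moreover have "counting (\<lambda>a. max 0 (- zorder d a)) r \<le> counting (\<lambda>a. pole_mult a1 a + pole_mult a2 a) r"
  proof (rule counting_mono)
    fix a
    have "- zorder d a \<le> max (pole_mult a2 a) (pole_mult a1 a)"
      by (rule neg_zorder_le_pole_mult[OF du a2_reg a1_reg]) (simp add: d_def)
    moreover have "0 \<le> pole_mult a1 a" "0 \<le> pole_mult a2 a"
      using a1_reg a2_reg by (auto intro!: pole_mult_nonneg simp: regular_off_def)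
    ultimately show "max 0 (- zorder d a) \<le> pole_mult a1 a + pole_mult a2 a" by linarith
  qed (use r in \<open>auto simp: good_def\<close>)
  ultimately show ?thesis by (simp add: T_def Tm_def counting_add)
qed

definition kd :: real where "kd = \<bar>circle_mean (\<lambda>z. ln (norm (d z))) r0\<bar>"

lemma T_inverse_d:
  assumes r: "good r"
  shows "T (\<lambda>z. inverse (d z)) r \<le> Tm a1 r + Tm a2 r + (ln 2 + kd)"
  using first_main[OF du r] T_d[OF r] by (simp add: kd_def)

text \<open>Since \<open>\<phi>\<close> is entire, poles of \<open>aff \<phi> a\<close> can come
  only from poles of \<open>a\<close> and zeros of \<open>d\<close>; the latter are paid for by the
  characteristic of \<open>1 / d\<close>.\<close>

lemma T_affine:
  assumes \<phi>: "admissible \<phi>" and r: "good r" and a: "a = a1 \<or> a = a2"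
  shows "T (aff \<phi> a) r \<le> proximity_fun \<phi> r + 2 * (Tm a1 r + Tm a2 r) + (2 * ln 2 + kd)"
proof -
  have areg: "regular_off B a" using a a1_reg a2_reg by auto
  have u: "unit_off B (\<lambda>z. \<phi> z - a z)" using a admissible_unit1[OF \<phi>] admissible_unit2[OF \<phi>] by auto
  have \<phi>reg: "regular_off B \<phi>" using admissible_unit[OF \<phi>] by (rule unit_off_imp_regular)
  have idu: "unit_off B (\<lambda>z. inverse (d z))" by (rule unit_off_inverse[OF du])
  have au: "unit_off B (aff \<phi> a)" using unit_off_divide[OF u du] by (simp add: aff_def [abs_def])
  have "proximity_fun (aff \<phi> a) r \<le> proximity_fun (\<lambda>z. \<phi> z - a z) r + proximity_fun (\<lambda>z. inverse (d z)) r"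
    by (intro prox_mult unit_off_imp_regular u idu r au) (simp add: aff_def field_simps)
  moreover have "proximity_fun (\<lambda>z. \<phi> z - a z) r \<le> proximity_fun \<phi> r + proximity_fun a r + ln 2"
    by (intro prox_diff \<phi>reg areg r unit_off_imp_regular u) simp
  moreover have "counting (\<lambda>b. max 0 (- zorder (aff \<phi> a) b)) r
      \<le> counting (\<lambda>b. pole_mult a b + max 0 (- zorder (\<lambda>z. inverse (d z)) b)) r"
  proof (rule counting_mono)
    fix b
    have "zorder (aff \<phi> a) b = zorder (\<lambda>z. \<phi> z - a z) b - zorder d b"
      unfolding aff_def [abs_def] by (rule zorder_divide_unit[OF u du])
    moreover have "- zorder (\<lambda>z. \<phi> z - a z) b \<le> max (pole_mult \<phi> b) (pole_mult a b)"
      by (rule neg_zorder_le_pole_mult[OF u \<phi>reg areg]) simp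
    moreover have "0 \<le> pole_mult a b" using areg by (auto intro!: pole_mult_nonneg simp: regular_off_def)
    ultimately show "max 0 (- zorder (aff \<phi> a) b) \<le> pole_mult a b + max 0 (- zorder (\<lambda>z. inverse (d z)) b)"
      unfolding zorder_inverse_unit[OF du] pole_mult_entire[OF \<phi>] by linarith
  qed (use r in \<open>auto simp: good_def\<close>)
  ultimately have tle: "T (aff \<phi> a) r \<le> proximity_fun \<phi> r + Tm a r + T (\<lambda>z. inverse (d z)) r + ln 2"
    by (simp add: T_def Tm_def counting_add)
  have ale: "Tm a r \<le> Tm a1 r + Tm a2 r" using a Tm_nonneg[OF r] by auto
  have "T (aff \<phi> a) r \<le> proximity_fun \<phi> r + (Tm a1 r + Tm a2 r) + (Tm a1 r + Tm a2 r + (ln 2 + kd)) + ln 2"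
    by (rule order_trans[OF tle]) (intro add_mono order_refl ale T_inverse_d[OF r])
  then show ?thesis by (simp only: mult_2 add_ac)
qed

lemma cross_eq:
  assumes "admissible \<phi>" "z \<notin> B"
  shows "cross \<phi> z = 1 - inverse (aff \<phi> a1 z)" "aff \<phi> a2 z = aff \<phi> a1 z - 1"
    "cross \<phi> z = aff \<phi> a2 z / aff \<phi> a1 z"
proof -
  have nz: "\<phi> z - a1 z \<noteq> 0" "d z \<noteq> 0"
    using unit_off_nonzero[OF admissible_unit1[OF assms(1)] assms(2)] unit_off_nonzero[OF du assms(2)] by auto
  have "cross \<phi> z = ((\<phi> z - a1 z) - d z) / (\<phi> z - a1 z)" by (simp add: cross_def d_def)
  also have "\<dots> = 1 - d z / (\<phi> z - a1 z)" using nz by (simp add: diff_divide_distrib)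
  finally show "cross \<phi> z = 1 - inverse (aff \<phi> a1 z)" by (simp add: aff_def)
  have "aff \<phi> a2 z = ((\<phi> z - a1 z) - d z) / d z" by (simp add: aff_def d_def)
  also have "\<dots> = aff \<phi> a1 z - 1" using nz by (simp add: diff_divide_distrib aff_def)
  finally show "aff \<phi> a2 z = aff \<phi> a1 z - 1" .
  show "cross \<phi> z = aff \<phi> a2 z / aff \<phi> a1 z" using nz by (simp add: cross_def aff_def)
qed

definition ka :: "(complex \<Rightarrow> complex) \<Rightarrow> real" where
  "ka \<phi> = \<bar>circle_mean (\<lambda>z. ln (norm (aff \<phi> a1 z))) r0\<bar>"

lemma T_one_minus:
  assumes h: "unit_off B h" "unit_off B h'" and eq: "\<And>z. z \<notin> B \<Longrightarrow> h z = 1 - h' z" and r: "good r"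
  shows "T h r \<le> T h' r + ln 2"
proof -
  have "proximity_fun h r \<le> proximity_fun (\<lambda>_. 1) r + proximity_fun h' r + ln 2"
    using good_notin[OF r] by (intro prox_diff regular_off_const unit_off_imp_regular h r eq) auto
  moreover have "proximity_fun (\<lambda>_. 1) r = 0" by (simp add: prox_one log_plus_def)
  moreover have "counting (\<lambda>a. max 0 (- zorder h a)) r \<le> counting (\<lambda>a. max 0 (- zorder h' a)) r"
  proof (rule counting_mono)
    fix a
    have "- zorder h a \<le> max (pole_mult (\<lambda>_. 1) a) (pole_mult h' a)"
      by (intro neg_zorder_le_pole_mult h regular_off_const unit_off_imp_regular eq)
    then show "max 0 (- zorder h a) \<le> max 0 (- zorder h' a)"
      using unit_pole_mult[OF h(2), of a] by (simp add: pole_mult_def)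
  qed (use r in \<open>auto simp: good_def\<close>)
  ultimately show ?thesis by (simp add: T_def)
qed

text \<open>\<open>cross\<close> is \<open>1 - 1 / F\<close> with \<open>F = aff \<phi> a1\<close>,
  and conversely \<open>1 / F = 1 - cross\<close>; passing to the reciprocal costs a constant by the
  first main theorem.\<close>

lemma T_cross:
  assumes \<phi>: "admissible \<phi>" and r: "good r"
  shows "T (cross \<phi>) r \<le> T (aff \<phi> a1) r + (ka \<phi> + ln 2)" "T (aff \<phi> a1) r \<le> T (cross \<phi>) r + (ka \<phi> + ln 2)"
proof -
  note u = cross_unit[OF \<phi>] unit_off_inverse[OF affine_unit(1)[OF \<phi>]]
  have "T (cross \<phi>) r \<le> T (\<lambda>z. inverse (aff \<phi> a1 z)) r + ln 2"
    by (rule T_one_minus[OF u cross_eq(1)[OF \<phi>] r])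
  moreover have "T (\<lambda>z. inverse (aff \<phi> a1 z)) r \<le> T (cross \<phi>) r + ln 2"
    by (rule T_one_minus[OF u(2,1) _ r]) (simp add: cross_eq(1)[OF \<phi>])
  ultimately show "T (cross \<phi>) r \<le> T (aff \<phi> a1) r + (ka \<phi> + ln 2)" "T (aff \<phi> a1) r \<le> T (cross \<phi>) r + (ka \<phi> + ln 2)"
    using first_main[OF affine_unit(1)[OF \<phi>] r] by (auto simp: ka_def)
qed

lemma prox_le_affine:
  assumes \<phi>: "admissible \<phi>" and r: "good r"
  shows "proximity_fun \<phi> r \<le> proximity_fun (aff \<phi> a1) r + proximity_fun d r + proximity_fun a1 r + ln 2"
proof -
  have reg: "regular_off B \<phi>" "regular_off B (\<lambda>z. aff \<phi> a1 z * d z)" "regular_off B (aff \<phi> a1)" "regular_off B d"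
    by (intro unit_off_imp_regular admissible_unit[OF \<phi>] unit_off_mult affine_unit \<phi> du)+
  have "proximity_fun \<phi> r \<le> proximity_fun (\<lambda>z. aff \<phi> a1 z * d z) r + proximity_fun a1 r + ln 2"
    using good_notin[OF r] unit_off_nonzero[OF du] by (intro prox_add reg a1_reg r) (auto simp: aff_def)
  moreover have "proximity_fun (\<lambda>z. aff \<phi> a1 z * d z) r \<le> proximity_fun (aff \<phi> a1) r + proximity_fun d r"
    by (intro prox_mult reg r refl)
  ultimately show ?thesis by linarith
qed

lemma tame_affine:
  assumes \<phi>: "admissible \<phi>" and a: "a = a1 \<or> a = a2"
  shows "tame (aff \<phi> a)"
proof -
  obtain C where C: "\<forall>\<^sub>F k in sequentially. \<forall>R. near k R \<longrightarrow> proximity_fun \<phi> R \<le> C * T0 k"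
    using \<phi> by (auto simp: admissible_def)
  obtain D where D: "\<forall>\<^sub>F k in sequentially. \<forall>R. near k R \<longrightarrow> Tm a1 R + Tm a2 R \<le> D * T0 k"
    using tame_a by blast
  have "\<forall>\<^sub>F k in sequentially. \<forall>R. near k R \<longrightarrow> T (aff \<phi> a) R \<le> (C + 2 * D + 1) * T0 k"
  proof (rule eventually_mono[OF eventually_conj[OF eventually_conj[OF C D] T0_ge[of "2 * ln 2 + kd"]]], intro allI impI)
    fix k R
    assume *: "((\<forall>R. near k R \<longrightarrow> proximity_fun \<phi> R \<le> C * T0 k) \<and> (\<forall>R. near k R \<longrightarrow> Tm a1 R + Tm a2 R \<le> D * T0 k)) \<and> 2 * ln 2 + kd \<le> T0 k"
      and R: "near k R"
    then have "good R" using \<Gamma>_good by (simp add: near_def)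
    from T_affine[OF \<phi> this a] have "T (aff \<phi> a) R \<le> C * T0 k + 2 * (D * T0 k) + T0 k" using * R by force
    then show "T (aff \<phi> a) R \<le> (C + 2 * D + 1) * T0 k" by (simp add: algebra_simps)
  qed
  then show ?thesis unfolding tame_def by blast
qed

lemma tame_cross:
  assumes \<phi>: "admissible \<phi>"
  shows "tame (cross \<phi>)"
proof -
  obtain C where C: "\<forall>\<^sub>F k in sequentially. \<forall>R. near k R \<longrightarrow> T (aff \<phi> a1) R \<le> C * T0 k"
    using tame_affine[OF \<phi>] by (auto simp: tame_def)
  have "\<forall>\<^sub>F k in sequentially. \<forall>R. near k R \<longrightarrow> T (cross \<phi>) R \<le> (C + 1) * T0 k"
  proof (rule eventually_mono[OF eventually_conj[OF C T0_ge[of "ka \<phi> + ln 2"]]], intro allI impI)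
    fix k R
    assume *: "(\<forall>R. near k R \<longrightarrow> T (aff \<phi> a1) R \<le> C * T0 k) \<and> ka \<phi> + ln 2 \<le> T0 k"
      and R: "near k R"
    then have "good R" using \<Gamma>_good by (simp add: near_def)
    from T_cross(1)[OF \<phi> this] have "T (cross \<phi>) R \<le> C * T0 k + T0 k" using * R by force
    then show "T (cross \<phi>) R \<le> (C + 1) * T0 k" by (simp add: algebra_simps)
  qed
  then show ?thesis unfolding tame_def by blast
qed

lemma negl_A: "negl (\<lambda>k. Tm a1 (X k) + Tm a2 (X k))"
  by (intro negl_add small1 small2)

lemma T_cross_asymp:
  assumes \<phi>: "admissible \<phi>"
  shows "negl (\<lambda>k. T (cross \<phi>) (X k) - T0 k)" and "negl (\<lambda>k. T0 k - T (cross \<phi>) (X k))"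
proof -
  have n: "negl (\<lambda>k. proximity_fun \<phi> (X k) - T0 k)" "negl (\<lambda>k. T0 k - proximity_fun \<phi> (X k))"
    using \<phi> unfolding admissible_def by blast+
  have "negl (\<lambda>k. 2 * (Tm a1 (X k) + Tm a2 (X k)))" using negl_cmult[OF _ negl_A, of 2] by simp
  from negl_add[OF n(1) negl_add[OF this negl_const[of "(2 * ln 2 + kd) + (ka \<phi> + ln 2)"]]]
  show "negl (\<lambda>k. T (cross \<phi>) (X k) - T0 k)"
  proof (rule negl_mono)
    show "T (cross \<phi>) (X k) - T0 k \<le> proximity_fun \<phi> (X k) - T0 k + (2 * (Tm a1 (X k) + Tm a2 (X k)) + ((2 * ln 2 + kd) + (ka \<phi> + ln 2)))" for k
      using T_cross(1)[OF \<phi> good_X, of k] T_affine[OF \<phi> good_X, of a1 k] by simp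
  qed
  from negl_add[OF n(2) negl_add[OF negl_add[OF small_prox_negl[OF small_prox_d] small_prox_negl[OF small_prox_a1]] negl_const[of "ln 2 + (ka \<phi> + ln 2)"]]]
  show "negl (\<lambda>k. T0 k - T (cross \<phi>) (X k))"
  proof (rule negl_mono)
    show "T0 k - T (cross \<phi>) (X k) \<le> T0 k - proximity_fun \<phi> (X k) + (proximity_fun d (X k) + proximity_fun a1 (X k) + (ln 2 + (ka \<phi> + ln 2)))" for k
      using T_cross(2)[OF \<phi> good_X, of k] prox_le_affine[OF \<phi> good_X, of k] T_ge_prox[OF good_X, of "aff \<phi> a1" k] by linarith
  qed
qed

section \<open>Logarithmic derivatives of the normalised functions\<close>

definition ld :: "(complex \<Rightarrow> complex) \<Rightarrow> complex \<Rightarrow> complex" where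
  "ld h z = deriv h z / h z"

lemma ld_regular: "unit_off B h \<Longrightarrow> regular_off B (ld h)"
  unfolding ld_def [abs_def] by (intro regular_off_divide regular_off_deriv unit_off_imp_regular)

lemma small_prox_ld: "unit_off B h \<Longrightarrow> tame h \<Longrightarrow> small_prox (ld h)"
  using log_deriv_negl[of h] ld_regular[of h] by (simp add: small_prox_def ld_def [abs_def])

text \<open>For \<open>F = aff \<phi> a1\<close> the derivative of \<open>1 - 1 / F\<close> is
  \<open>F' / F^2\<close>. Divided by \<open>(F - 1) / F\<close> and multiplied by \<open>F\<close>
  it becomes \<open>F' / (F - 1)\<close>, a logarithmic derivative again.\<close>

lemma ld_cross_times_affine:
  assumes \<phi>: "admissible \<phi>" and z: "z \<notin> B"
  shows "ld (cross \<phi>) z * aff \<phi> a1 z = ld (aff \<phi> a2) z"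
proof -
  let ?F = "aff \<phi> a1"
  have dF: "(?F has_field_derivative deriv ?F z) (at z)"
    by (intro regular_has_deriv unit_off_imp_regular affine_unit \<phi> z)
  have nz: "?F z \<noteq> 0" "aff \<phi> a2 z \<noteq> 0"
    using unit_off_nonzero[OF affine_unit(1)[OF \<phi>] z] unit_off_nonzero[OF affine_unit(2)[OF \<phi>] z] by auto
  have "deriv (aff \<phi> a2) z = deriv (\<lambda>z. ?F z - 1) z"
    by (rule deriv_cong_off[OF cross_eq(2)[OF \<phi>] z])
  also have "\<dots> = deriv ?F z" using dF by (intro DERIV_imp_deriv) (auto intro!: derivative_eq_intros)
  finally have d2: "deriv (aff \<phi> a2) z = deriv ?F z" .
  have "deriv (cross \<phi>) z = deriv (\<lambda>z. 1 - inverse (?F z)) z"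
    by (rule deriv_cong_off[OF cross_eq(1)[OF \<phi>] z])
  also have "\<dots> = deriv ?F z / (?F z)^2"
    using dF nz by (intro DERIV_imp_deriv) (auto intro!: derivative_eq_intros simp: power2_eq_square field_simps)
  finally have "deriv (cross \<phi>) z = deriv ?F z / (?F z)^2" .
  then show ?thesis unfolding ld_def d2 cross_eq(3)[OF \<phi> z] using nz
    by (simp add: field_simps power2_eq_square)
qed

lemma small_prox_ld_cross:
  assumes \<phi>: "admissible \<phi>"
  shows "small_prox (ld (cross \<phi>))" "small_prox (\<lambda>z. ld (cross \<phi>) z * aff \<phi> a1 z)" "small_prox (\<lambda>z. ld (cross \<phi>) z * \<phi> z)"
proof -
  have reg: "regular_off B (ld (cross \<phi>))" by (intro ld_regular cross_unit \<phi>)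
  show 1: "small_prox (ld (cross \<phi>))" by (intro small_prox_ld cross_unit tame_cross \<phi>)
  have "small_prox (ld (aff \<phi> a2))" by (intro small_prox_ld affine_unit tame_affine \<phi>) simp
  then show 2: "small_prox (\<lambda>z. ld (cross \<phi>) z * aff \<phi> a1 z)"
    by (rule small_prox_cong[OF regular_off_mult[OF reg unit_off_imp_regular[OF affine_unit(1)[OF \<phi>]]]]) (rule ld_cross_times_affine[OF \<phi>])
  \<comment> \<open>Undoing the normalisation: \<open>\<phi> = aff \<phi> a1 * d + a1\<close>, where
    \<open>d\<close> and \<open>a1\<close> have small proximity.\<close>
  have "small_prox (\<lambda>z. ld (cross \<phi>) z * aff \<phi> a1 z * d z + ld (cross \<phi>) z * a1 z)"
    by (intro small_prox_add small_prox_mult[OF 2] small_prox_mult[OF 1] small_prox_d small_prox_a1)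
  then show "small_prox (\<lambda>z. ld (cross \<phi>) z * \<phi> z)"
  proof (rule small_prox_cong[OF regular_off_mult[OF reg unit_off_imp_regular[OF admissible_unit[OF \<phi>]]]])
    fix z assume "z \<notin> B"
    then have "d z \<noteq> 0" by (rule unit_off_nonzero[OF du])
    then show "ld (cross \<phi>) z * \<phi> z = ld (cross \<phi>) z * aff \<phi> a1 z * d z + ld (cross \<phi>) z * a1 z"
      by (simp add: aff_def field_simps)
  qed
qed

text \<open>\<open>f - g\<close> is written as \<open>f (1 - g / f)\<close> next to
  \<open>cross f\<close> and as \<open>g (f / g - 1)\<close> next to \<open>cross g\<close>: each
  logarithmic derivative absorbs its own function, and the shift quotients handle the rest.\<close>

lemma small_prox_ld_diff: "small_prox (\<lambda>z. ld (cross f) z * (f z - g z))" "small_prox (\<lambda>z. ld (cross g) z * (f z - g z))"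
proof -
  have reg: "regular_off B (ld (cross f))" "regular_off B (ld (cross g))"
    by (intro ld_regular cross_unit admissible_f admissible_g)+
  have fg: "regular_off B (\<lambda>z. f z - g z)" by (rule unit_off_imp_regular[OF diff_unit])
  have "small_prox (\<lambda>z. ld (cross f) z * f z * (1 - g z / f z))"
    by (intro small_prox_mult[OF small_prox_ld_cross(3)[OF admissible_f]] small_prox_diff small_prox_const small_prox_shift)
  then show "small_prox (\<lambda>z. ld (cross f) z * (f z - g z))"
  proof (rule small_prox_cong[OF regular_off_mult[OF reg(1) fg]])
    fix z assume "z \<notin> B"
    then have nz: "f z \<noteq> 0" by (rule unit_off_nonzero[OF f_unit])
    then show "ld (cross f) z * (f z - g z) = ld (cross f) z * f z * (1 - g z / f z)"
      by (simp add: right_diff_distrib)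
  qed
  have "small_prox (\<lambda>z. ld (cross g) z * g z * (f z / g z - 1))"
    by (intro small_prox_mult[OF small_prox_ld_cross(3)[OF admissible_g]] small_prox_diff small_prox_const small_prox_shift)
  then show "small_prox (\<lambda>z. ld (cross g) z * (f z - g z))"
  proof (rule small_prox_cong[OF regular_off_mult[OF reg(2) fg]])
    fix z assume "z \<notin> B"
    then have nz: "g z \<noteq> 0" by (rule unit_off_nonzero[OF g_unit])
    then show "ld (cross g) z * (f z - g z) = ld (cross g) z * g z * (f z / g z - 1)"
      by (simp add: right_diff_distrib)
  qed
qed

end

context shared begin

section \<open>Exclusion of multiplicative relations between the two cross ratios\<close>

definition w :: "nat \<Rightarrow> nat \<Rightarrow> complex \<Rightarrow> complex" where
  "w n m z = of_nat n * ld (cross f) z - of_nat m * ld (cross g) z"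

lemma Uu: "unit_off B (cross f)" and Vu: "unit_off B (cross g)"
  by (intro cross_unit admissible_f admissible_g)+

lemma quotient_unit: "unit_off B (\<lambda>z. cross f z ^ n / cross g z ^ m)"
  by (intro unit_off_divide unit_off_power Uu Vu)

lemma w_eq: "z \<notin> B \<Longrightarrow> w n m z = deriv (\<lambda>z. cross f z ^ n / cross g z ^ m) z / (cross f z ^ n / cross g z ^ m)"
  unfolding w_def ld_def by (rule log_deriv_quotient_powers[OF Uu Vu, symmetric])

lemma negl_T0_cmult: "0 < K \<Longrightarrow> negl (\<lambda>k. K * T0 k) \<Longrightarrow> False"
  using negl_cmult[of "1 / K" "\<lambda>k. K * T0 k"] not_negl_T0 by simp

lemma prox_mono_add3:
  assumes "regular_off B h" "regular_off B h1" "regular_off B h2" "regular_off B h3" "good r"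
    and "\<And>z. norm z = r \<Longrightarrow> log_plus (h z) \<le> log_plus (h1 z) + log_plus (h2 z) + log_plus (h3 z) + K"
  shows "proximity_fun h r \<le> proximity_fun h1 r + proximity_fun h2 r + proximity_fun h3 r + K"
proof -
  note c = regular_cont_log_plus[OF assms(1,5)] regular_cont_log_plus[OF assms(2,5)]
    regular_cont_log_plus[OF assms(3,5)] regular_cont_log_plus[OF assms(4,5)]
  have r0': "0 \<le> r" using good_pos[OF assms(5)] by simp
  have "circle_mean (\<lambda>z. log_plus (h z)) r \<le> circle_mean (\<lambda>z. ((log_plus (h1 z) + log_plus (h2 z)) + log_plus (h3 z)) + K) r"
    by (intro circle_mean_mono continuous_on_add continuous_on_const c r0' assms(6))
  also have "\<dots> = circle_mean (\<lambda>z. log_plus (h1 z)) r + circle_mean (\<lambda>z. log_plus (h2 z)) r + circle_mean (\<lambda>z. log_plus (h3 z)) r + K"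
    by (simp only: circle_mean_add[OF continuous_on_add[OF continuous_on_add[OF c(2,3)] c(4)] continuous_on_const r0']
        circle_mean_add[OF continuous_on_add[OF c(2,3)] c(4) r0'] circle_mean_add[OF c(2,3) r0'] circle_mean_const)
  finally show ?thesis by (simp add: proximity_eq_circle_mean)
qed

text \<open>The identity \<open>U = k V\<close> with \<open>k \<noteq> 1\<close> expresses \<open>g\<close> through \<open>g / f\<close>, \<open>1 / f\<close> and small
  functions, so \<open>g\<close> would be small: where \<open>f\<close> is small, \<open>g = (g / f) f\<close> is controlled directly.\<close>

lemma cross_proportional_False:
  assumes k: "\<And>z. z \<notin> B \<Longrightarrow> cross f z = k * cross g z"
  shows False
proof (cases "k = 1")
  case True
  obtain z where z: "z \<notin> B" using good_notin[OF good_r0, of "of_real r0"] r0 by auto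
  have nz: "f z - a1 z \<noteq> 0" "g z - a1 z \<noteq> 0" "d z \<noteq> 0" "f z - g z \<noteq> 0"
    using unit_off_nonzero[OF fa1 z] unit_off_nonzero[OF ga1 z] unit_off_nonzero[OF du z] unit_off_nonzero[OF diff_unit z] by auto
  \<comment> \<open>Equality of the cross ratios cross-multiplies to
    \<open>(f - g) * d = 0\<close>.\<close>
  have "(f z - a2 z) * (g z - a1 z) = (g z - a2 z) * (f z - a1 z)"
    using k[OF z] True nz by (simp add: cross_def field_simps)
  then have "(f z - g z) * d z = 0" by (simp add: d_def algebra_simps)
  then show False using nz by simp
next
  case k1: False
  \<comment> \<open>\<open>K\<close> collects the coefficients of the three terms in the equation
    solved for \<open>(1 - k) * g z\<close>.\<close>
  define K where "K = ((1 + norm k) + (1 + norm k) + norm (1 - k)) / norm (1 - k)"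
  have K: "1 \<le> K" using k1 by (simp add: K_def field_simps add_nonneg_nonneg)
  have reg: "regular_off B g" "regular_off B (\<lambda>z. g z / f z)"
    by (rule unit_off_imp_regular[OF g_unit], rule unit_off_imp_regular[OF unit_off_divide[OF g_unit f_unit]])
  have le: "log_plus (g z) \<le> log_plus (g z / f z) + log_plus (a1 z) + log_plus (a2 z) + ln K" if z: "z \<notin> B" for z
  proof -
    define A1 A2 Q where "A1 = max 1 (norm (a1 z))" and "A2 = max 1 (norm (a2 z))" and "Q = max 1 (norm (g z / f z))"
    have ge: "1 \<le> A1" "1 \<le> A2" "1 \<le> Q" "norm (a1 z) \<le> A1" "norm (a2 z) \<le> A2" "norm (g z / f z) \<le> Q"
      by (auto simp: A1_def A2_def Q_def)
    have AA: "A1 \<le> A1 * A2" "A2 \<le> A1 * A2" "1 \<le> A1 * A2"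
      using ge mult_mono[of 1 A1 1 A2] by auto
    have gA: "norm (a1 z) \<le> A1 * A2" "norm (a2 z) \<le> A1 * A2"
      by (rule order_trans[OF ge(4) AA(1)], rule order_trans[OF ge(5) AA(2)])
    have AQ: "A1 * A2 \<le> A1 * A2 * Q" "Q \<le> A1 * A2 * Q" "1 \<le> A1 * A2 * Q"
      using ge AA mult_mono[of 1 "A1 * A2" 1 Q] by auto
    have nz: "f z \<noteq> 0" "f z - a1 z \<noteq> 0" "g z - a1 z \<noteq> 0"
      using unit_off_nonzero[OF f_unit z] unit_off_nonzero[OF fa1 z] unit_off_nonzero[OF ga1 z] by auto
    have "norm (g z) \<le> K * (A1 * A2 * Q)"
    proof (cases "norm (f z) < 1")
      case True
      have "norm (g z) = norm (g z / f z) * norm (f z)" using nz by (simp add: norm_divide)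
      also have "\<dots> \<le> Q * 1" using ge True by (intro mult_mono) auto
      also have "\<dots> \<le> 1 * (A1 * A2 * Q)" using AQ by simp
      also have "\<dots> \<le> K * (A1 * A2 * Q)" using K AQ by (intro mult_right_mono) auto
      finally show ?thesis .
    next
      case False
      have "(f z - a2 z) * (g z - a1 z) = k * (f z - a1 z) * (g z - a2 z)"
        using k[OF z] nz by (simp add: cross_def field_simps)
      \<comment> \<open>Solved for the product of \<open>f\<close> and \<open>g\<close>; dividing by
        \<open>f z\<close>, of modulus at least 1 here, leaves only \<open>g / f\<close>,
        \<open>1 / f\<close> and the targets on the right.\<close>
      then have m: "(1 - k) * g z * f z = (a1 z - k * a2 z) * f z + (a2 z - k * a1 z) * g z - (1 - k) * (a1 z * a2 z)"
        by (simp add: algebra_simps)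
      have "(1 - k) * g z = ((1 - k) * g z * f z) / f z" using nz by simp
      also have "\<dots> = (a1 z - k * a2 z) + (a2 z - k * a1 z) * (g z / f z) - (1 - k) * (a1 z * a2 z) / f z"
        unfolding m using nz by (simp add: add_divide_distrib diff_divide_distrib)
      finally have eq: "(1 - k) * g z = (a1 z - k * a2 z) + (a2 z - k * a1 z) * (g z / f z) - (1 - k) * (a1 z * a2 z) / f z" .
      have b1: "norm (a1 z - k * a2 z) \<le> (1 + norm k) * (A1 * A2)"
      proof -
        have "norm (a1 z - k * a2 z) \<le> norm (a1 z) + norm k * norm (a2 z)"
          using norm_triangle_ineq4[of "a1 z" "k * a2 z"] by (simp add: norm_mult)
        also have "\<dots> \<le> A1 * A2 + norm k * (A1 * A2)"
          by (intro add_mono mult_left_mono gA) auto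
        finally show ?thesis by (simp add: algebra_simps)
      qed
      have b2: "norm (a2 z - k * a1 z) \<le> (1 + norm k) * (A1 * A2)"
      proof -
        have "norm (a2 z - k * a1 z) \<le> norm (a2 z) + norm k * norm (a1 z)"
          using norm_triangle_ineq4[of "a2 z" "k * a1 z"] by (simp add: norm_mult)
        also have "\<dots> \<le> A1 * A2 + norm k * (A1 * A2)"
          by (intro add_mono mult_left_mono gA) auto
        finally show ?thesis by (simp add: algebra_simps)
      qed
      have b3: "norm ((1 - k) * (a1 z * a2 z) / f z) \<le> norm (1 - k) * (A1 * A2)"
      proof -
        have "norm ((1 - k) * (a1 z * a2 z) / f z) = norm (1 - k) * (norm (a1 z) * norm (a2 z)) / norm (f z)"
          by (simp add: norm_mult norm_divide)
        also have "\<dots> \<le> norm (1 - k) * (A1 * A2) / 1"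
          using ge False by (intro frac_le mult_left_mono mult_mono) auto
        finally show ?thesis by simp
      qed
      have "norm (1 - k) * norm (g z) = norm ((a1 z - k * a2 z) + (a2 z - k * a1 z) * (g z / f z) - (1 - k) * (a1 z * a2 z) / f z)"
        using eq by (simp add: norm_mult[symmetric])
      also have "\<dots> \<le> norm (a1 z - k * a2 z) + norm (a2 z - k * a1 z) * norm (g z / f z) + norm ((1 - k) * (a1 z * a2 z) / f z)"
        unfolding norm_mult[of "a2 z - k * a1 z", symmetric]
        by (rule order_trans[OF norm_triangle_ineq4 add_right_mono[OF norm_triangle_ineq]])
      also have "\<dots> \<le> (1 + norm k) * (A1 * A2) + (1 + norm k) * (A1 * A2) * Q + norm (1 - k) * (A1 * A2)"
        using ge by (intro add_mono b1 b3 mult_mono b2) auto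
      also have "\<dots> \<le> (1 + norm k) * (A1 * A2 * Q) + (1 + norm k) * (A1 * A2 * Q) + norm (1 - k) * (A1 * A2 * Q)"
        using AQ by (intro add_mono mult_left_mono) (auto simp: mult.assoc)
      also have "\<dots> = ((1 + norm k) + (1 + norm k) + norm (1 - k)) * (A1 * A2 * Q)"
        by (simp only: distrib_right)
      finally have "norm (g z) \<le> ((1 + norm k) + (1 + norm k) + norm (1 - k)) * (A1 * A2 * Q) / norm (1 - k)"
        using k1 by (simp add: pos_le_divide_eq mult.commute)
      then show ?thesis by (simp add: K_def)
    qed
    moreover have "1 \<le> K * (A1 * A2 * Q)" using K AQ mult_mono[of 1 K 1 "A1 * A2 * Q"] by simp
    ultimately have "log_plus (g z) \<le> ln (K * (A1 * A2 * Q))"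
      unfolding log_plus_def by (subst ln_le_cancel_iff) auto
    also have "\<dots> = ln K + (ln A1 + ln A2 + ln Q)"
      using K ge by (simp add: ln_mult)
    finally show ?thesis by (simp add: log_plus_def A1_def A2_def Q_def)
  qed
  have pr: "proximity_fun g (X k) \<le> proximity_fun (\<lambda>z. g z / f z) (X k) + proximity_fun a1 (X k) + proximity_fun a2 (X k) + ln K" for k
    using good_notin[OF good_X] by (intro prox_mono_add3 reg a1_reg a2_reg good_X le) auto
  have "negl (\<lambda>k. proximity_fun (\<lambda>z. g z / f z) (X k) + proximity_fun a1 (X k) + proximity_fun a2 (X k) + ln K)"
    by (intro negl_add negl_const small_prox_negl small_prox_a1 small_prox_a2 small_prox_shift(1))
  then have ng: "negl (\<lambda>k. proximity_fun g (X k))" using pr by (rule negl_mono)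
  have "negl (\<lambda>k. T0 k - proximity_fun g (X k))" using admissible_g unfolding admissible_def by blast
  from negl_add[OF ng this] have "negl T0" by (rule negl_mono) simp
  then show False using not_negl_T0 by blast
qed

lemma negl_power_aux:
  assumes le: "\<And>k. real n * u k \<le> real m * v k + K" and mn: "m < n"
    and u: "negl (\<lambda>k. T0 k - u k)" and v: "negl (\<lambda>k. v k - T0 k)"
  shows False
proof -
  have "negl (\<lambda>k. real n * (T0 k - u k) + (real m * (v k - T0 k) + K))"
    by (intro negl_add negl_const negl_cmult u v) auto
  then have "negl (\<lambda>k. (real n - real m) * T0 k)"
  proof (rule negl_mono)
    show "(real n - real m) * T0 k \<le> real n * (T0 k - u k) + (real m * (v k - T0 k) + K)" for k
      using le[of k] by (simp add: algebra_simps)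
  qed
  then show False using mn negl_T0_cmult[of "real n - real m"] by simp
qed

lemma w_zero_False:
  assumes nm: "0 < n \<or> 0 < m" and 0: "\<And>z. z \<notin> B \<Longrightarrow> w n m z = 0"
  shows False
proof -
  let ?W = "\<lambda>z. cross f z ^ n / cross g z ^ m"
  have dW: "deriv ?W z = 0" if z: "z \<notin> B" for z
  proof -
    have "deriv ?W z / ?W z = 0" using 0[OF z] w_eq[OF z, of n m] by metis
    then show ?thesis using unit_off_nonzero[OF quotient_unit z, of n m] by (meson divide_eq_0_iff)
  qed
  obtain k where k: "k \<noteq> 0" "\<And>z. z \<notin> B \<Longrightarrow> ?W z = k"
    using constant_off_if_log_deriv_zero[OF quotient_unit dW] by blast
  have UV: "cross f z ^ n = k * cross g z ^ m" "cross g z ^ m = inverse k * cross f z ^ n" if "z \<notin> B" for z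
    using k(2)[OF that] k(1) unit_off_nonzero[OF Vu that] by (auto simp: field_simps)
  have 1: "real n * T (cross f) (X j) \<le> real m * T (cross g) (X j) + log_plus k" for j
  proof -
    have "T (\<lambda>z. cross f z ^ n) (X j) = T (\<lambda>z. k * cross g z ^ m) (X j)"
      by (rule T_cong_off[OF good_X UV(1)])
    also have "\<dots> \<le> T (\<lambda>z. cross g z ^ m) (X j) + log_plus k"
      by (rule T_cmult[OF unit_off_power[OF Vu] good_X k(1)])
    finally show ?thesis unfolding T_power[OF Uu good_X] T_power[OF Vu good_X] .
  qed
  have 2: "real m * T (cross g) (X j) \<le> real n * T (cross f) (X j) + log_plus (inverse k)" for j
  proof -
    have "T (\<lambda>z. cross g z ^ m) (X j) = T (\<lambda>z. inverse k * cross f z ^ n) (X j)"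
      by (rule T_cong_off[OF good_X UV(2)])
    also have "\<dots> \<le> T (\<lambda>z. cross f z ^ n) (X j) + log_plus (inverse k)"
      using k(1) by (intro T_cmult[OF unit_off_power[OF Uu] good_X]) simp
    finally show ?thesis unfolding T_power[OF Uu good_X] T_power[OF Vu good_X] .
  qed
  note aU = T_cross_asymp[OF admissible_f] and aV = T_cross_asymp[OF admissible_g]
  have "n = m"
  proof (rule linorder_cases[of n m])
    assume "m < n"
    then show ?thesis using negl_power_aux[OF 1 _ aU(2) aV(1)] by blast
  next
    assume "n < m"
    then show ?thesis using negl_power_aux[OF 2 _ aV(2) aU(1)] by blast
  qed
  then have n0: "n \<noteq> 0" using nm by auto
  \<comment> \<open>With equal exponents the factor \<open>n\<close> cancels in
    \<open>w n n\<close>. So the quotient of the cross ratios is itself constant, and no root has to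
    be extracted from \<open>U ^ n = k V ^ n\<close>.\<close>
  have w1: "w 1 1 z = 0" if "z \<notin> B" for z
  proof -
    have "of_nat n * w 1 1 z = w n m z" using \<open>n = m\<close> by (simp add: w_def algebra_simps)
    then show ?thesis using 0[OF that] n0 by simp
  qed
  let ?W1 = "\<lambda>z. cross f z ^ 1 / cross g z ^ 1"
  have dW1: "deriv ?W1 z = 0" if z: "z \<notin> B" for z
    using w1[OF z] w_eq[OF z, of 1 1] unit_off_nonzero[OF quotient_unit z, of 1 1] by auto
  obtain k1 where k1: "k1 \<noteq> 0" "\<And>z. z \<notin> B \<Longrightarrow> ?W1 z = k1"
    using constant_off_if_log_deriv_zero[OF quotient_unit dW1] by blast
  show False
  proof (rule cross_proportional_False)
    show "cross f z = k1 * cross g z" if "z \<notin> B" for z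
      using k1(2)[OF that] unit_off_nonzero[OF Vu that] by (auto simp: field_simps)
  qed
qed

section \<open>Truncated counting and the exceptional places\<close>

definition support :: "(complex \<Rightarrow> complex) \<Rightarrow> complex \<Rightarrow> int" where
  "support h a = (if zorder h a \<noteq> 0 then 1 else 0)"

text \<open>The second main theorem for the three targets \<open>a1\<close>, \<open>a2\<close> and infinity.\<close>

lemma second_main:
  assumes q: "unit_off B (ld (cross f))"
  shows "negl (\<lambda>k. T0 k - counting (support (cross f)) (X k))"
proof -
  let ?q = "ld (cross f)" and ?F = "aff f a1"
  define kq where "kq = circle_mean (\<lambda>z. ln (norm (?q z))) r0"
  have iq: "unit_off B (\<lambda>z. inverse (?q z))" by (rule unit_off_inverse[OF q])
  have F: "unit_off B ?F" by (rule affine_unit(1)[OF admissible_f])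
  have le: "T0 k - counting (support (cross f)) (X k) \<le>
     proximity_fun (\<lambda>z. ?q z * ?F z) (X k) + (proximity_fun ?q (X k) + (proximity_fun d (X k) + (proximity_fun a1 (X k) + (ln 2 - kq))))" for k
  proof -
    \<comment> \<open>\<open>F = (q F) * (1 / q)\<close>, where \<open>q F\<close> has negligible
      proximity. The proximity of \<open>1 / q\<close> is at most the characteristic of
      \<open>q\<close> up to a constant, and the poles of \<open>q\<close> are simple and lie on the
      support: hence the truncated count.\<close>
    have "proximity_fun ?F (X k) \<le> proximity_fun (\<lambda>z. ?q z * ?F z) (X k) + proximity_fun (\<lambda>z. inverse (?q z)) (X k)"
      using good_notin[OF good_X] unit_off_nonzero[OF q]
      by (intro prox_mult unit_off_imp_regular[OF unit_off_mult[OF q F]] unit_off_imp_regular[OF iq] unit_off_imp_regular[OF F] good_X) auto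
    moreover have "proximity_fun (\<lambda>z. inverse (?q z)) (X k) \<le> T ?q (X k) - kq"
      using T_ge_prox[OF good_X, of "\<lambda>z. inverse (?q z)" k] first_main[OF q good_X, of k] by (simp add: kq_def)
    moreover have "T ?q (X k) \<le> proximity_fun ?q (X k) + counting (support (cross f)) (X k)"
    proof -
      have "counting (\<lambda>a. max 0 (- zorder ?q a)) (X k) \<le> counting (support (cross f)) (X k)"
      proof (rule counting_mono)
        fix a
        show "max 0 (- zorder ?q a) \<le> support (cross f) a"
          using zorder_log_deriv[OF Uu q, of a] by (cases "zorder (cross f) a = 0") (auto simp: support_def ld_def)
      qed (use good_X in \<open>auto simp: good_def\<close>)
      then show ?thesis by (simp add: T_def)
    qed
    moreover have "T0 k \<le> proximity_fun ?F (X k) + proximity_fun d (X k) + proximity_fun a1 (X k) + ln 2"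
      unfolding T0_def by (rule prox_le_affine[OF admissible_f good_X])
    ultimately show ?thesis by linarith
  qed
  have "negl (\<lambda>k. proximity_fun (\<lambda>z. ?q z * ?F z) (X k) + (proximity_fun ?q (X k) + (proximity_fun d (X k) + (proximity_fun a1 (X k) + (ln 2 - kq)))))"
    by (intro negl_add negl_const small_prox_negl small_prox_a1 small_prox_d small_prox_ld_cross[OF admissible_f])
  then show ?thesis using le by (rule negl_mono)
qed

text \<open>Zero exactly where neither target has a pole and \<open>d\<close> has order 0. Being an
  integer, it is at least 1 at all other points and so pays for a simple pole of \<open>w\<close>
  there.\<close>

definition exc :: "complex \<Rightarrow> int" where
  "exc a = pole_mult a1 a + pole_mult a2 a + \<bar>zorder d a\<bar>"

lemma pole_mult_a_nonneg: "0 \<le> pole_mult a1 a" "0 \<le> pole_mult a2 a"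
  using a1_reg a2_reg by (auto intro!: pole_mult_nonneg simp: regular_off_def)

lemma exc_nonneg: "0 \<le> exc a"
  using pole_mult_a_nonneg[of a] by (simp add: exc_def)

lemma counting_abs_zorder_le:
  assumes h: "unit_off B h" and r: "good r"
  shows "counting (\<lambda>a. \<bar>zorder h a\<bar>) r \<le> 2 * T h r - circle_mean (\<lambda>z. ln (norm (h z))) r0"
proof -
  have "(\<lambda>a. \<bar>zorder h a\<bar>) = (\<lambda>a. max 0 (- zorder h a) + max 0 (zorder h a))" by auto
  then have "counting (\<lambda>a. \<bar>zorder h a\<bar>) r \<le> T h r + T (\<lambda>z. inverse (h z)) r"
    using prox_nonneg[OF unit_off_imp_regular[OF h] r] prox_nonneg[OF unit_off_imp_regular[OF unit_off_inverse[OF h]] r]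
    by (simp add: counting_add T_def zorder_inverse_unit[OF h])
  then show ?thesis using T_sum_eq[OF h r] by simp
qed

lemma negl_exc: "negl (\<lambda>k. counting exc (X k))"
proof -
  define K where "K = 2 * ln 2 - circle_mean (\<lambda>z. ln (norm (d z))) r0"
  have le: "counting exc (X k) \<le> 3 * (Tm a1 (X k) + Tm a2 (X k)) + K" for k
  proof -
    have "counting exc (X k) = counting (pole_mult a1) (X k) + counting (pole_mult a2) (X k) + counting (\<lambda>a. \<bar>zorder d a\<bar>) (X k)"
      by (simp add: exc_def [abs_def] counting_add)
    moreover have "counting (pole_mult a1) (X k) \<le> Tm a1 (X k)" "counting (pole_mult a2) (X k) \<le> Tm a2 (X k)"
      using prox_nonneg[OF a1_reg good_X, of k] prox_nonneg[OF a2_reg good_X, of k] by (auto simp: Tm_def)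
    ultimately show ?thesis using counting_abs_zorder_le[OF du good_X, of k] T_d[OF good_X, of k] by (simp add: K_def)
  qed
  have "negl (\<lambda>k. 3 * (Tm a1 (X k) + Tm a2 (X k)) + K)"
    by (intro negl_add[OF negl_cmult[OF _ negl_A] negl_const]) simp
  then show ?thesis using le by (rule negl_mono)
qed

text \<open>At such a point the targets are finite and distinct, so a positive order of
  \<open>cross\<close> means the value \<open>a2 a\<close> and a negative order the value
  \<open>a1 a\<close>. The limits in \<open>mero_zeros\<close> are values here, and sharing
  applies.\<close>

lemma shared_points:
  assumes x: "exc a = 0"
  shows "zorder (cross f) a > 0 \<longleftrightarrow> zorder (cross g) a > 0"
    and "zorder (cross f) a < 0 \<longleftrightarrow> zorder (cross g) a < 0"
    and "zorder (cross f) a \<noteq> 0 \<Longrightarrow> f a = g a"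
proof -
  have x': "pole_mult a1 a = 0" "pole_mult a2 a = 0" "zorder d a = 0"
    using x pole_mult_a_nonneg[of a] by (auto simp: exc_def)
  have "\<not> is_pole a1 a" "\<not> is_pole a2 a"
    using x' pole_mult_pos[of a1 a] pole_mult_pos[of a2 a] a1_reg a2_reg by (auto simp: regular_off_def)
  then have an: "a1 analytic_on {a}" "a2 analytic_on {a}"
    using nicely_meromorphic_on_imp_analytic_at[OF a1_nice] nicely_meromorphic_on_imp_analytic_at[OF a2_nice] by auto
  then have "d analytic_on {a}" unfolding d_def [abs_def] by (intro analytic_intros)
  then have "d a \<noteq> 0" using zorder_eq_0_iff[OF _ frequently_nonzero[OF du]] x' by blast
  then have da: "a1 a \<noteq> a2 a" by (simp add: d_def)
  have ent: "f analytic_on {a}" "g analytic_on {a}"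
    using analytic_on_subset[of f UNIV "{a}"] analytic_on_subset[of g UNIV "{a}"] f_entire g_entire
    by (auto simp: analytic_on_open)
  have key: "(zorder (cross \<phi>) a > 0 \<longleftrightarrow> \<phi> a = a2 a) \<and> (zorder (cross \<phi>) a < 0 \<longleftrightarrow> \<phi> a = a1 a)"
    if \<phi>: "admissible \<phi>" and an\<phi>: "\<phi> analytic_on {a}" for \<phi>
  proof -
    note u1 = admissible_unit1[OF \<phi>] and u2 = admissible_unit2[OF \<phi>]
    have z: "zorder (cross \<phi>) a = zorder (\<lambda>z. \<phi> z - a2 z) a - zorder (\<lambda>z. \<phi> z - a1 z) a"
      unfolding cross_def [abs_def] by (rule zorder_divide_unit[OF u2 u1])
    have 1: "(\<lambda>z. \<phi> z - a1 z) analytic_on {a}" and 2: "(\<lambda>z. \<phi> z - a2 z) analytic_on {a}"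
      using an an\<phi> by (auto intro!: analytic_intros)
    have p: "zorder (\<lambda>z. \<phi> z - a1 z) a > 0 \<longleftrightarrow> \<phi> a = a1 a" "zorder (\<lambda>z. \<phi> z - a2 z) a > 0 \<longleftrightarrow> \<phi> a = a2 a"
      using zorder_pos_iff'[OF 1 frequently_nonzero[OF u1]] zorder_pos_iff'[OF 2 frequently_nonzero[OF u2]] by auto
    have n: "zorder (\<lambda>z. \<phi> z - a1 z) a \<ge> 0" "zorder (\<lambda>z. \<phi> z - a2 z) a \<ge> 0"
      using zorder_ge_0[OF 1 frequently_nonzero[OF u1]] zorder_ge_0[OF 2 frequently_nonzero[OF u2]] by auto
    show ?thesis using z p n da by (smt (verit))
  qed
  have mz: "a \<in> mero_zeros (\<lambda>z. \<phi> z - b z) \<longleftrightarrow> \<phi> a = b a"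
    if "\<phi> analytic_on {a}" "b analytic_on {a}" for \<phi> b
  proof -
    have "isCont (\<lambda>z. \<phi> z - b z) a" using that by (intro analytic_at_imp_isCont analytic_intros)
    then have t: "((\<lambda>z. \<phi> z - b z) \<longlongrightarrow> \<phi> a - b a) (at a)" by (simp add: isCont_def)
    show ?thesis unfolding mero_zeros_def
      using t LIM_unique[OF t, of 0] by auto
  qed
  have s: "f a = a1 a \<longleftrightarrow> g a = a1 a" "f a = a2 a \<longleftrightarrow> g a = a2 a"
    using share1 share2 mz ent an unfolding share_IM_def by blast+
  note kf = key[OF admissible_f ent(1)] and kg = key[OF admissible_g ent(2)]
  show "zorder (cross f) a > 0 \<longleftrightarrow> zorder (cross g) a > 0" "zorder (cross f) a < 0 \<longleftrightarrow> zorder (cross g) a < 0"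
    using kf kg s by auto
  show "f a = g a" if "zorder (cross f) a \<noteq> 0"
    using that kf s by (metis linorder_neqE)
qed

text \<open>A small function vanishing at the shared points where the multiplicities of \<open>cross f\<close> and
  \<open>cross g\<close> are \<open>m\<close> and \<open>n\<close>, because the residues of the two logarithmic derivatives cancel.\<close>

definition chi :: "nat \<Rightarrow> nat \<Rightarrow> complex \<Rightarrow> complex" where
  "chi n m z = w n m z * (f z - g z)"

lemma zorder_diff: "0 \<le> zorder (\<lambda>z. f z - g z) a" "f a = g a \<Longrightarrow> 0 < zorder (\<lambda>z. f z - g z) a"
proof -
  have "(\<lambda>z. f z - g z) holomorphic_on UNIV" using f_entire g_entire by (intro holomorphic_intros)
  then have "(\<lambda>z. f z - g z) analytic_on {a}"
    using analytic_on_subset[of "\<lambda>z. f z - g z" UNIV "{a}"] by (auto simp: analytic_on_open)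
  then show "0 \<le> zorder (\<lambda>z. f z - g z) a" "f a = g a \<Longrightarrow> 0 < zorder (\<lambda>z. f z - g z) a"
    using zorder_ge_0[OF _ frequently_nonzero[OF diff_unit]] zorder_pos_iff'[OF _ frequently_nonzero[OF diff_unit]] by auto
qed

lemma zorder_quotient: "zorder (\<lambda>z. cross f z ^ n / cross g z ^ m) a = int n * zorder (cross f) a - int m * zorder (cross g) a"
  by (simp add: zorder_divide_unit[OF unit_off_power[OF Uu] unit_off_power[OF Vu]]
      zorder_power_unit[OF Uu] zorder_power_unit[OF Vu])

text \<open>At a shared point the simple pole of \<open>w\<close> is compensated by the zero of
  \<open>f - g\<close>. If the weighted orders agree, \<open>cross f ^ n / cross g ^ m\<close> has
  order 0 there, \<open>w\<close> has no pole, and the zero of \<open>f - g\<close>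
  survives.\<close>

lemma zorder_chi:
  assumes w: "unit_off B (w n m)"
  shows "- zorder (chi n m) a \<le> exc a"
    and "exc a = 0 \<Longrightarrow> zorder (cross f) a \<noteq> 0 \<Longrightarrow> int n * zorder (cross f) a = int m * zorder (cross g) a
      \<Longrightarrow> 1 \<le> zorder (chi n m) a"
proof -
  have z: "zorder (chi n m) a = zorder (w n m) a + zorder (\<lambda>z. f z - g z) a"
    unfolding chi_def [abs_def] by (rule zorder_mult_unit[OF w diff_unit])
  note wz = zorder_log_deriv[OF quotient_unit w w_eq, of a, unfolded zorder_quotient]
  show "- zorder (chi n m) a \<le> exc a"
  proof (cases "exc a = 0")
    case True
    show ?thesis
    proof (cases "zorder (cross f) a = 0")
      case z0: True
      then have "zorder (cross g) a = 0" using shared_points(1,2)[OF True] by auto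
      then have "0 \<le> zorder (w n m) a" using wz(2) z0 by simp
      then show ?thesis using z zorder_diff(1)[of a] True by simp
    next
      case False
      then show ?thesis using z wz(1) zorder_diff(2)[OF shared_points(3)[OF True False]] True by simp
    qed
  next
    case False
    then show ?thesis using z wz(1) zorder_diff(1)[of a] exc_nonneg[of a] by simp
  qed
  show "1 \<le> zorder (chi n m) a" if "exc a = 0" "zorder (cross f) a \<noteq> 0" "int n * zorder (cross f) a = int m * zorder (cross g) a"
    using z wz(2) that zorder_diff(2)[OF shared_points(3)[OF that(1,2)]] by simp
qed

text \<open>Zeros are counted by the characteristic of the reciprocal, hence by that of
  \<open>chi\<close>, which has negligible proximity and poles only at exceptional places.\<close>

lemma negl_zeros_chi:
  assumes w: "unit_off B (w n m)"
  shows "negl (\<lambda>k. counting (\<lambda>a. max 0 (zorder (chi n m) a)) (X k))"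
proof -
  have cu: "unit_off B (chi n m)" unfolding chi_def [abs_def] by (rule unit_off_mult[OF w diff_unit])
  have "small_prox (\<lambda>z. of_nat n * (ld (cross f) z * (f z - g z)) - of_nat m * (ld (cross g) z * (f z - g z)))"
    by (rule small_prox_diff[OF small_prox_mult[OF small_prox_const small_prox_ld_diff(1)] small_prox_mult[OF small_prox_const small_prox_ld_diff(2)]])
  then have small_prox: "small_prox (chi n m)"
    by (rule small_prox_cong[OF unit_off_imp_regular[OF cu]]) (simp add: chi_def w_def algebra_simps)
  define K where "K = circle_mean (\<lambda>z. ln (norm (chi n m z))) r0"
  have le: "counting (\<lambda>a. max 0 (zorder (chi n m) a)) (X k) \<le> proximity_fun (chi n m) (X k) + (counting exc (X k) + (- K))" for k
  proof -
    have "counting (\<lambda>a. max 0 (zorder (chi n m) a)) (X k) \<le> T (\<lambda>z. inverse (chi n m z)) (X k)"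
      using prox_nonneg[OF unit_off_imp_regular[OF unit_off_inverse[OF cu]] good_X, of k]
      by (simp add: T_def zorder_inverse_unit[OF cu])
    also have "\<dots> = T (chi n m) (X k) - K" using first_main[OF cu good_X, of k] by (simp add: K_def)
    also have "T (chi n m) (X k) \<le> proximity_fun (chi n m) (X k) + counting exc (X k)"
      unfolding T_def
    proof (intro add_left_mono counting_mono)
      show "max 0 (- zorder (chi n m) a) \<le> exc a" for a using zorder_chi(1)[OF w, of a] exc_nonneg[of a] by simp
    qed (use good_X in \<open>auto simp: good_def\<close>)
    finally show ?thesis by simp
  qed
  have "negl (\<lambda>k. proximity_fun (chi n m) (X k) + (counting exc (X k) + (- K)))"
    by (intro negl_add negl_const negl_exc small_prox_negl small_prox)
  then show ?thesis using le by (rule negl_mono)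
qed

text \<open>At an ordinary shared point either some \<open>chi n m\<close> with
  \<open>n, m \<le> 4\<close> vanishes, or the two multiplicities add up to at least
  \<open>5 + 1\<close>. The error terms carry the factor 6 of the left-hand side.\<close>

lemma counting_pointwise:
  assumes w: "\<And>n m. n \<in> {1..4} \<Longrightarrow> m \<in> {1..4} \<Longrightarrow> unit_off B (w n m)"
  shows "6 * support (cross f) a \<le> 6 * exc a + 6 * (\<Sum>p\<in>{1..4} \<times> {1..4}. max 0 (zorder (chi (fst p) (snd p)) a))
     + (\<bar>zorder (cross f) a\<bar> + \<bar>zorder (cross g) a\<bar>)"
proof -
  let ?S = "\<Sum>p\<in>{1..4::nat} \<times> {1..4::nat}. max 0 (zorder (chi (fst p) (snd p)) a)"
  have S0: "0 \<le> ?S" by (intro sum_nonneg) auto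
  show ?thesis
  proof (cases "exc a = 0 \<and> zorder (cross f) a \<noteq> 0")
    case True
    \<comment> \<open>The indices cross over: the multiplicity \<open>n\<close> of
      \<open>cross g\<close> is the coefficient that multiplies the order of
      \<open>cross f\<close>.\<close>
    define m n where "m = nat \<bar>zorder (cross f) a\<bar>" and "n = nat \<bar>zorder (cross g) a\<bar>"
    have sg: "zorder (cross f) a > 0 \<and> zorder (cross g) a > 0 \<or> zorder (cross f) a < 0 \<and> zorder (cross g) a < 0"
      using True shared_points(1,2)[of a] by auto
    then have mn: "1 \<le> m" "1 \<le> n" by (auto simp: m_def n_def)
    show ?thesis
    proof (cases "m \<le> 4 \<and> n \<le> 4")
      case le: True
      have "int n * zorder (cross f) a = int m * zorder (cross g) a"
        using sg by (auto simp: m_def n_def)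
      then have "1 \<le> zorder (chi n m) a" using zorder_chi(2)[OF w[of n m]] True le mn by auto
      also have "zorder (chi n m) a \<le> max 0 (zorder (chi (fst (n, m)) (snd (n, m))) a)" by simp
      also have "\<dots> \<le> ?S" using le mn
        by (intro member_le_sum[where f = "\<lambda>p. max 0 (zorder (chi (fst p) (snd p)) a)"]) auto
      finally have "1 \<le> ?S" .
      moreover have "support (cross f) a = 1" using True by (simp add: support_def)
      ultimately show ?thesis using exc_nonneg[of a] by linarith
    next
      case False
      then have "6 \<le> m + n" using mn by linarith
      then have "6 \<le> \<bar>zorder (cross f) a\<bar> + \<bar>zorder (cross g) a\<bar>" by (simp add: m_def n_def)
      then show ?thesis using S0 exc_nonneg[of a] by (simp add: support_def)
    qed
  next
    case False
    then show ?thesis using S0 exc_nonneg[of a] by (auto simp: support_def)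
  qed
qed

theorem contradiction:
  assumes alt: "\<And>n m. n \<le> 4 \<Longrightarrow> m \<le> 4 \<Longrightarrow> unit_off B (w n m) \<or> (\<forall>z. z \<notin> B \<longrightarrow> w n m z = 0)"
  shows False
proof -
  have wu: "unit_off B (w n m)" if "n \<le> 4" "m \<le> 4" "0 < n \<or> 0 < m" for n m
    using alt[OF that(1,2)] w_zero_False[OF that(3)] by blast
  have w: "unit_off B (w n m)" if "n \<in> {1..4}" "m \<in> {1..4}" for n m using wu[of n m] that by auto
  have "w 1 0 = ld (cross f)" by (simp add: w_def fun_eq_iff)
  then have q: "unit_off B (ld (cross f))" using wu[of 1 0] by simp
  let ?P = "{1..4::nat} \<times> {1..4::nat}"
  define kf kg where "kf = circle_mean (\<lambda>z. ln (norm (cross f z))) r0" and "kg = circle_mean (\<lambda>z. ln (norm (cross g z))) r0"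
  define N where "N = (\<lambda>k. \<Sum>p\<in>?P. counting (\<lambda>a. max 0 (zorder (chi (fst p) (snd p)) a)) (X k))"
  have N: "negl N" unfolding N_def
    by (rule negl_sum) (use negl_zeros_chi w in auto)
  have le: "6 * counting (support (cross f)) (X k) \<le> 6 * counting exc (X k) + 6 * N k
      + ((2 * T (cross f) (X k) - kf) + (2 * T (cross g) (X k) - kg))" for k
  proof -
    have "6 * counting (support (cross f)) (X k) = counting (\<lambda>a. 6 * support (cross f) a) (X k)"
      by (simp add: counting_cmult)
    also have "\<dots> \<le> counting (\<lambda>a. 6 * exc a + 6 * (\<Sum>p\<in>?P. max 0 (zorder (chi (fst p) (snd p)) a))
     + (\<bar>zorder (cross f) a\<bar> + \<bar>zorder (cross g) a\<bar>)) (X k)"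
      using good_X[of k] by (intro counting_mono counting_pointwise w) (auto simp: good_def)
    also have "\<dots> = 6 * counting exc (X k) + 6 * N k + (counting (\<lambda>a. \<bar>zorder (cross f) a\<bar>) (X k) + counting (\<lambda>a. \<bar>zorder (cross g) a\<bar>) (X k))"
      by (simp only: counting_add counting_cmult counting_sum N_def of_int_numeral)
    finally show ?thesis
      using counting_abs_zorder_le[OF Uu good_X, of k] counting_abs_zorder_le[OF Vu good_X, of k] by (simp add: kf_def kg_def)
  qed
  have n6: "negl (\<lambda>k. 6 * (T0 k - counting (support (cross f)) (X k)))"
    by (rule negl_cmult[OF _ second_main[OF q]]) simp
  have e6: "negl (\<lambda>k. 6 * counting exc (X k))" by (rule negl_cmult[OF _ negl_exc]) simp
  have N6: "negl (\<lambda>k. 6 * N k)" by (rule negl_cmult[OF _ N]) simp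
  have U2: "negl (\<lambda>k. 2 * (T (cross f) (X k) - T0 k))" by (rule negl_cmult[OF _ T_cross_asymp(1)[OF admissible_f]]) simp
  have V2: "negl (\<lambda>k. 2 * (T (cross g) (X k) - T0 k))" by (rule negl_cmult[OF _ T_cross_asymp(1)[OF admissible_g]]) simp
  \<comment> \<open>Of the \<open>6 * T0\<close> on the left the two characteristics account for
    \<open>4 * T0\<close>; what remains is \<open>2 * T0\<close>.\<close>
  have "negl (\<lambda>k. 2 * T0 k)"
  proof (rule negl_mono[OF negl_add[OF n6 negl_add[OF e6 negl_add[OF N6 negl_add[OF U2 negl_add[OF V2 negl_const[of "- kf - kg"]]]]]]])
    fix k
    show "2 * T0 k \<le> 6 * (T0 k - counting (support (cross f)) (X k)) + (6 * counting exc (X k) + (6 * N k +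
      (2 * (T (cross f) (X k) - T0 k) + (2 * (T (cross g) (X k) - T0 k) + (- kf - kg)))))"
      using le[of k] by (simp add: algebra_simps)
  qed
  then show False using negl_T0_cmult[of 2] by simp
qed

end

subsection \<open>The choice of radii\<close>

text \<open>An interval longer than the measure of \<open>E\<close> is not covered by
  \<open>E\<close> and a null set. This turns exceptional sets of finite measure and countably many
  bad radii into a bounded gap between admissible radii.\<close>

lemma avoid_measure:
  fixes x y :: real
  assumes E: "E \<in> lmeasurable" and N: "countable N" and xy: "x + measure lebesgue E < y"
  shows "\<exists>r. x \<le> r \<and> r \<le> y \<and> r \<notin> E \<and> r \<notin> N"
proof (rule ccontr)
  assume "\<not> ?thesis"
  then have sub: "{x..y} \<subseteq> E \<union> N" by auto
  have N': "N \<in> lmeasurable" "measure lebesgue N = 0"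
    using null_sets_completionI[OF countable_imp_null_set_lborel[OF N]]
    by (auto simp: negligible_iff_null_sets[symmetric] negligible_iff_measure)
  have "measure lebesgue {x..y} \<le> measure lebesgue (E \<union> N)"
    by (rule measure_mono_fmeasurable[OF sub]) (use E N' in auto)
  also have "\<dots> \<le> measure lebesgue E + measure lebesgue N"
    by (rule measure_Un_le) (use E N' in auto)
  finally have "y - x \<le> measure lebesgue E" using N' xy measure_nonneg[of lebesgue E] by simp
  then show False using xy by simp
qed

text \<open>The contribution of one pole at distance \<open>s\<close> to the integrated counting
  function: a unit jump at \<open>s\<close>, integrated against \<open>dt / t\<close>.\<close>

lemma has_integral_recip_from:
  fixes s r :: real
  assumes "0 < s" "s \<le> r"
  shows "((\<lambda>t. if s \<le> t then 1 / t else 0) has_integral (ln r - ln s)) {0..r}"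
proof -
  have "((\<lambda>t. 1 / t) has_integral (ln r - ln s)) {s..r}"
    using assms by (intro fundamental_theorem_of_calculus)
      (auto intro!: derivative_eq_intros simp: has_real_derivative_iff_has_vector_derivative[symmetric])
  then have "((\<lambda>t. if t \<in> {s..r} then 1 / t else 0) has_integral (ln r - ln s)) {0..r}"
    using assms by (subst has_integral_restrict) auto
  then show ?thesis by (rule has_integral_eq[rotated]) auto
qed

text \<open>The first case allows \<open>B\<close> to be fixed before it is known which of the functions vanish
  identically.\<close>

definition exceptional_set :: "(complex \<Rightarrow> complex) \<Rightarrow> complex set" where
  "exceptional_set h = (if \<forall>\<^sub>\<approx>z\<in>UNIV. h z = 0 then {z. h z \<noteq> 0} else {z. \<not> (h analytic_on {z} \<and> h z \<noteq> 0)})"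

lemma exceptional_set_sparse:
  assumes h: "h meromorphic_on UNIV"
  shows "exceptional_set h sparse_in UNIV"
proof (cases "\<forall>\<^sub>\<approx>z\<in>UNIV. h z = 0")
  case True
  then show ?thesis by (simp add: exceptional_set_def eventually_cosparse)
next
  case False
  then have "\<forall>\<^sub>\<approx>z\<in>UNIV. h z \<noteq> 0"
    using meromorphic_imp_constant_or_avoid[OF h, of 0] convex_connected[OF convex_UNIV] by auto
  then have "\<forall>\<^sub>\<approx>z\<in>UNIV. h analytic_on {z} \<and> h z \<noteq> 0"
    using meromorphic_on_imp_analytic_cosparse[OF h] by eventually_elim simp
  then show ?thesis using False by (simp add: exceptional_set_def eventually_cosparse)
qed

lemma exceptional_set_unit:
  assumes "h meromorphic_on UNIV" "exceptional_set h \<subseteq> B" "\<not> (\<forall>\<^sub>\<approx>z\<in>UNIV. h z = 0)"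
  shows "unit_off B h"
  using assms by (auto simp: exceptional_set_def unit_off_def regular_off_def)

lemma exceptional_set_zero: "exceptional_set h \<subseteq> B \<Longrightarrow> \<forall>\<^sub>\<approx>z\<in>UNIV. h z = 0 \<Longrightarrow> z \<notin> B \<Longrightarrow> h z = 0"
  by (auto simp: exceptional_set_def)

text \<open>Both functions have the value 0 at poles and equal their limit elsewhere, and poles and
  limits are determined by a punctured neighbourhood.\<close>

lemma nicely_meromorphic_eqI:
  assumes a: "a nicely_meromorphic_on UNIV" and b: "b nicely_meromorphic_on UNIV"
    and eq: "\<forall>\<^sub>\<approx>z\<in>UNIV. a z = b z"
  shows "a = b"
proof
  fix z
  have ev: "\<forall>\<^sub>F w in at z. a w = b w" using eventually_cosparse_imp_eventually_at[OF eq, of z UNIV] by simp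
  have pole: "is_pole a z \<longleftrightarrow> is_pole b z"
    unfolding is_pole_def by (rule filterlim_cong[OF refl refl ev])
  show "a z = b z"
  proof (cases "is_pole a z")
    case True
    then show ?thesis using a b pole unfolding nicely_meromorphic_on_def
      by (metis UNIV_I is_pole_def not_tendsto_and_filterlim_at_infinity trivial_limit_at)
  next
    case False
    then have "a \<midarrow>z\<rightarrow> a z" "b \<midarrow>z\<rightarrow> b z" using a b pole unfolding nicely_meromorphic_on_def by auto
    moreover from this(1) have "b \<midarrow>z\<rightarrow> a z" using tendsto_cong[OF ev] by blast
    ultimately show ?thesis by (blast intro: LIM_unique)
  qed
qed

section \<open>Entire functions and comparison with the standard characteristic\<close>

lemma entire_nicely: "h holomorphic_on UNIV \<Longrightarrow> h nicely_meromorphic_on UNIV"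
  by (rule analytic_on_imp_nicely_meromorphic_on) (simp add: analytic_on_open)

lemma entire_mero: "h holomorphic_on UNIV \<Longrightarrow> h meromorphic_on UNIV"
  using entire_nicely by (simp add: nicely_meromorphic_on_def)

lemma entire_no_pole: "h holomorphic_on UNIV \<Longrightarrow> \<not> is_pole h z"
  using not_is_pole_holomorphic[of UNIV z h] by simp

lemma nevanlinna_char_entire:
  assumes "h holomorphic_on UNIV"
  shows "nevanlinna_char h r = proximity_fun h r"
proof -
  have "pole_count h t = 0" for t
    using entire_no_pole[OF assms] by (simp add: pole_count_def)
  then show ?thesis by (simp add: nevanlinna_char_def integrated_pole_count_def)
qed

lemma exists_divisor:
  assumes "B sparse_in UNIV"
  shows "\<exists>r0. divisor B r0"
proof -
  have "countable (norm ` B)" using sparse_imp_countable[OF open_UNIV assms] by simp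
  from avoid_measure[OF _ this, of "{}" 1 2]
  obtain r where "1 \<le> r" "r \<notin> norm ` B" by auto
  then have "divisor B r" using assms by unfold_locales auto
  then show ?thesis ..
qed

context divisor begin

text \<open>Subtracting \<open>f 0\<close> creates a zero at the origin, whose weight alone is
  \<open>ln r - ln r0\<close>; Jensen's formula turns this into logarithmic growth.\<close>

lemma prox_lower:
  assumes f: "f holomorphic_on UNIV" and u: "unit_off B (\<lambda>z. f z - f 0)"
  shows "\<exists>C. \<forall>r. good r \<longrightarrow> ln r - C \<le> proximity_fun f r"
proof -
  let ?h = "\<lambda>z. f z - f 0"
  have "?h holomorphic_on UNIV" by (intro holomorphic_intros f)
  then have han: "?h analytic_on {a}" for a
    using analytic_on_subset[of ?h UNIV "{a}"] by (auto simp: analytic_on_open)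
  have freg: "regular_off B f"
    using entire_mero[OF f] f analytic_on_subset[of f UNIV] by (auto simp: regular_off_def analytic_on_open)
  have z: "0 \<le> zorder ?h a" for a using zorder_ge_0[OF han frequently_nonzero[OF u]] .
  have z0: "0 < zorder ?h 0" using zorder_pos_iff'[OF han frequently_nonzero[OF u]] by simp
  then have B0: "0 \<in> B" using zorder_unit_off[OF u, of 0] by auto
  define J where "J = circle_mean (\<lambda>z. ln (norm (?h z))) r0"
  have "ln r - (ln r0 - J + log_plus (f 0) + ln 2) \<le> proximity_fun f r" if r: "good r" for r
  proof -
    have rr: "0 < r" "r0 \<le> r" "0 < r0" using good_pos[OF r] r r0 by (auto simp: good_def)
    have "weight r 0 = (\<Sum>a\<in>B \<inter> ball 0 r. of_int (if a = 0 then 1 else 0) * weight r a)"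
      using B0 rr by (subst sum.remove[of _ 0]) auto
    also have "\<dots> = counting (\<lambda>a. if a = 0 then 1 else 0) r" by (simp add: counting_def)
    also have "\<dots> \<le> counting (zorder ?h) r"
      using z z0 rr by (intro counting_mono) auto
    finally have "ln r - ln r0 \<le> counting (zorder ?h) r"
      using rr by (simp add: weight_def max_def ln_div)
    moreover have "circle_mean (\<lambda>z. ln (norm (?h z))) r = J + counting (zorder ?h) r"
      unfolding J_def by (rule jensen[OF u r])
    moreover have "circle_mean (\<lambda>z. ln (norm (?h z))) r \<le> proximity_fun ?h r"
      unfolding proximity_eq_circle_mean
    proof (rule circle_mean_mono)
      show "continuous_on (sphere 0 r) (\<lambda>z. ln (norm (?h z)))"
        using r by (intro continuous_on_ln_norm_unit[OF u]) (auto simp: good_def)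
      show "continuous_on (sphere 0 r) (\<lambda>z. log_plus (?h z))" by (rule regular_cont_log_plus[OF unit_off_imp_regular[OF u] r])
      show "ln (norm (?h z)) \<le> log_plus (?h z)" if "norm z = r" for z
        using unit_off_nonzero[OF u good_notin[OF r that]] unfolding log_plus_def by (subst ln_le_cancel_iff) auto
    qed (use rr in simp)
    moreover have "proximity_fun ?h r \<le> proximity_fun f r + proximity_fun (\<lambda>_. f 0) r + ln 2"
      by (intro prox_diff freg regular_off_const r unit_off_imp_regular[OF u] refl)
    ultimately show ?thesis by (simp add: prox_one)
  qed
  then show ?thesis by blast
qed

text \<open>Integrating pole by pole gives the weight \<open>ln (r / norm z)\<close>, and
  \<open>ln r\<close> at the origin. The weights based at \<open>r0\<close> are no larger; at the
  origin this is \<open>r0 \<ge> 1\<close>.\<close>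

lemma counting_pole_le_integrated:
  assumes a: "regular_off B a" and r: "good r"
  shows "counting (pole_mult a) r \<le> integrated_pole_count a r"
proof -
  have rr: "0 < r" "r0 \<le> r" "1 \<le> r0" using good_pos[OF r] r r0 by (auto simp: good_def)
  have am: "a meromorphic_on UNIV" using a by (simp add: regular_off_def)
  have polB: "z \<in> B" if "is_pole a z" for z
    using that pole_mult_analytic[of a z] pole_mult_pos[OF am that] a by (auto simp: regular_off_def)
  define P where "P = {z. is_pole a z \<and> norm z \<le> r}"
  define p where "p = (\<lambda>z. real (nat (- zorder a z)))"
  have pm: "of_int (pole_mult a z) = p z" if "is_pole a z" for z
    using pole_mult_pos[OF am that] that by (simp add: pole_mult_def p_def)
  have PB: "P = {z \<in> B \<inter> ball 0 r. is_pole a z}"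
    unfolding P_def using polB good_notin[OF r] by force
  then have "P \<subseteq> B \<inter> ball 0 r" by blast
  then have finP: "finite P" by (rule finite_subset) (rule finite_B)
  have pc: "real (pole_count a t) = (\<Sum>z\<in>P. if norm z \<le> t then p z else 0)" if "t \<le> r" for t
  proof -
    have "{z. is_pole a z \<and> norm z \<le> t} = {z \<in> P. norm z \<le> t}" using that by (auto simp: P_def)
    then show ?thesis using finP by (auto simp: pole_count_def p_def sum.inter_filter intro!: sum.cong)
  qed
  have pc0: "real (pole_count a 0) = (\<Sum>z\<in>P. if z = 0 then p z else 0)"
    using pc[of 0] rr by simp
  define P' where "P' = P - {0}"
  have "((\<lambda>t. \<Sum>z\<in>P'. p z * (if norm z \<le> t then 1 / t else 0)) has_integral (\<Sum>z\<in>P'. p z * (ln r - ln (norm z)))) {0..r}"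
    using finP by (intro has_integral_sum has_integral_mult_right has_integral_recip_from) (auto simp: P'_def P_def)
  then have "((\<lambda>t. (real (pole_count a t) - real (pole_count a 0)) / t) has_integral (\<Sum>z\<in>P'. p z * (ln r - ln (norm z)))) {0..r}"
  proof (rule has_integral_eq[rotated])
    fix t assume t: "t \<in> {0..r}"
    have "real (pole_count a t) - real (pole_count a 0)
      = (\<Sum>z\<in>P. (if norm z \<le> t then p z else 0) - (if z = 0 then p z else 0))"
      using t by (simp add: pc pc0 sum_subtractf)
    also have "\<dots> = (\<Sum>z\<in>P'. if norm z \<le> t then p z else 0)"
      unfolding P'_def using finP t by (intro sum.mono_neutral_cong_right) auto
    finally show "(\<Sum>z\<in>P'. p z * (if norm z \<le> t then 1 / t else 0)) = (real (pole_count a t) - real (pole_count a 0)) / t"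
      by (auto simp: sum_divide_distrib intro!: sum.cong)
  qed
  then have int: "integrated_pole_count a r = (\<Sum>z\<in>P'. p z * (ln r - ln (norm z))) + (\<Sum>z\<in>P. if z = 0 then p z else 0) * ln r"
    by (simp add: integrated_pole_count_def integral_unique pc0)
  have "counting (pole_mult a) r = (\<Sum>z\<in>P. of_int (pole_mult a z) * weight r z)"
    unfolding counting_def PB by (intro sum.mono_neutral_right) (auto simp: pole_mult_def)
  also have "\<dots> = (\<Sum>z\<in>P. p z * weight r z)"
    by (intro sum.cong) (auto simp: pm P_def)
  also have "\<dots> \<le> (\<Sum>z\<in>P. p z * (if z = 0 then ln r else ln r - ln (norm z)))"
  proof (intro sum_mono mult_left_mono)
    fix z :: complex
    have "ln (norm z) \<le> ln (max r0 (norm z))" if "z \<noteq> 0" using that rr by (subst ln_le_cancel_iff) (auto simp: max_def)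
    moreover have "0 \<le> ln (max r0 (norm z))" using rr by (intro ln_ge_zero) auto
    moreover have "weight r z = ln r - ln (max r0 (norm z))" 
    proof -
      have "0 < max r0 (norm z)" using rr by linarith
      then show ?thesis using rr by (simp add: weight_def ln_div)
    qed
    ultimately show "weight r z \<le> (if z = 0 then ln r else ln r - ln (norm z))" by auto
  qed (simp add: p_def)
  also have "\<dots> = integrated_pole_count a r"
  proof (cases "0 \<in> P")
    case True
    then show ?thesis unfolding int P'_def using finP by (simp add: sum.remove[of P 0])
  next
    case False
    then have "P' = P" by (simp add: P'_def)
    moreover have "(\<Sum>z\<in>P. if z = 0 then p z else 0) = 0" using False by (intro sum.neutral) auto
    ultimately show ?thesis unfolding int using False by (auto intro!: sum.cong)
  qed
  finally show ?thesis .
qed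

lemma Tm_le_char: "regular_off B a \<Longrightarrow> good r \<Longrightarrow> Tm a r \<le> nevanlinna_char a r"
  using counting_pole_le_integrated by (simp add: Tm_def nevanlinna_char_def)

end

section \<open>Unfolding the growth hypotheses\<close>

lemma small_functionsD:
  assumes "a \<in> small_functions f"
  obtains E where "a nicely_meromorphic_on UNIV" "E \<in> lmeasurable"
    "\<And>\<epsilon>. 0 < \<epsilon> \<Longrightarrow> \<exists>\<rho>. \<forall>r\<ge>\<rho>. r \<notin> E \<longrightarrow> \<bar>nevanlinna_char a r\<bar> \<le> \<epsilon> * \<bar>nevanlinna_char f r\<bar>"
proof -
  obtain E where E: "a nicely_meromorphic_on UNIV" "E \<in> lmeasurable"
    "nevanlinna_char a \<in> o[inf at_top (principal (- E))](nevanlinna_char f)"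
    using assms by (auto simp: small_functions_def)
  have "\<exists>\<rho>. \<forall>r\<ge>\<rho>. r \<notin> E \<longrightarrow> \<bar>nevanlinna_char a r\<bar> \<le> \<epsilon> * \<bar>nevanlinna_char f r\<bar>" if "0 < \<epsilon>" for \<epsilon>
    using landau_o.smallD[OF E(3) that]
    by (auto simp: eventually_inf_principal eventually_at_top_linorder)
  then show ?thesis using E that by blast
qed

text \<open>Logarithmic growth makes the characteristic at least 1 at some large radius outside the
  exceptional set, which contradicts \<open>T \<le> T / 2\<close>. This guarantees that
  \<open>f\<close> differs from both targets.\<close>

lemma nonconstant_entire_not_small:
  assumes f: "f holomorphic_on UNIV" "\<not> f constant_on UNIV"
  shows "f \<notin> small_functions f"
proof
  assume small: "f \<in> small_functions f"
  obtain E where E: "E \<in> lmeasurable"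
    "\<And>\<epsilon>. 0 < \<epsilon> \<Longrightarrow> \<exists>\<rho>. \<forall>r\<ge>\<rho>. r \<notin> E \<longrightarrow> \<bar>nevanlinna_char f r\<bar> \<le> \<epsilon> * \<bar>nevanlinna_char f r\<bar>"
    by (rule small_functionsD[OF small], rule that)
  let ?h = "\<lambda>z. f z - f 0"
  have h: "?h holomorphic_on UNIV" using f by (intro holomorphic_intros)
  have nz: "\<not> (\<forall>\<^sub>\<approx>z\<in>UNIV. ?h z = 0)"
  proof
    assume "\<forall>\<^sub>\<approx>z\<in>UNIV. ?h z = 0"
    then have "f = (\<lambda>_. f 0)"
      by (intro nicely_meromorphic_eqI entire_nicely f) auto
    then show False using f(2) by (metis constant_on_def)
  qed
  have "exceptional_set ?h sparse_in UNIV" by (rule exceptional_set_sparse[OF entire_mero[OF h]])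
  from exists_divisor[OF this] obtain r0 where "divisor (exceptional_set ?h) r0" ..
  then interpret divisor "exceptional_set ?h" r0 .
  obtain C where C: "\<And>r. good r \<Longrightarrow> ln r - C \<le> proximity_fun f r"
    using prox_lower[OF f(1) exceptional_set_unit[OF entire_mero[OF h] order_refl nz]] by blast
  obtain \<rho> where \<rho>: "\<And>r. \<rho> \<le> r \<Longrightarrow> r \<notin> E \<Longrightarrow> \<bar>nevanlinna_char f r\<bar> \<le> 1 / 2 * \<bar>nevanlinna_char f r\<bar>"
    using E(2)[of "1 / 2"] by auto
  define x where "x = max (max \<rho> r0) (exp (C + 1))"
  have "countable (norm ` exceptional_set ?h)" using sparse_imp_countable[OF open_UNIV sparse] by simp
  from avoid_measure[OF E(1) this, of x "x + measure lebesgue E + 1"]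
  obtain r where r: "x \<le> r" "r \<notin> E" "r \<notin> norm ` exceptional_set ?h" by auto
  have "good r" using r by (auto simp: good_def x_def)
  then have "ln r - C \<le> proximity_fun f r" by (rule C)
  moreover have "C + 1 \<le> ln r" using r(1) by (intro ln_ge_iff[THEN iffD2]) (auto simp: x_def intro: less_le_trans[OF exp_gt_zero])
  ultimately have "1 \<le> nevanlinna_char f r" unfolding nevanlinna_char_entire[OF f(1)] by linarith
  then show False using \<rho>[of r] r by (auto simp: x_def)
qed

lemma hyper_order_less_one:
  assumes "hyper_order f < 1"
  obtains \<zeta> \<rho> where "0 < \<zeta>" "\<zeta> < 1" "\<And>r. \<rho> \<le> r \<Longrightarrow> nevanlinna_char f r \<le> exp (r powr \<zeta>)"
proof -
  obtain y where y: "hyper_order f < ereal y" "ereal y < 1"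
    using assms ereal_dense2[of "hyper_order f" 1] by blast
  \<comment> \<open>\<open>y\<close> may be negative; the maximum with \<open>1 / 2\<close> makes
    the exponent positive and keeps it below 1.\<close>
  define \<zeta> where "\<zeta> = max y (1 / 2)"
  have \<zeta>: "0 < \<zeta>" "\<zeta> < 1" using y by (auto simp: \<zeta>_def)
  have "\<forall>\<^sub>F r in at_top. ereal (ln (ln (nevanlinna_char f r)) / ln r) < ereal y"
    using y(1) unfolding hyper_order_def by (rule Limsup_lessD)
  then have "\<forall>\<^sub>F r in at_top. nevanlinna_char f r \<le> exp (r powr \<zeta>)"
    using eventually_gt_at_top[of 1]
  proof eventually_elim
    case (elim r)
    show ?case
    \<comment> \<open>Up to \<open>exp 1\<close> the iterated logarithm may be applied to a
      nonpositive number and carries no information, but there the bound is trivial.\<close>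
    proof (cases "nevanlinna_char f r \<le> exp 1")
      case True
      also have "exp 1 \<le> exp (r powr \<zeta>)" using elim \<zeta> by (simp add: ge_one_powr_ge_zero)
      finally show ?thesis .
    next
      case False
      define t where "t = nevanlinna_char f r"
      have t: "exp 1 < t" using False by (simp add: t_def)
      then have t0: "0 < t" using exp_gt_zero[of 1] by linarith
      have l1: "1 < ln t" using t t0 by (metis exp_gt_zero ln_exp ln_less_cancel_iff)
      have lr: "0 < ln r" using elim by simp
      have "ln (ln t) / ln r < y" using elim by (simp add: t_def)
      then have "ln (ln t) < y * ln r" using lr by (simp add: pos_divide_less_eq)
      also have "\<dots> \<le> \<zeta> * ln r" using lr by (intro mult_right_mono) (auto simp: \<zeta>_def)
      also have "\<dots> = ln (r powr \<zeta>)" using elim by (simp add: ln_powr)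
      finally have "ln t < r powr \<zeta>" using l1 elim by (subst (asm) ln_less_cancel_iff) auto
      then have "t < exp (r powr \<zeta>)" using t0 by (metis exp_less_mono exp_ln)
      then show ?thesis by (simp add: t_def)
    qed
  qed
  then show ?thesis using \<zeta> that by (auto simp: eventually_at_top_linorder)
qed

text \<open>Expresses identical vanishing through the zero set, so that sharing transfers it between
  \<open>f - a\<close> and \<open>g - a\<close>.\<close>

lemma mero_zeros_UNIV_iff:
  assumes "h meromorphic_on UNIV"
  shows "mero_zeros h = UNIV \<longleftrightarrow> (\<forall>\<^sub>\<approx>z\<in>UNIV. h z = 0)"
proof
  assume U: "mero_zeros h = UNIV"
  show "\<forall>\<^sub>\<approx>z\<in>UNIV. h z = 0"
    using meromorphic_on_imp_analytic_cosparse[OF assms]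
  proof eventually_elim
    case (elim z)
    have "h \<midarrow>z\<rightarrow> 0" using U by (auto simp: mero_zeros_def)
    moreover have "h \<midarrow>z\<rightarrow> h z" using analytic_at_imp_isCont[OF elim] by (simp add: isCont_def)
    ultimately show ?case by (metis LIM_unique)
  qed
next
  assume e: "\<forall>\<^sub>\<approx>z\<in>UNIV. h z = 0"
  have "h \<midarrow>z\<rightarrow> 0" for z
    using eventually_cosparse_imp_eventually_at[OF e, of z UNIV] tendsto_eventually by auto
  then show "mero_zeros h = UNIV" by (auto simp: mero_zeros_def)
qed

lemma entire_zero_if_ae_zero:
  assumes "h holomorphic_on UNIV" "\<forall>\<^sub>\<approx>z\<in>UNIV. h z = 0"
  shows "h z = 0"
proof -
  have "h = (\<lambda>_. 0)"
    by (intro nicely_meromorphic_eqI entire_nicely assms holomorphic_on_const)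
  then show ?thesis by metis
qed

theorem shared_small_functions_imp_periodic:
  fixes f a1 a2 :: "complex \<Rightarrow> complex" and c :: complex
  assumes f: "f holomorphic_on UNIV" and nc: "\<not> f constant_on UNIV"
    and ho: "hyper_order f < 1"
    and a1: "a1 \<in> small_functions f" and a2: "a2 \<in> small_functions f"
    and ne: "a1 \<noteq> a2"
    and s1: "share_IM f (\<lambda>z. f (z + c)) a1" and s2: "share_IM f (\<lambda>z. f (z + c)) a2"
  shows "\<forall>z. f z = f (z + c)"
proof (rule ccontr)
  assume neg: "\<not> ?thesis"
  define g where "g = (\<lambda>z. f (z + c))"
  have g: "g holomorphic_on UNIV"
  proof -
    have "(f \<circ> (\<lambda>z. z + c)) holomorphic_on UNIV"
      by (rule holomorphic_on_compose[OF _ holomorphic_on_subset[OF f]]) (auto intro!: holomorphic_intros)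
    then show ?thesis by (simp add: o_def g_def)
  qed
  obtain E1 where E1: "a1 nicely_meromorphic_on UNIV" "E1 \<in> lmeasurable"
    "\<And>\<epsilon>. 0 < \<epsilon> \<Longrightarrow> \<exists>\<rho>. \<forall>r\<ge>\<rho>. r \<notin> E1 \<longrightarrow> \<bar>nevanlinna_char a1 r\<bar> \<le> \<epsilon> * \<bar>nevanlinna_char f r\<bar>"
    by (rule small_functionsD[OF a1], rule that)
  obtain E2 where E2: "a2 nicely_meromorphic_on UNIV" "E2 \<in> lmeasurable"
    "\<And>\<epsilon>. 0 < \<epsilon> \<Longrightarrow> \<exists>\<rho>. \<forall>r\<ge>\<rho>. r \<notin> E2 \<longrightarrow> \<bar>nevanlinna_char a2 r\<bar> \<le> \<epsilon> * \<bar>nevanlinna_char f r\<bar>"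
    by (rule small_functionsD[OF a2], rule that)
  have fm: "f meromorphic_on UNIV" and gm: "g meromorphic_on UNIV" using f g by (auto intro: entire_mero)
  have am: "a1 meromorphic_on UNIV" "a2 meromorphic_on UNIV" using E1 E2 by (auto simp: nicely_meromorphic_on_def)

  have n_f: "\<not> (\<forall>\<^sub>\<approx>z\<in>UNIV. f z = 0)"
  proof
    assume "\<forall>\<^sub>\<approx>z\<in>UNIV. f z = 0"
    then have "f z = 0" for z by (rule entire_zero_if_ae_zero[OF f])
    then show False using nc by (auto simp: constant_on_def)
  qed
  have n_g: "\<not> (\<forall>\<^sub>\<approx>z\<in>UNIV. g z = 0)"
  proof
    assume "\<forall>\<^sub>\<approx>z\<in>UNIV. g z = 0"
    then have "g (z - c) = 0" for z by (rule entire_zero_if_ae_zero[OF g])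
    then have "f z = 0" for z by (simp add: g_def)
    then show False using nc by (auto simp: constant_on_def)
  qed
  have n_p: "\<not> (\<forall>\<^sub>\<approx>z\<in>UNIV. f z - g z = 0)"
  proof
    assume *: "\<forall>\<^sub>\<approx>z\<in>UNIV. f z - g z = 0"
    have "(\<lambda>z. f z - g z) holomorphic_on UNIV" by (intro holomorphic_intros f g)
    then have "f z - g z = 0" for z using * by (rule entire_zero_if_ae_zero)
    then show False using neg by (simp add: g_def)
  qed
  have n_d: "\<not> (\<forall>\<^sub>\<approx>z\<in>UNIV. a2 z - a1 z = 0)"
  proof
    assume "\<forall>\<^sub>\<approx>z\<in>UNIV. a2 z - a1 z = 0"
    then have "a2 = a1" by (intro nicely_meromorphic_eqI E1 E2) simp
    then show False using ne by simp
  qed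
  have n_fa: "\<not> (\<forall>\<^sub>\<approx>z\<in>UNIV. f z - a z = 0)" if a: "a \<in> small_functions f" for a
  proof
    assume "\<forall>\<^sub>\<approx>z\<in>UNIV. f z - a z = 0"
    then have "\<forall>\<^sub>\<approx>z\<in>UNIV. f z = a z" by simp
    moreover have "a nicely_meromorphic_on UNIV" using a by (simp add: small_functions_def)
    ultimately have "f = a" using nicely_meromorphic_eqI[OF entire_nicely[OF f]] by blast
    then show False using nonconstant_entire_not_small[OF f nc] a by simp
  qed
  have n_ga: "\<not> (\<forall>\<^sub>\<approx>z\<in>UNIV. g z - a z = 0)"
    if a: "a \<in> small_functions f" and s: "share_IM f g a" for a
  proof -
    have "a meromorphic_on UNIV" using a by (simp add: small_functions_def nicely_meromorphic_on_def)
    then have m: "(\<lambda>z. f z - a z) meromorphic_on UNIV" "(\<lambda>z. g z - a z) meromorphic_on UNIV"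
      by (auto intro!: meromorphic_intros fm gm)
    show ?thesis
      using n_fa[OF a] s unfolding mero_zeros_UNIV_iff[OF m(1), symmetric] mero_zeros_UNIV_iff[OF m(2), symmetric] share_IM_def
      by simp
  qed

  define U V where "U = (\<lambda>z. (f z - a2 z) / (f z - a1 z))" and "V = (\<lambda>z. (g z - a2 z) / (g z - a1 z))"
  \<comment> \<open>\<open>W\<close> has to be available before \<open>B\<close>, because
    \<open>B\<close> must contain its exceptional set; it is identified with \<open>w\<close> once
    the locale is interpreted.\<close>
  define W where "W = (\<lambda>(n::nat, m::nat) z. of_nat n * (deriv U z / U z) - of_nat m * (deriv V z / V z))"
  \<comment> \<open>The entry \<open>f z - f 0\<close> is there for the lower growth bound
    \<open>prox_lower\<close>.\<close>
  define HS where "HS = {f, g, \<lambda>z. f z - g z, \<lambda>z. a2 z - a1 z, \<lambda>z. f z - a1 z, \<lambda>z. f z - a2 z, \<lambda>z. g z - a1 z, \<lambda>z. g z - a2 z,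
      \<lambda>z. f z - f 0} \<union> W ` ({..4} \<times> {..4})"
  define B where "B = (\<Union>h\<in>HS. exceptional_set h) \<union> ({z. \<not> a1 analytic_on {z}} \<union> {z. \<not> a2 analytic_on {z}})"
  have Um: "U meromorphic_on UNIV" and Vm: "V meromorphic_on UNIV"
    unfolding U_def V_def by (intro meromorphic_intros fm gm am)+
  have HSm: "h meromorphic_on UNIV" if "h \<in> HS" for h
    using that unfolding HS_def W_def
    by (auto intro!: meromorphic_intros fm gm am Um Vm)
  have sparse: "B sparse_in UNIV"
  proof -
    have "finite HS" by (simp add: HS_def)
    then have "(\<Union>h\<in>HS. exceptional_set h) sparse_in UNIV" by (intro sparse_in_UN_finite exceptional_set_sparse HSm)
    then show ?thesis unfolding B_def by (intro sparse_in_union' meromorphic_on_imp_sparse_singularities am)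
  qed
  then obtain r0 where "divisor B r0" using exists_divisor by blast
  then interpret D: divisor B r0 .
  have ex: "exceptional_set h \<subseteq> B" if "h \<in> HS" for h using that by (auto simp: B_def)
  have unit: "unit_off B h" if "h \<in> HS" "\<not> (\<forall>\<^sub>\<approx>z\<in>UNIV. h z = 0)" for h
    using exceptional_set_unit[OF HSm ex] that by blast

  obtain \<zeta> \<rho> where \<zeta>: "0 < \<zeta>" "\<zeta> < 1" "\<And>r. \<rho> \<le> r \<Longrightarrow> nevanlinna_char f r \<le> exp (r powr \<zeta>)"
    by (rule hyper_order_less_one[OF ho], rule that)
  define E where "E = E1 \<union> E2"
  have E: "E \<in> lmeasurable" using E1 E2 by (simp add: E_def fmeasurable.Un)
  \<comment> \<open>Avoiding the norms of \<open>b\<close> and of \<open>b - c\<close> keeps both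
    the circle and its translate by \<open>c\<close> off \<open>B\<close>.\<close>
  define N where "N = norm ` B \<union> norm ` ((\<lambda>b. b - c) ` B)"
  have "countable B" using sparse_imp_countable[OF open_UNIV sparse] by simp
  then have N: "countable N" by (simp add: N_def)
  define \<Gamma> where "\<Gamma> = {r. r0 \<le> r \<and> r \<notin> E \<and> r \<notin> N}"
  \<comment> \<open>The added 1 makes the inequality required by \<open>avoid_measure\<close>
    strict.\<close>
  define gap where "gap = measure lebesgue E + 1"
  have \<Gamma>_good: "D.good r" if "r \<in> \<Gamma>" for r
    using that by (auto simp: \<Gamma>_def N_def D.good_def)
  have \<Gamma>_dense: "\<exists>r\<in>\<Gamma>. x \<le> r \<and> r \<le> y" if "r0 \<le> x" "x + gap \<le> y" for x y
  proof -
    have "x + measure lebesgue E < y" using that(2) unfolding gap_def by linarith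
    from avoid_measure[OF E N this] obtain r where "x \<le> r" "r \<le> y" "r \<notin> E" "r \<notin> N" by blast
    then show ?thesis using that by (intro bexI[of _ r]) (auto simp: \<Gamma>_def)
  qed
  have u0: "unit_off B (\<lambda>z. f z - f 0)"
  proof (rule unit)
    show "\<not> (\<forall>\<^sub>\<approx>z\<in>UNIV. f z - f 0 = 0)"
    proof
      assume *: "\<forall>\<^sub>\<approx>z\<in>UNIV. f z - f 0 = 0"
      have "(\<lambda>z. f z - f 0) holomorphic_on UNIV" by (intro holomorphic_intros f)
      then have "f z - f 0 = 0" for z using * by (rule entire_zero_if_ae_zero)
      then have "f z = f 0" for z by simp
      then show False using nc by (auto simp: constant_on_def)
    qed
  qed (simp add: HS_def)
  obtain C where C: "\<And>r. D.good r \<Longrightarrow> ln r - C \<le> proximity_fun f r"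
    using D.prox_lower[OF f u0] by blast
  have unb: "\<exists>t\<in>\<Gamma>. x \<le> t \<and> K \<le> proximity_fun f t" for K x
  proof -
    define y where "y = max (max x r0) (exp (K + C))"
    have "r0 \<le> y" by (simp add: y_def)
    from \<Gamma>_dense[OF this order_refl] obtain t where t: "t \<in> \<Gamma>" "y \<le> t" by blast
    have "K + C \<le> ln t"
      using t by (intro ln_ge_iff[THEN iffD2]) (auto simp: y_def intro: less_le_trans[OF exp_gt_zero])
    then show ?thesis using C[OF \<Gamma>_good[OF t(1)]] t by (intro bexI[of _ t]) (auto simp: y_def)
  qed
  define \<beta> where "\<beta> = (1 - \<zeta>) / 2"
  have \<beta>: "0 < \<beta>" "\<beta> < 1" using \<zeta> by (auto simp: \<beta>_def)
  have "\<exists>t\<in>\<Gamma>. x \<le> t \<and> K \<le> proximity_fun f t \<and>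
      (\<forall>R\<in>\<Gamma>. t \<le> R \<longrightarrow> R \<le> t + t powr \<beta> \<longrightarrow> proximity_fun f R \<le> 2 * proximity_fun f t)" for x K
    unfolding \<beta>_def
    by (rule doubling_radius[OF \<zeta>(1,2) unb, of \<rho>])
       (use \<zeta>(3) in \<open>simp add: nevanlinna_char_entire[OF f]\<close>)
  \<comment> \<open>Taking the radius and the proximity function both at least \<open>k\<close>
    makes both sequences tend to infinity.\<close>
  then have "\<exists>X. \<forall>k::nat. X k \<in> \<Gamma> \<and> real k \<le> X k \<and> real k \<le> proximity_fun f (X k) \<and>
      (\<forall>R\<in>\<Gamma>. X k \<le> R \<longrightarrow> R \<le> X k + X k powr \<beta> \<longrightarrow> proximity_fun f R \<le> 2 * proximity_fun f (X k))"
    by (intro choice) blast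
  then obtain X where X: "\<And>k::nat. X k \<in> \<Gamma>" "\<And>k. real k \<le> X k" "\<And>k. real k \<le> proximity_fun f (X k)"
    "\<And>k R. R \<in> \<Gamma> \<Longrightarrow> X k \<le> R \<Longrightarrow> R \<le> X k + X k powr \<beta> \<Longrightarrow> proximity_fun f R \<le> 2 * proximity_fun f (X k)"
    by blast
  have lim: "filterlim X at_top sequentially" "filterlim (\<lambda>k. proximity_fun f (X k)) at_top sequentially"
    by (rule filterlim_at_top_mono[OF filterlim_real_sequentially], simp add: X)+
  have fu: "unit_off B f" by (rule unit[OF _ n_f]) (simp add: HS_def)
  interpret G: growth B r0 \<Gamma> X f c \<beta> gap
  proof unfold_locales
    show "z + c \<notin> B" if "r \<in> \<Gamma>" "norm z = r" for r z
    proof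
      assume "z + c \<in> B"
      then have "norm (z + c - c) \<in> N" unfolding N_def by blast
      then show False using that by (simp add: \<Gamma>_def)
    qed
  qed (use \<Gamma>_good \<Gamma>_dense X lim \<beta> fu f in blast)+

  have areg: "regular_off B a1" "regular_off B a2"
    using am by (auto simp: regular_off_def B_def)
  have small: "G.negl (\<lambda>k. D.Tm a (X k))" and tame: "\<forall>\<^sub>F k in sequentially. \<forall>R. G.near k R \<longrightarrow> D.Tm a R \<le> 2 * G.T0 k"
    if reg: "regular_off B a" and EE: "E' \<subseteq> E"
      and sm: "\<And>\<epsilon>. 0 < \<epsilon> \<Longrightarrow> \<exists>\<rho>. \<forall>r\<ge>\<rho>. r \<notin> E' \<longrightarrow> \<bar>nevanlinna_char a r\<bar> \<le> \<epsilon> * \<bar>nevanlinna_char f r\<bar>" for a E'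
  proof -
    have bound: "\<exists>\<rho>. \<forall>r\<ge>\<rho>. r \<in> \<Gamma> \<longrightarrow> D.Tm a r \<le> \<epsilon> * proximity_fun f r" if \<epsilon>: "0 < \<epsilon>" for \<epsilon>
    proof -
      obtain \<rho> where \<rho>: "\<And>r. \<rho> \<le> r \<Longrightarrow> r \<notin> E' \<Longrightarrow> \<bar>nevanlinna_char a r\<bar> \<le> \<epsilon> * \<bar>nevanlinna_char f r\<bar>"
        using sm[OF \<epsilon>] by blast
      have "D.Tm a r \<le> \<epsilon> * proximity_fun f r" if r: "\<rho> \<le> r" "r \<in> \<Gamma>" for r
      proof -
        have "r \<notin> E'" using r EE by (auto simp: \<Gamma>_def)
        moreover have "0 \<le> proximity_fun f r" by (rule D.prox_nonneg[OF unit_off_imp_regular[OF fu] \<Gamma>_good[OF r(2)]])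
        ultimately show ?thesis
          using \<rho>[OF r(1)] D.Tm_le_char[OF reg \<Gamma>_good[OF r(2)]] by (simp add: nevanlinna_char_entire[OF f])
      qed
      then show ?thesis by blast
    qed
    show "G.negl (\<lambda>k. D.Tm a (X k))" unfolding G.negl_def
    proof (intro allI impI)
      fix \<epsilon> :: real assume "0 < \<epsilon>"
      from bound[OF this] obtain \<rho> where \<rho>: "\<And>r. \<rho> \<le> r \<Longrightarrow> r \<in> \<Gamma> \<Longrightarrow> D.Tm a r \<le> \<epsilon> * proximity_fun f r" by blast
      show "\<forall>\<^sub>F k in sequentially. D.Tm a (X k) \<le> \<epsilon> * G.T0 k"
        by (rule eventually_mono[OF G.X_ge[of \<rho>]]) (simp add: G.T0_def \<rho> X)
    qed
    \<comment> \<open>Smallness with constant 1 at \<open>R\<close>, followed by doubling between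
      \<open>X k\<close> and \<open>R\<close>, gives the constant 2.\<close>
    from bound[of 1] obtain \<rho> where \<rho>: "\<And>r. \<rho> \<le> r \<Longrightarrow> r \<in> \<Gamma> \<Longrightarrow> D.Tm a r \<le> proximity_fun f r" by auto
    show "\<forall>\<^sub>F k in sequentially. \<forall>R. G.near k R \<longrightarrow> D.Tm a R \<le> 2 * G.T0 k"
    proof (rule eventually_mono[OF G.X_ge[of \<rho>]], intro allI impI)
      fix k R assume k: "\<rho> \<le> X k" and "G.near k R"
      then have R: "R \<in> \<Gamma>" "X k \<le> R" "R \<le> X k + X k powr \<beta> / 2" by (auto simp: G.near_def)
      have "0 \<le> X k powr \<beta>" by simp
      then have "R \<le> X k + X k powr \<beta>" using R(3) by linarith
      from X(4)[OF R(1,2) this] show "D.Tm a R \<le> 2 * G.T0 k"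
        using \<rho>[of R] R k unfolding G.T0_def by linarith
    qed
  qed
  have EE: "E1 \<subseteq> E" "E2 \<subseteq> E" by (auto simp: E_def)
  have t12: "\<exists>C. \<forall>\<^sub>F k in sequentially. \<forall>R. G.near k R \<longrightarrow> D.Tm a1 R + D.Tm a2 R \<le> C * G.T0 k"
  proof (intro exI[of _ 4] eventually_mono[OF eventually_conj[OF tame[OF areg(1) EE(1) E1(3)] tame[OF areg(2) EE(2) E2(3)]]] allI impI)
    fix k R
    assume "(\<forall>R. G.near k R \<longrightarrow> D.Tm a1 R \<le> 2 * G.T0 k) \<and> (\<forall>R. G.near k R \<longrightarrow> D.Tm a2 R \<le> 2 * G.T0 k)" "G.near k R"
    then have "D.Tm a1 R \<le> 2 * G.T0 k" "D.Tm a2 R \<le> 2 * G.T0 k" by blast+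
    then show "D.Tm a1 R + D.Tm a2 R \<le> 4 * G.T0 k" by linarith
  qed
  have units: "unit_off B g" "unit_off B (\<lambda>z. f z - g z)" "unit_off B (\<lambda>z. a2 z - a1 z)"
    "unit_off B (\<lambda>z. f z - a1 z)" "unit_off B (\<lambda>z. f z - a2 z)" "unit_off B (\<lambda>z. g z - a1 z)" "unit_off B (\<lambda>z. g z - a2 z)"
    using n_g n_p n_d n_fa[OF a1] n_fa[OF a2] n_ga[OF a1] n_ga[OF a2] s1 s2
    by (auto intro!: unit simp: HS_def g_def)
  interpret S: shared B r0 \<Gamma> X f c \<beta> gap a1 a2
    by unfold_locales
      (use E1(1) E2(1) areg units s1 s2 small[OF areg(1) EE(1) E1(3)] small[OF areg(2) EE(2) E2(3)] t12 in \<open>simp_all add: g_def\<close>)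
  show False
  proof (rule S.contradiction)
    fix n m :: nat assume nm: "n \<le> 4" "m \<le> 4"
    have "S.cross f = U" "S.cross g = V" unfolding S.cross_def [abs_def] U_def V_def by simp_all
    then have w: "S.w n m = W (n, m)"
      by (intro ext) (simp add: S.w_def S.ld_def W_def g_def[symmetric])
    have "W (n, m) \<in> HS" using nm by (simp add: HS_def)
    then show "unit_off B (S.w n m) \<or> (\<forall>z. z \<notin> B \<longrightarrow> S.w n m z = 0)"
      unfolding w using unit exceptional_set_zero[OF ex] by blast
  qed
qed

theorem corollary1p2:
  fixes f a1 a2 :: "complex \<Rightarrow> complex" and c :: complex
  assumes "f holomorphic_on UNIV"
    and "\<not> f constant_on UNIV"
    and "hyper_order f < 1"
    and "c \<noteq> 0"
    and "a1 \<in> small_functions f" and "a2 \<in> small_functions f"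
    and "a1 \<noteq> a2"
    and "((\<forall>z. a1 (z + c) = a1 z) \<and> (\<forall>z. a2 (z + c) = a2 z))
         \<or> \<not> mero_constant (\<lambda>z. deriv a1 z - deriv a2 z)"
    and "share_IM f (\<lambda>z. f (z + c)) a1"
    and "share_IM f (\<lambda>z. f (z + c)) a2"
  shows "\<forall>z. f z = f (z + c)"
  using assms(1-3,5-7,9-10) by (rule shared_small_functions_imp_periodic)

end
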